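(* Let $F=\mathbb F_q$ be a finite field of characteristic $p_F\ne 2,3$, let $B/F$ be a finite étale cubic algebra, let $T_B(F)=\{h\in B^\times:\operatorname{Norm}_{B/F}(h)=1\}$, let $H\subset T_B(F)$ be a subgroup of index $m$, let $g\in T_B(F)$, and let $\gamma\in B^\times$. Let $s\in F^\times$ satisfy $s^3=27\operatorname{Norm}_{B/F}(\gamma)$, and put $h_*=(s/3)\gamma^{-1}\in T_B(F)$. Then \[ N^{\rm nod}_{gH,B}(s;\gamma):=\#\{h\in gH:\operatorname{Tr}_{B/F}(\gamma h)=s\} =\frac{N_B^{\rm nod}(s,\operatorname{Norm}\gamma)}{m}\sum_{\chi\in H^\perp\cap\mathcal E_B}\chi(g^{-1}h_* )+R^{\rm nod}_{gH,B}(s;\gamma), \] where \[ |R^{\rm nod}_{gH,B}(s;\gamma)|\le \frac{m-|H^\perp\cap\mathcal E_B|}{m}\,(3\sqrt q+3). \]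
   Context: $N_B^{\rm nod}(s,n)=\#\{x\in B^\times:\operatorname{Tr}_{B/F}(x)=s,\ \operatorname{Norm}_{B/F}(x)=n\}$ for $s^3=27n$. $H^\perp$ is the set of complex characters $\chi:T_B(F)\to\mathbb C^\times$ with $\chi|_H=1$. Definition of $\mathcal E_B$: $T_B=\ker(\operatorname{Norm}:\operatorname{Res}_{B/F}\mathbf G_m\to\mathbf G_m)$ is a connected two-dimensional $F$-torus. Fix a prime $\ell\ne p_F$ and an isomorphism $\overline{\mathbb Q}_\ell\simeq\mathbb C$. For a character $\chi$ of $T_B(F)$, let $\mathcal L_\chi$ be the rank-one summand of $L_*\overline{\mathbb Q}_\ell$, where $L(t)=\mathrm{Frob}_q(t)t^{-1}$ is the Lang isogeny of $T_B$ (with deck group $T_B(F)$), normalized so that the trace of geometric Frobenius on its fiber at $h\in T_B(F)$ is $\chi(h)$. After base change to $\overline F$ and choosing an ordering of the three geometric embeddings of $B$, $T_{B,\overline F}=\{(t_1,t_2,t_3):t_1t_2t_3=1\}$. $\mathcal E_B$ is the set of characters $\chi$ of $T_B(F)$ such that $\mathcal L_\chi\otimes\overline F$ is isomorphic to a direct summand of $\pi_*\overline{\mathbb Q}_\ell$, where $\pi$ is the $\mu_3$-Kummer covering $u^3=t_2t_3^2$ of $T_{B,\overline F}$ (this includes the trivial character); it is a subgroup of the character group of $T_B(F)$. *)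

theory Defs
  imports
    "HOL-Analysis.Determinants"
    "HOL-Computational_Algebra.Polynomial_Factorial"
    "HOL-Algebra.Coset"
    "HOL-Algebra.Algebraic_Closure_Type"
begin

section \<open>Finite etale cubic algebras\<close>

definition is_ring_hom :: "('a::comm_ring_1 \<Rightarrow> 'b::comm_ring_1) \<Rightarrow> bool" where
  "is_ring_hom f \<longleftrightarrow>
     f 1 = 1 \<and> (\<forall>x y. f (x + y) = f x + f y) \<and> (\<forall>x y. f (x * y) = f x * f y)"

text \<open>An algebra \<open>B\<close> over \<open>F\<close> is a commutative ring type \<open>'b\<close> with a structure
  homomorphism \<open>\<iota>\<close> from the field type \<open>'f\<close>.\<close>

definition is_basis3 :: "('f::field \<Rightarrow> 'b::comm_ring_1) \<Rightarrow> (3 \<Rightarrow> 'b) \<Rightarrow> bool" where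
  "is_basis3 \<iota> \<beta> \<longleftrightarrow> (\<forall>x. \<exists>!c :: 3 \<Rightarrow> 'f. x = (\<Sum>i\<in>UNIV. \<iota> (c i) * \<beta> i))"

text \<open>The factor \<open>eB\<close> cut out by an idempotent \<open>e\<close> is a ring with unit \<open>e\<close>; a polynomial
  \<open>p\<close> over \<open>F\<close> evaluated at \<open>e * x\<close> in that ring is \<open>e * poly (map_poly \<iota> p) (e * x)\<close>.\<close>

definition separable_field_factor :: "('f::field \<Rightarrow> 'b::comm_ring_1) \<Rightarrow> 'b \<Rightarrow> bool" where
  "separable_field_factor \<iota> e \<longleftrightarrow>
     e \<noteq> 0 \<and> e * e = e \<and>
     (\<forall>x. e * x \<noteq> 0 \<longrightarrow> (\<exists>y. (e * x) * (e * y) = e)) \<and>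
     (\<forall>x. \<exists>p :: 'f poly. p \<noteq> 0 \<and> coprime p (pderiv p) \<and>
            e * poly (map_poly \<iota> p) (e * x) = 0)"

text \<open>Three-dimensional, and a finite product of separable field extensions of \<open>F\<close>.\<close>

definition etale_cubic :: "('f::field \<Rightarrow> 'b::comm_ring_1) \<Rightarrow> bool" where
  "etale_cubic \<iota> \<longleftrightarrow>
     is_ring_hom \<iota> \<and> (\<exists>\<beta>. is_basis3 \<iota> \<beta>) \<and>
     (\<exists>E. finite E \<and> (\<forall>e\<in>E. separable_field_factor \<iota> e) \<and>
          (\<forall>e\<in>E. \<forall>e'\<in>E. e \<noteq> e' \<longrightarrow> e * e' = 0) \<and> (\<Sum>e\<in>E. e) = 1)"

definition coords :: "('f::field \<Rightarrow> 'b::comm_ring_1) \<Rightarrow> (3 \<Rightarrow> 'b) \<Rightarrow> 'b \<Rightarrow> 3 \<Rightarrow> 'f" where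
  "coords \<iota> \<beta> x = (THE c. x = (\<Sum>i\<in>UNIV. \<iota> (c i) * \<beta> i))"

text \<open>The matrix of multiplication by \<open>x\<close> in a basis chosen once and for all; its trace and
  determinant do not depend on the choice.\<close>

definition mult_matrix :: "('f::field \<Rightarrow> 'b::comm_ring_1) \<Rightarrow> 'b \<Rightarrow> 'f^3^3" where
  "mult_matrix \<iota> x =
     (let \<beta> = (SOME \<beta>. is_basis3 \<iota> \<beta>) in (\<chi> i j. coords \<iota> \<beta> (x * \<beta> j) i))"

definition Tr :: "('f::field \<Rightarrow> 'b::comm_ring_1) \<Rightarrow> 'b \<Rightarrow> 'f" where
  "Tr \<iota> x = trace (mult_matrix \<iota> x)"

definition Nm :: "('f::field \<Rightarrow> 'b::comm_ring_1) \<Rightarrow> 'b \<Rightarrow> 'f" where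
  "Nm \<iota> x = det (mult_matrix \<iota> x)"

definition unit_inverse :: "'b::comm_ring_1 \<Rightarrow> 'b" where
  "unit_inverse x = (THE y. x * y = 1)"

section \<open>The group of norm-one elements and its characters\<close>

definition TB :: "('f::field \<Rightarrow> 'b::comm_ring_1) \<Rightarrow> 'b monoid" where
  "TB \<iota> = \<lparr>carrier = {h. h dvd 1 \<and> Nm \<iota> h = 1}, mult = (*), one = 1\<rparr>"

text \<open>Characters are normalised to vanish outside the group, so that distinct functions are
  distinct characters.\<close>

definition characters :: "('a, 'm) monoid_scheme \<Rightarrow> ('a \<Rightarrow> complex) set" where
  "characters G =
     {\<psi>. (\<forall>x\<in>carrier G. \<psi> x \<noteq> 0) \<and>
          (\<forall>x\<in>carrier G. \<forall>y\<in>carrier G. \<psi> (x \<otimes>\<^bsub>G\<^esub> y) = \<psi> x * \<psi> y) \<and>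
          (\<forall>x. x \<notin> carrier G \<longrightarrow> \<psi> x = 0)}"

definition annihilator :: "('a, 'm) monoid_scheme \<Rightarrow> 'a set \<Rightarrow> ('a \<Rightarrow> complex) set" where
  "annihilator G H = {\<psi> \<in> characters G. \<forall>h\<in>H. \<psi> h = 1}"

section \<open>The exceptional characters\<close>

definition geometric_embeddings ::
    "('f::field \<Rightarrow> 'b::comm_ring_1) \<Rightarrow> ('b \<Rightarrow> 'f alg_closure) set" where
  "geometric_embeddings \<iota> = {\<phi>. is_ring_hom \<phi> \<and> (\<forall>c. \<phi> (\<iota> c) = to_ac c)}"

text \<open>
  Let \<open>k\<close> be the algebraic closure of \<open>F\<close>. A lisse sheaf on the normal connected variety
  \<open>T = {t1 t2 t3 = 1}\<close> over \<open>k\<close> is the same as a representation of its fundamental group,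
  a quotient of the absolute Galois group of the function field \<open>K = k(t2,t3)\<close>, on the
  stalk at the geometric generic point. For a finite etale covering \<open>f\<close> of \<open>T\<close>, the direct
  image of the constant sheaf has as stalk the space of functions on the geometric generic
  fibre of \<open>f\<close>. All monodromy below is finite, and the coefficients, transported
  along an isomorphism between an algebraic closure of the \<open>l\<close>-adic numbers and the
  complex numbers, are complex.

  \<open>'f geom\<close> is an algebraic closure of \<open>K\<close>. The inner polynomial variable of \<open>K\<close> is
  \<open>t2\<close>, the outer one is \<open>t3\<close>. Indices lie in the three-element type \<open>3\<close>, so the index
  \<open>3\<close> is the index \<open>0\<close>.\<close>

type_synonym 'f funfield = "'f alg_closure poly poly fract"
type_synonym 'f geom = "'f funfield alg_closure"

definition const_geom :: "'f::field alg_closure \<Rightarrow> 'f geom" where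
  "const_geom c = to_ac (Fract [:[:c:]:] 1)"

definition torus :: "(3 \<Rightarrow> 'f::field geom) set" where
  "torus = {t. t 1 * t 2 * t 3 = 1}"

definition generic_point :: "3 \<Rightarrow> 'f::field geom" where
  "generic_point =
     (let t2 = to_ac (Fract [:[:0, 1:]:] 1); t3 = to_ac (Fract [:0, 1:] 1)
      in (\<lambda>i. if i = 2 then t2 else if i = 3 then t3 else inverse (t2 * t3)))"

text \<open>The Frobenius endomorphism of the \<open>F\<close>-scheme of units of \<open>B\<close> is
  \<open>id \<otimes> (\<lambda>x. x ^ q)\<close> on the tensor product of \<open>B\<close> with \<open>'f geom\<close>. In the coordinates
  given by the ordering \<open>e\<close> of the geometric embeddings, it raises the coordinates to the
  power \<open>q\<close> and permutes them in the way the \<open>q\<close>-power map permutes the embeddings.\<close>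

definition Frobenius ::
    "(3 \<Rightarrow> 'b \<Rightarrow> 'f::{field,finite} alg_closure) \<Rightarrow> (3 \<Rightarrow> 'f geom) \<Rightarrow> 3 \<Rightarrow> 'f geom" where
  "Frobenius e t = (\<lambda>i. t (THE j. \<forall>x. e i x = e j x ^ CARD('f)) ^ CARD('f))"

definition lang ::
    "(3 \<Rightarrow> 'b \<Rightarrow> 'f::{field,finite} alg_closure) \<Rightarrow> (3 \<Rightarrow> 'f geom) \<Rightarrow> 3 \<Rightarrow> 'f geom" where
  "lang e t = (\<lambda>i. Frobenius e t i * inverse (t i))"

definition kummer_cover :: "((3 \<Rightarrow> 'f::field geom) \<times> 'f geom) set" where
  "kummer_cover = {(t, u). t \<in> torus \<and> u ^ 3 = t 2 * t 3 ^ 2}"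

definition generic_fibre :: "'x set \<Rightarrow> ('x \<Rightarrow> 3 \<Rightarrow> 'f::field geom) \<Rightarrow> 'x set" where
  "generic_fibre Y f = {x \<in> Y. f x = generic_point}"

definition galois_group :: "('f::field geom \<Rightarrow> 'f geom) set" where
  "galois_group = {\<sigma>. bij \<sigma> \<and> is_ring_hom \<sigma> \<and> (\<forall>x :: 'f funfield. \<sigma> (to_ac x) = to_ac x)}"

definition act_torus ::
    "('f::field geom \<Rightarrow> 'f geom) \<Rightarrow> (3 \<Rightarrow> 'f geom) \<Rightarrow> (3 \<Rightarrow> 'f geom)" where
  "act_torus \<sigma> t = (\<lambda>i. \<sigma> (t i))"

definition act_kummer ::
    "('f::field geom \<Rightarrow> 'f geom) \<Rightarrow> (3 \<Rightarrow> 'f geom) \<times> 'f geom \<Rightarrow> (3 \<Rightarrow> 'f geom) \<times> 'f geom" where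
  "act_kummer \<sigma> = (\<lambda>(t, u). (act_torus \<sigma> t, \<sigma> u))"

text \<open>Functions on a fibre are represented by functions vanishing outside it.\<close>

definition functions_on :: "'x set \<Rightarrow> ('x \<Rightarrow> complex) set" where
  "functions_on Y = {v. \<forall>x. x \<notin> Y \<longrightarrow> v x = 0}"

definition act_fun :: "(('a \<Rightarrow> 'a) \<Rightarrow> 'x \<Rightarrow> 'x) \<Rightarrow> ('a \<Rightarrow> 'a) \<Rightarrow> ('x \<Rightarrow> complex) \<Rightarrow> ('x \<Rightarrow> complex)" where
  "act_fun act \<sigma> v = (\<lambda>x. v (act (inv_into UNIV \<sigma>) x))"

definition subrepresentation ::
    "'g set \<Rightarrow> ('g \<Rightarrow> ('x \<Rightarrow> complex) \<Rightarrow> ('x \<Rightarrow> complex)) \<Rightarrow>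
     ('x \<Rightarrow> complex) set \<Rightarrow> ('x \<Rightarrow> complex) set \<Rightarrow> bool" where
  "subrepresentation G \<rho> V W \<longleftrightarrow>
     V \<subseteq> W \<and> (\<lambda>x. 0) \<in> V \<and>
     (\<forall>v\<in>V. \<forall>w\<in>V. (\<lambda>x. v x + w x) \<in> V) \<and>
     (\<forall>c. \<forall>v\<in>V. (\<lambda>x. c * v x) \<in> V) \<and>
     (\<forall>\<sigma>\<in>G. \<forall>v\<in>V. \<rho> \<sigma> v \<in> V)"

definition rep_isomorphic ::
    "'g set \<Rightarrow> ('g \<Rightarrow> ('x \<Rightarrow> complex) \<Rightarrow> ('x \<Rightarrow> complex)) \<Rightarrow> ('x \<Rightarrow> complex) set \<Rightarrow>
     ('g \<Rightarrow> ('y \<Rightarrow> complex) \<Rightarrow> ('y \<Rightarrow> complex)) \<Rightarrow> ('y \<Rightarrow> complex) set \<Rightarrow> bool" where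
  "rep_isomorphic G \<rho> V \<rho>' V' \<longleftrightarrow>
     (\<exists>\<Phi>. bij_betw \<Phi> V V' \<and>
          (\<forall>v\<in>V. \<forall>w\<in>V. \<Phi> (\<lambda>x. v x + w x) = (\<lambda>y. \<Phi> v y + \<Phi> w y)) \<and>
          (\<forall>c. \<forall>v\<in>V. \<Phi> (\<lambda>x. c * v x) = (\<lambda>y. c * \<Phi> v y)) \<and>
          (\<forall>\<sigma>\<in>G. \<forall>v\<in>V. \<Phi> (\<rho> \<sigma> v) = \<rho>' \<sigma> (\<Phi> v)))"

definition direct_summand ::
    "'g set \<Rightarrow> ('g \<Rightarrow> ('x \<Rightarrow> complex) \<Rightarrow> ('x \<Rightarrow> complex)) \<Rightarrow>
     ('x \<Rightarrow> complex) set \<Rightarrow> ('x \<Rightarrow> complex) set \<Rightarrow> bool" where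
  "direct_summand G \<rho> V W \<longleftrightarrow>
     subrepresentation G \<rho> V W \<and>
     (\<exists>V'. subrepresentation G \<rho> V' W \<and> V \<inter> V' = {\<lambda>x. 0} \<and>
           (\<forall>w\<in>W. \<exists>v\<in>V. \<exists>v'\<in>V'. w = (\<lambda>x. v x + v' x)))"

text \<open>The summand of the direct image under the Lang isogeny belonging to \<open>\<psi>\<close>. On the fibre
  over a rational point \<open>h\<close>, the Frobenius endomorphism is translation by \<open>h\<close>, and geometric
  Frobenius takes a function \<open>v\<close> to \<open>\<lambda>y. v (h * y)\<close>; so the condition below is the one for
  which its trace is \<open>\<psi> h\<close>.\<close>

definition lang_sheaf ::
    "('f::{field,finite} \<Rightarrow> 'b::comm_ring_1) \<Rightarrow> (3 \<Rightarrow> 'b \<Rightarrow> 'f alg_closure) \<Rightarrow>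
     ('b \<Rightarrow> complex) \<Rightarrow> ((3 \<Rightarrow> 'f geom) \<Rightarrow> complex) set" where
  "lang_sheaf \<iota> e \<psi> =
     {v \<in> functions_on (generic_fibre torus (lang e)).
        \<forall>a\<in>carrier (TB \<iota>). \<forall>y\<in>generic_fibre torus (lang e).
          v (\<lambda>i. const_geom (e i a) * y i) = \<psi> a * v y}"

definition exceptional ::
    "('f::{field,finite} \<Rightarrow> 'b::comm_ring_1) \<Rightarrow> (3 \<Rightarrow> 'b \<Rightarrow> 'f alg_closure) \<Rightarrow>
     ('b \<Rightarrow> complex) set" where
  "exceptional \<iota> e =
     {\<psi> \<in> characters (TB \<iota>).
        \<exists>W. direct_summand (galois_group :: ('f geom \<Rightarrow> 'f geom) set) (act_fun act_kummer) W
              (functions_on (generic_fibre kummer_cover fst)) \<and>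
            rep_isomorphic (galois_group :: ('f geom \<Rightarrow> 'f geom) set)
              (act_fun act_torus) (lang_sheaf \<iota> e \<psi>) (act_fun act_kummer) W}"

section \<open>The nodal counts\<close>

definition N_nod :: "('f::field \<Rightarrow> 'b::comm_ring_1) \<Rightarrow> 'f \<Rightarrow> 'f \<Rightarrow> nat" where
  "N_nod \<iota> s n = card {x. x dvd 1 \<and> Tr \<iota> x = s \<and> Nm \<iota> x = n}"

definition N_nod_coset ::
    "('f::field \<Rightarrow> 'b::comm_ring_1) \<Rightarrow> 'b set \<Rightarrow> 'b \<Rightarrow> 'f \<Rightarrow> 'b \<Rightarrow> nat" where
  "N_nod_coset \<iota> H g s \<gamma> = card {h \<in> g <#\<^bsub>TB \<iota>\<^esub> H. Tr \<iota> (\<gamma> * h) = s}"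

definition h_star :: "('f::field \<Rightarrow> 'b::comm_ring_1) \<Rightarrow> 'f \<Rightarrow> 'b \<Rightarrow> 'b" where
  "h_star \<iota> s \<gamma> = \<iota> (s / 3) * unit_inverse \<gamma>"

end

theory Submission
  imports Defs
begin

text \<open>
  Scaling by \<open>h_*\<close> reduces the count to the points \<open>x\<close> of \<open>T_B(F)\<close> with trace \<open>3\<close>, a nodal
  cubic with node \<open>1\<close>. It is parametrised by \<open>x = d^3 / N(d)\<close>, where \<open>d\<close> runs over the units of
  trace \<open>0\<close> up to scalars; away from the node the parameter is \<open>d = x - 1\<close>. Hence a character
  \<open>\<psi>\<close> of \<open>T_B(F)\<close> is constant on the curve if it is trivial on all \<open>d^3 / N(d)\<close>. Otherwise
  \<open>d \<mapsto> \<psi> (d^3 / N(d))\<close> is a nontrivial character of the units of \<open>B\<close> that is trivial on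
  \<open>F\<close>, and its sum over the elements of trace \<open>0\<close> is a Gauss sum on \<open>B\<close>.

  The exceptional characters are exactly those trivial on all \<open>d^3 / N(d)\<close>. With
  \<open>M = q^6 - 1\<close> and \<open>M\<close>-th roots \<open>\<tau>_i\<close> of the coordinates \<open>t_i\<close>, a point of the Lang covering
  above the generic point is the product of the first six Frobenius iterates of \<open>\<tau>\<close>, and
  \<open>(\<tau>_2 \<tau>_3^2)^(M/3)\<close> is a point of the Kummer covering. A Galois element scaling \<open>\<tau>\<close> by
  \<open>\<zeta>\<close> fixes the Kummer fibre iff \<open>\<zeta>\<close> is \<open>d^3 / N(d)\<close> for a triple \<open>d\<close> of \<open>M\<close>-th roots of
  unity, and then it moves the Lang fibre by the image of the norm of \<open>d\<close>.
\<close>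

section \<open>Ring homomorphisms\<close>

text \<open>The Kummer covering is the isogeny in disguise: for \<open>t = d^3 / N(d)\<close> one
  has \<open>t_2 t_3^2 = (d_2 d_3^2 / N(d))^3\<close>, so \<open>u^3 = t_2 t_3^2\<close> is the
  degree-three isogeny from triples modulo scalars onto norm-one triples. It is symmetric in the
  coordinates although the exponents 0, 1, 2 are not, so the ordering of the embeddings drops out.
  The obstacle on the Lang side is that Frobenius permutes the coordinates while raising them to the
  power q. The sixth power of a permutation of three indices is the identity, so six Frobenius steps
  are a plain q^6-th power; this is the origin of M. The product over six steps telescopes: its
  Frobenius divided by itself is the M-th power of the input. The identity solves the Lang equation
  above the generic point, and on constants it makes every triple of M-th roots of unity give a
  point of B. As 3 divides M, both coverings can be read off from the same roots. Only the three
  conjugates are used, so B may be split, mixed or a field. The sum over the curve of a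
  nonexceptional character is at most sqrt q + 2, which lies below the stated 3 sqrt q + 3.\<close>

lemma ring_hom_simps:
  assumes "is_ring_hom f"
  shows "f 1 = 1" "f 0 = 0" "f (x + y) = f x + f y" "f (x * y) = f x * f y"
    "f (- x) = - f x" "f (x - y) = f x - f y" "f (x ^ n) = f x ^ n"
proof -
  show 1: "f 1 = 1" and a: "f (x + y) = f x + f y" and "f (x * y) = f x * f y" for x y
    using assms by (auto simp: is_ring_hom_def)
  show z: "f 0 = 0" using a[of 0 0] by simp
  show m: "f (- x) = - f x" for x using a[of x "- x"] z by (simp add: eq_neg_iff_add_eq_0 add.commute)
  show "f (x - y) = f x - f y" using a[of x "- y"] m by simp
  show "f (x ^ n) = f x ^ n"
    by (induction n) (use assms in \<open>auto simp: is_ring_hom_def\<close>)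
qed

lemma ring_hom_sum:
  assumes "is_ring_hom f" shows "f (sum g A) = (\<Sum>x\<in>A. f (g x))"
  by (induction A rule: infinite_finite_induct) (auto simp: ring_hom_simps[OF assms])

lemma ring_hom_prod:
  assumes "is_ring_hom f" shows "f (prod g A) = (\<Prod>x\<in>A. f (g x))"
  by (induction A rule: infinite_finite_induct) (auto simp: ring_hom_simps[OF assms])

lemma ring_hom_field_eq_0_iff:
  fixes f :: "'a::field \<Rightarrow> 'b::comm_ring_1"
  assumes "is_ring_hom f" shows "f x = 0 \<longleftrightarrow> x = 0"
proof
  assume "f x = 0"
  show "x = 0"
  proof (rule ccontr)
    assume "x \<noteq> 0"
    then have "f (x * inverse x) = 1" using ring_hom_simps(1)[OF assms] by simp
    with \<open>f x = 0\<close> show False by (simp add: ring_hom_simps[OF assms])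
  qed
qed (simp add: ring_hom_simps[OF assms])

lemma ring_hom_field_inj:
  fixes f :: "'a::field \<Rightarrow> 'b::comm_ring_1"
  assumes "is_ring_hom f" shows "inj f"
  using ring_hom_field_eq_0_iff[OF assms] ring_hom_simps(6)[OF assms]
  by (metis (no_types, lifting) injI right_minus_eq)

lemma ring_hom_inverse:
  fixes f :: "'a::field \<Rightarrow> 'b::field"
  assumes "is_ring_hom f" shows "f (inverse x) = inverse (f x)"
proof (cases "x = 0")
  case False
  then have "f x * f (inverse x) = 1"
    using ring_hom_simps(1,4)[OF assms] by (metis right_inverse)
  then show ?thesis by (metis inverse_unique)
qed (simp add: ring_hom_simps[OF assms])

lemma ring_hom_divide:
  fixes f :: "'a::field \<Rightarrow> 'b::field"
  assumes "is_ring_hom f" shows "f (x / y) = f x / f y"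
  by (simp add: divide_inverse ring_hom_simps[OF assms] ring_hom_inverse[OF assms])

lemma ring_hom_comp:
  "is_ring_hom f \<Longrightarrow> is_ring_hom g \<Longrightarrow> is_ring_hom (\<lambda>x. g (f x))"
  by (simp add: is_ring_hom_def)

lemma ring_hom_to_ac: "is_ring_hom (to_ac :: 'a::field \<Rightarrow> 'a alg_closure)"
  by (simp add: is_ring_hom_def)

lemma ring_hom_map_poly:
  assumes "is_ring_hom f" shows "is_ring_hom (map_poly f)"
  unfolding is_ring_hom_def
proof (intro conjI allI)
  note h = ring_hom_simps[OF assms]
  show "map_poly f 1 = 1" by (simp add: h)
  show "map_poly f (p + q) = map_poly f p + map_poly f q" for p q
    by (rule poly_eqI) (simp add: coeff_map_poly h)
  show "map_poly f (p * q) = map_poly f p * map_poly f q" for p q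
    by (rule poly_eqI) (simp add: coeff_map_poly h coeff_mult ring_hom_sum[OF assms])
qed

text \<open>A polynomial over an algebraically closed source splits into linear factors there, and
  the homomorphism carries this factorization along; hence the image polynomial acquires no new
  roots.\<close>

lemma map_poly_hom_root:
  fixes f :: "'a::alg_closed_field \<Rightarrow> 'b::field"
  assumes f: "is_ring_hom f" and "p \<noteq> 0" and "poly (map_poly f p) y = 0"
  shows "\<exists>x. poly p x = 0 \<and> y = f x"
proof -
  from alg_closed_imp_factorization[OF \<open>p \<noteq> 0\<close>]
  obtain A where p: "p = smult (Polynomial.lead_coeff p) (\<Prod>x\<in>#A. [:- x, 1:])" by blast
  have *: "map_poly f (smult c (\<Prod>x\<in>#A. [:- x, 1:])) = smult (f c) (\<Prod>x\<in>#A. [:- f x, 1:])" for c A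
  proof (induction A)
    case empty
    show ?case by (simp add: map_poly_pCons ring_hom_simps[OF f])
  next
    case (add x A)
    have "smult c (\<Prod>x\<in>#add_mset x A. [:- x, 1:]) = [:- x, 1:] * smult c (\<Prod>x\<in>#A. [:- x, 1:])"
      by simp
    then show ?case
      using add by (simp only: ring_hom_simps[OF ring_hom_map_poly[OF f]])
        (simp add: map_poly_pCons ring_hom_simps[OF f])
  qed
  have "f (Polynomial.lead_coeff p) \<noteq> 0" using \<open>p \<noteq> 0\<close> by (simp add: ring_hom_field_eq_0_iff[OF f])
  moreover have "poly (map_poly f p) y = f (Polynomial.lead_coeff p) * (\<Prod>x\<in>#A. y - f x)"
    by (subst p, subst *) (simp add: poly_prod_mset)
  ultimately have "(\<Prod>x\<in>#A. y - f x) = 0" using assms(3) by simp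
  then obtain x where x: "x \<in># A" "y = f x" by (auto simp: prod_mset_zero_iff)
  then have "poly p x = 0" by (subst p) (auto simp: poly_prod_mset prod_mset_zero_iff)
  with x show ?thesis by blast
qed

text \<open>Coefficients in the range can be pulled back along the injective \<open>f\<close>, and
  then all roots come from the source. For endomorphisms of an algebraic closure this yields
  surjectivity from their effect on a subfield.\<close>

lemma ring_hom_surj_if_algebraic:
  fixes f :: "'a::alg_closed_field \<Rightarrow> 'b::field"
  assumes f: "is_ring_hom f"
    and alg: "\<And>y. \<exists>p. p \<noteq> 0 \<and> (\<forall>i. poly.coeff p i \<in> range f) \<and> poly p y = 0"
  shows "surj f"
  unfolding surj_def
proof
  fix y
  obtain p where p: "p \<noteq> 0" "\<And>i. poly.coeff p i \<in> range f" "poly p y = 0" using alg by blast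
  define s where "s = map_poly (inv_into UNIV f) p"
  have i: "inv_into UNIV f 0 = 0"
    using ring_hom_field_inj[OF f] ring_hom_simps(2)[OF f] by (metis inv_f_f)
  have "map_poly f s = p"
    by (rule poly_eqI) (simp add: s_def coeff_map_poly i ring_hom_simps[OF f] f_inv_into_f p)
  then show "\<exists>x. y = f x" using map_poly_hom_root[OF f, of s y] p by force
qed

section \<open>Extension of homomorphisms to an algebraic extension\<close>

text \<open>A homomorphism from a subring is handled through its graph, a subring of the square.\<close>

definition hom_graph :: "('o::field \<times> 'o) set \<Rightarrow> bool" where
  "hom_graph R \<longleftrightarrow>
     (\<forall>a b c d. (a, b) \<in> R \<longrightarrow> (c, d) \<in> R \<longrightarrow> (a + c, b + d) \<in> R \<and> (a * c, b * d) \<in> R) \<and>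
     (\<forall>a b. (a, b) \<in> R \<longrightarrow> (- a, - b) \<in> R) \<and>
     (\<forall>b. (0, b) \<in> R \<longrightarrow> b = 0)"

definition coeffs_in :: "('o::field \<times> 'o) set \<Rightarrow> 'o poly \<Rightarrow> 'o poly \<Rightarrow> bool" where
  "coeffs_in R f g \<longleftrightarrow> (\<forall>i. (poly.coeff f i, poly.coeff g i) \<in> R)"

lemma hom_graph_sum:
  assumes "hom_graph R" "(0, 0) \<in> R" "\<And>i. i \<in> A \<Longrightarrow> (f i, g i) \<in> R"
  shows "(sum f A, sum g A) \<in> R"
  using assms(3)
  by (induction A rule: infinite_finite_induct)
    (use assms(1,2) in \<open>auto simp: hom_graph_def\<close>)

lemma coeffs_in_poly:
  assumes R: "hom_graph R" "(0, 0) \<in> R"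
  shows "coeffs_in R f g \<Longrightarrow> (x, z) \<in> R \<Longrightarrow> (poly f x, poly g z) \<in> R"
proof (induction "max (Polynomial.degree f) (Polynomial.degree g)" arbitrary: f g rule: less_induct)
  case less
  obtain a f' where f: "f = pCons a f'" by (cases f)
  obtain b g' where g: "g = pCons b g'" by (cases g)
  have ab: "(a, b) \<in> R" using less.prems(1) unfolding coeffs_in_def f g
    by (metis coeff_pCons_0)
  have c: "coeffs_in R f' g'" using less.prems(1) unfolding coeffs_in_def f g
    by (metis coeff_pCons_Suc)
  show ?case
  proof (cases "f' = 0 \<and> g' = 0")
    case True
    then show ?thesis using ab by (simp add: f g)
  next
    case False
    have "max (Polynomial.degree f') (Polynomial.degree g') < max (Polynomial.degree f) (Polynomial.degree g)"
      using False by (auto simp: f g degree_pCons_eq_if)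
    from less.hyps[OF this c less.prems(2)] show ?thesis
      using ab less.prems(2) R unfolding hom_graph_def f g by simp
  qed
qed

text \<open>The new element is sent to a root of the image of a polynomial of least degree killing
  it. The domain of the graph is only a ring, so division with remainder is replaced by
  pseudo-division, which never inverts a leading coefficient.\<close>

lemma hom_graph_extend_one:
  assumes R: "hom_graph R" "(0, 0) \<in> R" "(1, 1) \<in> R"
    and inj: "\<And>a. (a, 0) \<in> R \<Longrightarrow> a = 0"
    and alg: "\<exists>f g. coeffs_in R f g \<and> f \<noteq> 0 \<and> poly f x = 0"
  shows "\<exists>R' z. hom_graph R' \<and> R \<subseteq> R' \<and> (x, z :: 'o::alg_closed_field) \<in> R'"
proof -
  let ?P = "\<lambda>f. f \<noteq> 0 \<and> poly f x = 0 \<and> (\<exists>g. coeffs_in R f g)"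
  obtain p where "?P p" and min: "\<And>f. ?P f \<Longrightarrow> Polynomial.degree p \<le> Polynomial.degree f"
    using ex_has_least_nat[of ?P _ Polynomial.degree] alg by blast
  then obtain p' where p: "p \<noteq> 0" "poly p x = 0" "coeffs_in R p p'" by blast
  have cl: "(a + c, b + d) \<in> R" "(a * c, b * d) \<in> R" "(- a, - b) \<in> R"
    if "(a, b) \<in> R" "(c, d) \<in> R" for a b c d
    using R that by (auto simp: hom_graph_def)
  have zero: "a = 0 \<longleftrightarrow> b = 0" if "(a, b) \<in> R" for a b
    using R that inj by (auto simp: hom_graph_def)
  have deg: "Polynomial.degree f = Polynomial.degree g" if "coeffs_in R f g" for f g
  proof -
    have "poly.coeff f i = 0 \<longleftrightarrow> poly.coeff g i = 0" for i
      using that zero unfolding coeffs_in_def by blast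
    then show ?thesis unfolding Polynomial.degree_def by simp
  qed
  have "Polynomial.degree p \<noteq> 0" using p by (metis degree_eq_zeroE poly_const_conv pCons_0_0)
  then obtain z where z: "poly p' z = 0"
    using alg_closed_imp_poly_has_root[of p'] deg[OF p(3)] by auto
  have Padd: "coeffs_in R (f1 + f2) (g1 + g2)" if "coeffs_in R f1 g1" "coeffs_in R f2 g2" for f1 f2 g1 g2
    using that cl unfolding coeffs_in_def by simp
  have Pmult: "coeffs_in R (f1 * f2) (g1 * g2)" if "coeffs_in R f1 g1" "coeffs_in R f2 g2" for f1 f2 g1 g2
    using that cl unfolding coeffs_in_def coeff_mult by (auto intro!: hom_graph_sum[OF R(1,2)])
  have Pminus: "coeffs_in R (- f1) (- g1)" if "coeffs_in R f1 g1" for f1 g1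
    using that R(1) unfolding coeffs_in_def hom_graph_def by simp
  have Pmonom: "coeffs_in R (Polynomial.monom a n) (Polynomial.monom b n)" if "(a, b) \<in> R" for a b n
    using that R unfolding coeffs_in_def by auto
  have key: "poly g z = 0" if "coeffs_in R f g" "poly f x = 0" for f g
    using that
  proof (induction "Polynomial.degree f" arbitrary: f g rule: less_induct)
    case less
    show ?case
    proof (cases "f = 0")
      case True
      then have "g = 0" using less.prems zero unfolding coeffs_in_def
        by (metis coeff_0 poly_eqI)
      then show ?thesis by simp
    next
      case False
      then have le: "Polynomial.degree p \<le> Polynomial.degree f" using less.prems min by blast
      let ?k = "Polynomial.degree f - Polynomial.degree p"
      \<comment> \<open>Pseudo-division: cross-multiplying by the leading coefficients cancels the
        top terms of \<open>f\<close> and \<open>p\<close>; \<open>g'\<close> performs the same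
        operation on the images.\<close>
      define f' where "f' = Polynomial.monom (Polynomial.lead_coeff p) 0 * f - Polynomial.monom (Polynomial.lead_coeff f) ?k * p"
      define g' where "g' = Polynomial.monom (Polynomial.lead_coeff p') 0 * g - Polynomial.monom (Polynomial.lead_coeff g) ?k * p'"
      have l: "(Polynomial.lead_coeff p, Polynomial.lead_coeff p') \<in> R" "(Polynomial.lead_coeff f, Polynomial.lead_coeff g) \<in> R"
        using deg[OF p(3)] deg[OF less.prems(1)] p(3) less.prems(1) unfolding coeffs_in_def
        by metis+
      have c': "coeffs_in R f' g'"
        unfolding f'_def g'_def diff_conv_add_uminus
        by (intro Padd Pminus Pmult Pmonom l p less.prems)
      have r': "poly f' x = 0" using p less.prems by (simp add: f'_def)
      have "poly g' z = 0"
      proof (cases "f' = 0")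
        case True
        then have "g' = 0" using c' zero unfolding coeffs_in_def
          by (metis coeff_0 poly_eqI)
        then show ?thesis by simp
      next
        case False
        have d: "Polynomial.degree f' < Polynomial.degree f"
        proof -
          have "Polynomial.degree f > 0" using \<open>Polynomial.degree p \<noteq> 0\<close> le by simp
          have "Polynomial.degree f' \<le> Polynomial.degree f"
            unfolding f'_def
            by (intro degree_diff_le order.trans[OF degree_mult_le])
               (use le degree_monom_le[of "Polynomial.lead_coeff f" ?k]
                 degree_monom_le[of "Polynomial.lead_coeff p" 0] in auto)
          moreover have "poly.coeff f' (Polynomial.degree f) = 0"
            using le by (simp add: f'_def coeff_monom_mult)
          ultimately show ?thesis using False
            by (metis leading_coeff_0_iff le_neq_implies_less)
        qed
        show ?thesis by (rule less.hyps[OF d c' r'])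
      qed
      then have "Polynomial.lead_coeff p' * poly g z = 0" using z by (simp add: g'_def poly_monom)
      moreover have "Polynomial.lead_coeff p' \<noteq> 0" using zero[OF l(1)] p(1) by simp
      ultimately show ?thesis by simp
    qed
  qed
  define R' where "R' = {(poly f x, poly g z) | f g. coeffs_in R f g}"
  have "hom_graph R'"
    unfolding hom_graph_def
  proof (intro conjI allI impI)
    fix a b c d assume "(a, b) \<in> R'" "(c, d) \<in> R'"
    then obtain f g f' g' where c: "coeffs_in R f g" "coeffs_in R f' g'"
      and e: "a = poly f x" "b = poly g z" "c = poly f' x" "d = poly g' z" by (auto simp: R'_def)
    have "(poly (f + f') x, poly (g + g') z) \<in> R'" "(poly (f * f') x, poly (g * g') z) \<in> R'"
      unfolding R'_def using Padd[OF c] Pmult[OF c] by blast+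
    then show "(a + c, b + d) \<in> R'" "(a * c, b * d) \<in> R'" by (simp_all add: e)
  next
    fix a b assume "(a, b) \<in> R'"
    then obtain f g where c: "coeffs_in R f g" and e: "a = poly f x" "b = poly g z"
      by (auto simp: R'_def)
    have "(poly (- f) x, poly (- g) z) \<in> R'" unfolding R'_def using Pminus[OF c] by blast
    then show "(- a, - b) \<in> R'" by (simp add: e)
  next
    fix b assume "(0, b) \<in> R'"
    then show "b = 0" using key unfolding R'_def by auto
  qed
  moreover have "R \<subseteq> R'"
  proof clarify
    fix a b assume "(a, b) \<in> R"
    then have "(poly (Polynomial.monom a 0) x, poly (Polynomial.monom b 0) z) \<in> R'" unfolding R'_def using Pmonom by blast
    then show "(a, b) \<in> R'" by (simp add: poly_monom)
  qed
  moreover have "(x, z) \<in> R'"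
  proof -
    have "(poly (Polynomial.monom 1 1) x, poly (Polynomial.monom 1 1) z) \<in> R'"
      unfolding R'_def using Pmonom[OF R(3)] by blast
    then show ?thesis by (simp add: poly_monom)
  qed
  ultimately show ?thesis by blast
qed

text \<open>Zorn on the graphs containing that of \<open>\<Phi> a \<mapsto> \<Phi>' a\<close>: a
  maximal graph is total, since any further element would be algebraic and could be
  adjoined.\<close>

theorem ring_hom_extend:
  fixes \<Phi> \<Phi>' :: "'l::field \<Rightarrow> 'o::alg_closed_field"
  assumes h: "is_ring_hom \<Phi>" and h': "is_ring_hom \<Phi>'"
    and alg: "\<And>x. \<exists>p. p \<noteq> 0 \<and> poly (map_poly \<Phi> p) x = 0"
  shows "\<exists>\<tau>. is_ring_hom \<tau> \<and> (\<forall>a. \<tau> (\<Phi> a) = \<Phi>' a)"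
proof -
  define R0 where "R0 = {(\<Phi> a, \<Phi>' a) | a. True}"
  let ?C = "{R. hom_graph R \<and> R0 \<subseteq> R}"
  note hs = ring_hom_simps[OF h] and hs' = ring_hom_simps[OF h']
  have R0: "hom_graph R0"
    unfolding hom_graph_def
  proof (intro conjI allI impI)
    fix a b c d assume "(a, b) \<in> R0" "(c, d) \<in> R0"
    then obtain x y where "a = \<Phi> x" "b = \<Phi>' x" "c = \<Phi> y" "d = \<Phi>' y" by (auto simp: R0_def)
    then show "(a + c, b + d) \<in> R0" "(a * c, b * d) \<in> R0"
      by (auto simp: R0_def hs(3,4)[symmetric] hs'(3,4)[symmetric])
  next
    fix a b assume "(a, b) \<in> R0"
    then show "(- a, - b) \<in> R0" by (auto simp: R0_def hs(5)[symmetric] hs'(5)[symmetric])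
  next
    fix b assume "(0, b) \<in> R0"
    then obtain x where "\<Phi> x = 0" "b = \<Phi>' x" by (auto simp: R0_def)
    then show "b = 0" using ring_hom_field_eq_0_iff[OF h] hs'(2) by simp
  qed
  have "\<exists>M\<in>?C . \<forall>Z\<in>?C . M \<subseteq> Z \<longrightarrow> Z = M"
  proof (rule subset_Zorn)
    fix C assume C: "subset.chain ?C C"
    show "\<exists>U\<in>?C . \<forall>Z\<in>C. Z \<subseteq> U"
    proof (cases "C = {}")
      case True
      then show ?thesis using R0 by blast
    next
      case False
      have 1: "\<exists>Z\<in>C. r \<in> Z \<and> s \<in> Z" if "r \<in> \<Union>C" "s \<in> \<Union>C" for r s
        using that C unfolding subset.chain_def by blast
      have 2: "hom_graph Z" "R0 \<subseteq> Z" if "Z \<in> C" for Z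
        using that C unfolding subset.chain_def by auto
      have "hom_graph (\<Union>C)"
        unfolding hom_graph_def
      proof (intro conjI allI impI)
        fix a b c d assume "(a, b) \<in> \<Union>C" "(c, d) \<in> \<Union>C"
        then obtain Z where "Z \<in> C" "(a, b) \<in> Z" "(c, d) \<in> Z" using 1 by blast
        then show "(a + c, b + d) \<in> \<Union>C" "(a * c, b * d) \<in> \<Union>C"
          using 2(1) unfolding hom_graph_def by blast+
      qed (use 2(1) in \<open>auto simp: hom_graph_def\<close>)
      moreover have "R0 \<subseteq> \<Union>C" using 2 False by blast
      ultimately show ?thesis by blast
    qed
  qed
  then obtain R where R: "hom_graph R" "R0 \<subseteq> R"
    and max: "\<And>Z. hom_graph Z \<Longrightarrow> R \<subseteq> Z \<Longrightarrow> Z = R" by fastforce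
  have "(\<Phi> 0, \<Phi>' 0) \<in> R" "(\<Phi> 1, \<Phi>' 1) \<in> R" using R(2) unfolding R0_def by blast+
  then have 00: "(0, 0) \<in> R" and 11: "(1, 1) \<in> R" by (simp_all add: hs hs')
  have lift: "coeffs_in R (map_poly \<Phi> p) (map_poly \<Phi>' p)" for p
    using R(2) unfolding coeffs_in_def R0_def by (auto simp: coeff_map_poly hs hs')
  \<comment> \<open>Injectivity rests on algebraicity: a nonzero \<open>a\<close> has an
    annihilating polynomial of least degree, whose constant term \<open>c\<close> is nonzero; if
    \<open>a\<close> went to 0, evaluating that polynomial would send 0 to
    \<open>\<Phi>' c\<close>.\<close>
  have inj: "a = 0" if "(a, 0) \<in> R" for a
  proof (rule ccontr)
    assume "a \<noteq> 0"
    let ?P = "\<lambda>p. p \<noteq> 0 \<and> poly (map_poly \<Phi> p) a = 0"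
    obtain p where "?P p" and min: "\<And>f. ?P f \<Longrightarrow> Polynomial.degree p \<le> Polynomial.degree f"
      using ex_has_least_nat[of ?P _ Polynomial.degree] alg[of a] by blast
    obtain c p1 where p: "p = pCons c p1" by (cases p)
    have "c \<noteq> 0"
    proof
      assume "c = 0"
      then have "?P p1" using \<open>?P p\<close> \<open>a \<noteq> 0\<close> p by (auto simp: map_poly_pCons hs)
      then show False using min[of p1] \<open>c = 0\<close> p by (simp add: degree_pCons_eq_if)
    qed
    have "(poly (map_poly \<Phi> p) a, poly (map_poly \<Phi>' p) 0) \<in> R"
      by (rule coeffs_in_poly[OF R(1) 00 lift that])
    then have "\<Phi>' c = 0" using R(1) \<open>?P p\<close> by (auto simp: p map_poly_pCons hs' hom_graph_def)
    with \<open>c \<noteq> 0\<close> show False by (simp add: ring_hom_field_eq_0_iff[OF h'])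
  qed
  have total: "\<exists>z. (x, z) \<in> R" for x
  proof -
    obtain p where p: "p \<noteq> 0" "poly (map_poly \<Phi> p) x = 0" using alg by blast
    have "map_poly \<Phi> p \<noteq> 0"
      using p by (subst map_poly_eq_0_iff) (auto simp: hs ring_hom_field_eq_0_iff[OF h])
    then show ?thesis
      using hom_graph_extend_one[OF R(1) 00 11 inj, of x] lift[of p] p(2) max by blast
  qed
  have uniq: "z = z'" if "(x, z) \<in> R" "(x, z') \<in> R" for x z z'
  proof -
    have "(- x, - z') \<in> R" using that R(1) unfolding hom_graph_def by blast
    then have "(x + - x, z + - z') \<in> R" using that R(1) unfolding hom_graph_def by blast
    then have "(0, z - z') \<in> R" by simp
    then have "z - z' = 0" using R(1) unfolding hom_graph_def by blast
    then show ?thesis by simp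
  qed
  define \<tau> where "\<tau> x = (SOME z. (x, z) \<in> R)" for x
  have \<tau>: "(x, \<tau> x) \<in> R" for x unfolding \<tau>_def using total by (rule someI_ex)
  have "is_ring_hom \<tau>"
    unfolding is_ring_hom_def
  proof (intro conjI allI)
    show "\<tau> 1 = 1" by (rule uniq[OF \<tau> 11])
    fix x y
    have "(x + y, \<tau> x + \<tau> y) \<in> R" "(x * y, \<tau> x * \<tau> y) \<in> R"
      using R(1) \<tau>[of x] \<tau>[of y] unfolding hom_graph_def by blast+
    then show "\<tau> (x + y) = \<tau> x + \<tau> y" "\<tau> (x * y) = \<tau> x * \<tau> y"
      using uniq[OF \<tau>] by blast+
  qed
  moreover have "\<tau> (\<Phi> a) = \<Phi>' a" for a
    using \<tau> uniq R(2) unfolding R0_def by blast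
  ultimately show ?thesis by blast
qed

section \<open>The function field of the torus\<close>

lemma fract_hom_lift:
  fixes f :: "'a::idom \<Rightarrow> 'b::field"
  assumes f: "is_ring_hom f" and inj: "\<And>x. f x = 0 \<Longrightarrow> x = 0"
  shows "\<exists>h. is_ring_hom h \<and> (\<forall>a. h (Fract a 1) = f a)"
proof -
  define rep where "rep z = (SOME ab. snd ab \<noteq> 0 \<and> z = Fract (fst ab) (snd ab))" for z :: "'a fract"
  define h where "h z = f (fst (rep z)) / f (snd (rep z))" for z
  note fs = ring_hom_simps[OF f]
  have h: "h (Fract a b) = f a / f b" if "b \<noteq> 0" for a b
  proof -
    have "\<exists>ab. snd ab \<noteq> 0 \<and> Fract a b = Fract (fst ab) (snd ab)"
      using that by (intro exI[of _ "(a, b)"]) simp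
    then have r: "snd (rep (Fract a b)) \<noteq> 0"
      "Fract a b = Fract (fst (rep (Fract a b))) (snd (rep (Fract a b)))"
      unfolding rep_def by (metis (mono_tags, lifting) someI_ex)+
    then have "a * snd (rep (Fract a b)) = fst (rep (Fract a b)) * b"
      using that by (metis eq_fract(1))
    then have "f a * f (snd (rep (Fract a b))) = f (fst (rep (Fract a b))) * f b"
      by (metis fs(4))
    then show ?thesis using r(1) that inj unfolding h_def
      by (metis (no_types, lifting) frac_eq_eq)
  qed
  have nz: "f b \<noteq> 0" if "b \<noteq> 0" for b using that inj by blast
  have "is_ring_hom h"
    unfolding is_ring_hom_def
  proof (intro conjI allI)
    show "h 1 = 1" by (simp add: One_fract_def h fs)
    fix x y :: "'a fract"
    obtain a b where x: "x = Fract a b" "b \<noteq> 0" by (cases x)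
    obtain c d where y: "y = Fract c d" "d \<noteq> 0" by (cases y)
    show "h (x + y) = h x + h y" using x y nz by (simp add: h fs field_simps)
    show "h (x * y) = h x * h y" using x y nz by (simp add: h fs field_simps)
  qed
  then show ?thesis using h[of 1] by (auto simp: fs)
qed

definition tgen2 :: "'f::field geom" where "tgen2 = to_ac (Fract [:[:0, 1:]:] 1)"
definition tgen3 :: "'f::field geom" where "tgen3 = to_ac (Fract [:0, 1:] 1)"

lemma generic_point_eq:
  "generic_point = (\<lambda>i. if i = 2 then tgen2 else if i = 3 then tgen3 else inverse (tgen2 * tgen3))"
  unfolding generic_point_def tgen2_def tgen3_def Let_def ..

lemma ring_hom_Fract: "is_ring_hom (\<lambda>p :: 'a::idom. Fract p 1)"
  by (simp add: is_ring_hom_def One_fract_def)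

lemma ring_hom_pConst: "is_ring_hom (\<lambda>c :: 'a::comm_ring_1. [:c:])"
  by (simp add: is_ring_hom_def one_pCons)

lemma ring_hom_const_geom: "is_ring_hom (const_geom :: 'f::field alg_closure \<Rightarrow> 'f geom)"
proof -
  have "is_ring_hom (\<lambda>c :: 'f alg_closure. to_ac (Fract [:[:c:]:] 1))"
    by (intro ring_hom_comp[OF _ ring_hom_to_ac] ring_hom_comp[OF _ ring_hom_Fract]
        ring_hom_comp[OF ring_hom_pConst ring_hom_pConst])
  then show ?thesis by (simp add: const_geom_def[abs_def])
qed

lemmas const_geom_simps = ring_hom_simps[OF ring_hom_const_geom]
  ring_hom_inverse[OF ring_hom_const_geom] ring_hom_divide[OF ring_hom_const_geom]

lemma const_geom_eq_iff [simp]: "const_geom a = const_geom b \<longleftrightarrow> a = b"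
  by (rule inj_eq[OF ring_hom_field_inj[OF ring_hom_const_geom]])

lemma const_geom_eq_0_iff [simp]: "const_geom a = 0 \<longleftrightarrow> a = 0"
  by (rule ring_hom_field_eq_0_iff[OF ring_hom_const_geom])

lemma tgen_nz: "tgen2 \<noteq> 0" "tgen3 \<noteq> 0"
  by (simp_all add: tgen2_def tgen3_def Zero_fract_def eq_fract)

text \<open>The function field is generated by the constants and the two coordinates: polynomials in
  \<open>tgen2\<close> come first, then polynomials in \<open>tgen3\<close> over them, then
  quotients. Claims about the whole function field thus reduce to generators.\<close>

lemma to_ac_in_subfield:
  fixes S :: "'f::field geom set"
  assumes c: "\<And>c. const_geom c \<in> S" and t: "tgen2 \<in> S" "tgen3 \<in> S"
    and cl: "\<And>x y. x \<in> S \<Longrightarrow> y \<in> S \<Longrightarrow> x + y \<in> S" "\<And>x y. x \<in> S \<Longrightarrow> y \<in> S \<Longrightarrow> x * y \<in> S"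
      "\<And>x. x \<in> S \<Longrightarrow> inverse x \<in> S"
  shows "to_ac x \<in> S"
proof -
  note hF = ring_hom_comp[OF ring_hom_Fract ring_hom_to_ac]
  have 0: "0 \<in> S" using c[of 0] by (simp add: const_geom_simps)
  have inner: "to_ac (Fract [:r:] 1) \<in> S" for r :: "'f alg_closure poly"
  proof (induction r)
    case 0
    show ?case using \<open>0 \<in> S\<close> by (simp add: Zero_fract_def[symmetric])
  next
    case (pCons a r)
    have "[:pCons a r:] = [:[:a:]:] + [:[:0, 1:]:] * [:r:]" by simp
    then have "to_ac (Fract [:pCons a r:] 1) = const_geom a + tgen2 * to_ac (Fract [:r:] 1)"
      by (simp only: ring_hom_simps[OF hF] const_geom_def tgen2_def)
    then show ?case using pCons c t cl by simp
  qed
  have outer: "to_ac (Fract p 1) \<in> S" for p :: "'f alg_closure poly poly"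
  proof (induction p)
    case 0
    show ?case using \<open>0 \<in> S\<close> by (simp add: Zero_fract_def[symmetric])
  next
    case (pCons a r)
    have "pCons a r = [:a:] + [:0, 1:] * r" by simp
    then have "to_ac (Fract (pCons a r) 1) = to_ac (Fract [:a:] 1) + tgen3 * to_ac (Fract r 1)"
      by (simp only: ring_hom_simps[OF hF] tgen3_def)
    then show ?case using pCons inner t cl by simp
  qed
  obtain a b where x: "x = Fract a b" "b \<noteq> 0" by (cases x)
  then have "x = Fract a 1 * inverse (Fract b 1)" by simp
  then have "to_ac x = to_ac (Fract a 1) * inverse (to_ac (Fract b 1))"
    by (simp only: to_ac_mult to_ac_inverse)
  then show ?thesis using outer cl by simp
qed

text \<open>An endomorphism fixing the generators fixes the whole function field, over which
  everything is algebraic, so bijectivity comes for free.\<close>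

lemma galois_groupI:
  fixes \<sigma> :: "'f::field geom \<Rightarrow> 'f geom"
  assumes h: "is_ring_hom \<sigma>" and c: "\<And>c. \<sigma> (const_geom c) = const_geom c"
    and t: "\<sigma> tgen2 = tgen2" "\<sigma> tgen3 = tgen3"
  shows "\<sigma> \<in> galois_group"
proof -
  have fx: "\<sigma> (to_ac x) = to_ac x" for x :: "'f funfield"
    using to_ac_in_subfield[of "{x. \<sigma> x = x}" x] c t
    by (simp add: ring_hom_simps[OF h] ring_hom_inverse[OF h])
  have "surj \<sigma>"
  proof (rule ring_hom_surj_if_algebraic[OF h])
    fix y :: "'f geom"
    obtain p where p: "p \<noteq> 0" "poly (map_poly to_ac p) y = 0" by (rule alg_closure_algebraic)
    have "poly.coeff (map_poly to_ac p) i \<in> range \<sigma>" for i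
      using rangeI[of \<sigma> "to_ac (poly.coeff p i)"] by (simp add: coeff_map_poly fx)
    moreover have "map_poly to_ac p \<noteq> 0" using p(1) by (simp add: map_poly_eq_0_iff)
    ultimately show "\<exists>p. p \<noteq> 0 \<and> (\<forall>i. poly.coeff p i \<in> range \<sigma>) \<and> poly p y = 0" using p by blast
  qed
  then show ?thesis
    unfolding galois_group_def using h fx ring_hom_field_inj[OF h] by (auto simp: bij_def)
qed

lemma galois_groupD:
  assumes "\<sigma> \<in> galois_group"
  shows "is_ring_hom \<sigma>" "bij \<sigma>" "\<sigma> (const_geom c) = const_geom c"
    "\<sigma> tgen2 = tgen2" "\<sigma> tgen3 = tgen3"
  using assms by (auto simp: galois_group_def const_geom_def tgen2_def tgen3_def)

lemma galois_group_inv: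
  assumes "\<sigma> \<in> galois_group" shows "inv_into UNIV \<sigma> \<in> galois_group"
proof -
  note b = galois_groupD(2)[OF assms] and s = ring_hom_simps[OF galois_groupD(1)[OF assms]]
  have i: "inv_into UNIV \<sigma> (\<sigma> x) = x" "\<sigma> (inv_into UNIV \<sigma> x) = x" for x
    using b by (auto simp: bij_is_inj bij_is_surj surj_f_inv_f)
  have "is_ring_hom (inv_into UNIV \<sigma>)"
    unfolding is_ring_hom_def
  proof (intro conjI allI)
    show "inv_into UNIV \<sigma> 1 = 1" using i(1)[of 1] s by simp
    show "inv_into UNIV \<sigma> (x + y) = inv_into UNIV \<sigma> x + inv_into UNIV \<sigma> y" for x y
      using i(1)[of "inv_into UNIV \<sigma> x + inv_into UNIV \<sigma> y"] s i(2) by simp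
    show "inv_into UNIV \<sigma> (x * y) = inv_into UNIV \<sigma> x * inv_into UNIV \<sigma> y" for x y
      using i(1)[of "inv_into UNIV \<sigma> x * inv_into UNIV \<sigma> y"] s i(2) by simp
  qed
  moreover have "inv_into UNIV \<sigma> (to_ac x) = to_ac x" for x
    using assms i(1)[of "to_ac x"] by (simp add: galois_group_def)
  ultimately show ?thesis using b by (simp add: galois_group_def bij_imp_bij_inv)
qed

lemma galois_group_comp:
  assumes "\<sigma> \<in> galois_group" "\<tau> \<in> galois_group" shows "(\<lambda>x. \<sigma> (\<tau> x)) \<in> galois_group"
  using assms bij_comp[of \<tau> \<sigma>] unfolding galois_group_def
  by (auto intro: ring_hom_comp simp: o_def)

section \<open>Roots of unity are constants; substitutions of the coordinates\<close>

lemma root_in_const_geom: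
  fixes y :: "'f::field geom"
  assumes "p \<noteq> 0" "poly (map_poly const_geom p) y = 0"
  obtains c where "y = const_geom c"
  using map_poly_hom_root[OF ring_hom_const_geom assms] by blast

text \<open>The constant field is algebraically closed, so it already contains all roots of
  \<open>X^n - 1\<close>. Hence the ambiguity in extracting roots is always a constant, fixed by
  every Galois element.\<close>

lemma root_of_unity_const_geom:
  fixes y :: "'f::field geom"
  assumes "y ^ n = 1" "n > 0"
  obtains c where "y = const_geom c" "c ^ n = 1"
proof -
  let ?p = "Polynomial.monom 1 n - 1 :: 'f alg_closure poly"
  have "poly.coeff ?p n = 1" using assms by simp
  then have "?p \<noteq> 0" by (metis coeff_0 zero_neq_one)
  moreover have "poly (map_poly const_geom ?p) y = 0"
    using assms by (simp add: ring_hom_simps[OF ring_hom_map_poly[OF ring_hom_const_geom]]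
        map_poly_monom const_geom_simps poly_monom)
  ultimately obtain c where c: "y = const_geom c" by (rule root_in_const_geom)
  then have "const_geom (c ^ n) = const_geom 1" using assms by (simp add: const_geom_simps)
  with c show ?thesis using that by simp
qed

text \<open>Composition with a nonconstant monomial is injective on polynomials, so the substitution
  passes to fractions and then extends to the algebraic closure. It serves with
  \<open>a = b = 1\<close> as the power map and with \<open>n = 1\<close> as a scaling.\<close>

lemma exists_monomial_substitution:
  fixes a b :: "'f::field alg_closure"
  assumes "a \<noteq> 0" "b \<noteq> 0" "n > 0"
  shows "\<exists>\<tau> :: 'f geom \<Rightarrow> 'f geom. is_ring_hom \<tau> \<and> (\<forall>c. \<tau> (const_geom c) = const_geom c) \<and>
    \<tau> tgen2 = const_geom a * tgen2 ^ n \<and> \<tau> tgen3 = const_geom b * tgen3 ^ n"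
proof -
  define S where "S p = pcompose (map_poly (\<lambda>r. pcompose r (Polynomial.monom a n)) p) (Polynomial.monom [:b:] n)"
    for p :: "'f alg_closure poly poly"
  have h1: "is_ring_hom (\<lambda>r. pcompose r (Polynomial.monom a n))"
    by (simp add: is_ring_hom_def pcompose_1 pcompose_add pcompose_mult)
  have h2: "is_ring_hom (\<lambda>r. pcompose r (Polynomial.monom [:b:] n))"
    by (simp add: is_ring_hom_def pcompose_1 pcompose_add pcompose_mult)
  have hS: "is_ring_hom S"
    using ring_hom_comp[OF ring_hom_map_poly[OF h1] h2] by (simp add: S_def[abs_def])
  have z1: "pcompose r (Polynomial.monom a n) = 0 \<longleftrightarrow> r = 0" for r
    by (rule pcompose_eq_0_iff) (simp add: assms degree_monom_eq)
  have zS: "p = 0" if "S p = 0" for p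
  proof -
    have "map_poly (\<lambda>r. pcompose r (Polynomial.monom a n)) p = 0"
      using that unfolding S_def
      by (subst (asm) pcompose_eq_0_iff) (use assms in \<open>auto simp: degree_monom_eq\<close>)
    then show ?thesis
      by (subst (asm) map_poly_eq_0_iff) (auto simp: z1)
  qed
  note hF = ring_hom_comp[OF hS ring_hom_comp[OF ring_hom_Fract ring_hom_to_ac]]
  have "\<exists>h :: 'f funfield \<Rightarrow> 'f geom. is_ring_hom h \<and> (\<forall>a. h (Fract a 1) = to_ac (Fract (S a) 1))"
    by (rule fract_hom_lift[OF hF]) (auto simp: Zero_fract_def eq_fract intro: zS)
  then obtain h :: "'f funfield \<Rightarrow> 'f geom"
    where h: "is_ring_hom h" "\<And>a. h (Fract a 1) = to_ac (Fract (S a) 1)" by blast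
  have "\<exists>\<tau>. is_ring_hom \<tau> \<and> (\<forall>x. \<tau> (to_ac x) = h x)"
    by (rule ring_hom_extend[OF ring_hom_to_ac h(1)]) (metis alg_closure_algebraic)
  then obtain \<tau> :: "'f geom \<Rightarrow> 'f geom" where \<tau>: "is_ring_hom \<tau>" "\<And>x. \<tau> (to_ac x) = h x" by blast
  have t2: "Fract [:Polynomial.monom a n:] 1 = Fract [:[:a:]:] 1 * Fract [:[:0, 1:]:] 1 ^ n"
  proof -
    have "[:Polynomial.monom a n:] = [:[:a:]:] * [:[:0, 1:]:] ^ n"
      by (simp only: ring_hom_simps(7)[OF ring_hom_pConst, symmetric]
          ring_hom_simps(4)[OF ring_hom_pConst, symmetric]) (simp add: monom_altdef)
    then show ?thesis by (simp only: ring_hom_simps[OF ring_hom_Fract])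
  qed
  have t3: "Fract (Polynomial.monom [:b:] n) 1 = Fract [:[:b:]:] 1 * Fract [:0, 1:] 1 ^ n"
  proof -
    have "Polynomial.monom [:b:] n = [:[:b:]:] * [:0, 1:] ^ n" by (simp add: monom_altdef)
    then show ?thesis by (simp only: ring_hom_simps[OF ring_hom_Fract])
  qed
  have "\<tau> (const_geom c) = const_geom c" for c
    by (simp add: const_geom_def \<tau> h S_def map_poly_pCons)
  moreover have "S [:[:0, 1:]:] = [:Polynomial.monom a n:]"
    by (simp add: S_def map_poly_pCons pcompose_pCons)
  then have "\<tau> tgen2 = const_geom a * tgen2 ^ n"
    by (simp only: tgen2_def \<tau> h t2) (simp only: to_ac_mult to_ac_power const_geom_def)
  moreover have "S [:0, 1:] = Polynomial.monom [:b:] n"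
    by (simp add: S_def map_poly_pCons pcompose_pCons pcompose_1)
  then have "\<tau> tgen3 = const_geom b * tgen3 ^ n"
    by (simp only: tgen3_def \<tau> h t3) (simp only: to_ac_mult to_ac_power const_geom_def)
  ultimately show ?thesis using \<tau> by blast
qed

text \<open>With \<open>\<tau>\<close> extending \<open>t \<mapsto> t^n\<close> and \<open>s\<close> extending a scaling, the
  automorphism is \<open>\<tau>^-1 s \<tau>\<close> and the roots are \<open>\<tau>^-1 t\<close>; no independence
  argument for the roots is needed.\<close>

theorem exists_kummer_automorphisms:
  fixes n :: nat
  assumes n: "n > 0"
  obtains T2 T3 :: "'f::field geom"
  where "T2 ^ n = tgen2" "T3 ^ n = tgen3"
    "\<And>a b :: 'f alg_closure. a ^ n = 1 \<Longrightarrow> b ^ n = 1 \<Longrightarrow>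
       \<exists>\<sigma>\<in>galois_group. \<sigma> T2 = const_geom a * T2 \<and> \<sigma> T3 = const_geom b * T3"
proof -
  obtain \<tau> :: "'f geom \<Rightarrow> 'f geom" where \<tau>: "is_ring_hom \<tau>" "\<And>c. \<tau> (const_geom c) = const_geom c"
    "\<tau> tgen2 = tgen2 ^ n" "\<tau> tgen3 = tgen3 ^ n"
    using exists_monomial_substitution[of 1 1 n, OF _ _ n] by (auto simp: const_geom_simps)
  note \<tau>s = ring_hom_simps[OF \<tau>(1)] ring_hom_inverse[OF \<tau>(1)]
  \<comment> \<open>An n-th root \<open>w\<close> of \<open>t\<close> goes to an n-th root of
    \<open>t^n\<close>, hence to a root of unity times \<open>t\<close>; that root of unity is
    constant and fixed by \<open>\<tau>\<close>, so dividing \<open>w\<close> by it gives a preimage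
    of \<open>t\<close>.\<close>
  have root: "t \<in> range \<tau>" if t: "\<tau> t = t ^ n" "t \<noteq> 0" for t
  proof -
    obtain w where w: "w ^ n = t" using nth_root_exists[OF n] by blast
    then have "\<tau> w ^ n = t ^ n" using t \<tau>s(7) by metis
    then have "(\<tau> w / t) ^ n = 1" using t by (simp add: power_divide)
    then obtain c where c: "\<tau> w / t = const_geom c" "c ^ n = 1"
      using n by (rule root_of_unity_const_geom)
    then have "\<tau> (w * inverse (const_geom c)) = \<tau> w / (\<tau> w / t)"
      by (simp add: \<tau>s \<tau>(2) divide_inverse)
    also have "\<tau> w \<noteq> 0" using c n t by (auto simp: const_geom_simps power_0_left)
    then have "\<tau> w / (\<tau> w / t) = t" by simp
    finally show ?thesis by (metis rangeI)
  qed
  have "to_ac x \<in> range \<tau>" for x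
  proof (rule to_ac_in_subfield)
    show "tgen2 \<in> range \<tau>" "tgen3 \<in> range \<tau>" using root \<tau> tgen_nz by auto
    show "const_geom c \<in> range \<tau>" for c using \<tau>(2) by (metis rangeI)
  qed (auto simp flip: \<tau>s)
  have "surj \<tau>"
  proof (rule ring_hom_surj_if_algebraic[OF \<tau>(1)])
    fix y :: "'f geom"
    obtain p where p: "p \<noteq> 0" "poly (map_poly to_ac p) y = 0" by (rule alg_closure_algebraic)
    have "poly.coeff (map_poly to_ac p) i \<in> range \<tau>" for i
      using \<open>\<And>x. to_ac x \<in> range \<tau>\<close> by (simp add: coeff_map_poly)
    moreover have "map_poly to_ac p \<noteq> 0" using p(1) by (simp add: map_poly_eq_0_iff)
    ultimately show "\<exists>p. p \<noteq> 0 \<and> (\<forall>i. poly.coeff p i \<in> range \<tau>) \<and> poly p y = 0" using p by blast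
  qed
  have inj: "inj \<tau>" by (rule ring_hom_field_inj[OF \<tau>(1)])
  define \<tau>' where "\<tau>' = inv_into UNIV \<tau>"
  have i: "\<tau>' (\<tau> x) = x" "\<tau> (\<tau>' x) = x" for x
    using inj \<open>surj \<tau>\<close> by (auto simp: \<tau>'_def surj_f_inv_f)
  have h': "is_ring_hom \<tau>'"
    unfolding is_ring_hom_def using i \<tau>s(1,3,4) by metis
  note \<tau>'s = ring_hom_simps[OF h']
  have c': "\<tau>' (const_geom c) = const_geom c" for c using i(1)[of "const_geom c"] \<tau>(2) by simp
  show thesis
  proof (rule that)
    show 1: "\<tau>' tgen2 ^ n = tgen2" "\<tau>' tgen3 ^ n = tgen3"
      using i(1)[of tgen2] i(1)[of tgen3] \<tau> \<tau>'s by auto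
    fix a b :: "'f alg_closure" assume ab: "a ^ n = 1" "b ^ n = 1"
    then have nz: "a \<noteq> 0" "b \<noteq> 0" using n by (auto simp: power_0_left)
    obtain s :: "'f geom \<Rightarrow> 'f geom" where s: "is_ring_hom s" "\<And>c. s (const_geom c) = const_geom c"
      "s tgen2 = const_geom a * tgen2" "s tgen3 = const_geom b * tgen3"
      using exists_monomial_substitution[OF nz, of 1] by auto
    \<comment> \<open>On \<open>\<tau>' tgen2\<close> the maps \<open>\<tau>\<close> and
      \<open>\<tau>'\<close> cancel and only the factor \<open>a\<close> remains; it disappears in
      the n-th power, so \<open>tgen2\<close> itself is fixed.\<close>
    define \<sigma> where "\<sigma> x = \<tau>' (s (\<tau> x))" for x
    have h: "is_ring_hom \<sigma>"
      unfolding \<sigma>_def[abs_def] by (intro ring_hom_comp[OF _ h'] ring_hom_comp[OF \<tau>(1) s(1)])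
    have r: "\<sigma> (\<tau>' tgen2) = const_geom a * \<tau>' tgen2" "\<sigma> (\<tau>' tgen3) = const_geom b * \<tau>' tgen3"
      by (simp_all add: \<sigma>_def i s \<tau>'s c')
    have f: "const_geom a ^ n = 1" "const_geom b ^ n = 1"
      using ab by (simp_all add: const_geom_simps(7,1)[symmetric])
    have "\<sigma> tgen2 = tgen2" "\<sigma> tgen3 = tgen3"
      using r 1 f ring_hom_simps(7)[OF h] by (metis mult_1 power_mult_distrib)+
    then have "\<sigma> \<in> galois_group"
      by (intro galois_groupI h) (simp_all add: \<sigma>_def \<tau> s c')
    with r show "\<exists>\<sigma>\<in>galois_group. \<sigma> (\<tau>' tgen2) = const_geom a * \<tau>' tgen2 \<and>
        \<sigma> (\<tau>' tgen3) = const_geom b * \<tau>' tgen3" by blast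
  qed
qed

section \<open>The power map of a finite field\<close>

lemma power_CARD_eq_self: "x ^ CARD('f) = (x :: 'f::{field,finite})"
proof (cases "x = 0")
  case False
  have "x * (\<Prod>y\<in>UNIV-{0}. x * y) = x * x ^ (CARD('f) - 1) * \<Prod>(UNIV-{0})"
    by (simp add: prod.distrib mult_ac)
  also have "x * x ^ (CARD('f) - 1) = x ^ CARD('f)"
    by (simp flip: power_Suc)
  also have "(\<Prod>y\<in>UNIV-{0}. x * y) = (\<Prod>y\<in>UNIV-{0}. y)"
    by (rule prod.reindex_bij_witness[of _ "\<lambda>y. y / x" "\<lambda>y. x * y"]) (use False in auto)
  finally show ?thesis by simp
qed simp

lemma CARD_field_gt_1: "CARD('f::{field,finite}) > 1"
proof -
  have "card {0, 1 :: 'f} \<le> CARD('f)" by (rule card_mono) auto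
  then show ?thesis by simp
qed

text \<open>The polynomial \<open>(X + 1)^q - X^q - 1\<close> has degree below \<open>q\<close> and vanishes on \<open>F\<close>.\<close>

lemma binomial_CARD_eq_0:
  assumes "0 < i" "i < CARD('f::{field,finite})"
  shows "of_nat (CARD('f) choose i) = (0 :: 'f)"
proof -
  let ?q = "CARD('f)"
  define p :: "'f poly" where "p = (\<Sum>i\<in>{0<..<?q}. Polynomial.monom (of_nat (?q choose i)) i)"
  have degree_bound: "Polynomial.degree p < ?q"
    unfolding p_def
    by (rule degree_sum_less) (use CARD_field_gt_1[where 'f='f] in \<open>auto intro: le_less_trans[OF degree_monom_le]\<close>)
  have "poly p x = 0" for x
  proof -
    have "(x + 1) ^ ?q = (\<Sum>k\<le>?q. of_nat (?q choose k) * x ^ k * 1 ^ (?q - k))"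
      by (rule binomial_ring)
    also have "{..?q} = insert 0 (insert ?q {0<..<?q})" by auto
    also have "(\<Sum>k\<in>\<dots>. of_nat (?q choose k) * x ^ k * 1 ^ (?q - k)) = 1 + x ^ ?q + poly p x"
      by (simp add: p_def poly_sum poly_monom)
    finally show ?thesis by (simp add: power_CARD_eq_self)
  qed
  then have "{x. poly p x = 0} = UNIV" by auto
  then have "p = 0"
    using card_poly_roots_bound[of p] degree_bound by auto
  then have "poly.coeff p i = 0" by simp
  moreover have "poly.coeff p i = of_nat (?q choose i)"
    unfolding p_def coeff_sum using assms by (simp add: sum.delta)
  ultimately show ?thesis by simp
qed

text \<open>Additivity follows from the vanishing of the middle binomial coefficients in
  \<open>F\<close>, transported to the closure; no factorization of \<open>q\<close> as a prime
  power enters.\<close>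

lemma ring_hom_power_CARD:
  "is_ring_hom (\<lambda>x :: 'f::{field,finite} alg_closure. x ^ CARD('f))"
proof -
  let ?q = "CARD('f)"
  have "(x + y) ^ ?q = x ^ ?q + y ^ ?q" for x y :: "'f alg_closure"
  proof -
    have "(x + y) ^ ?q = (\<Sum>k\<le>?q. of_nat (?q choose k) * x ^ k * y ^ (?q - k))"
      by (rule binomial_ring)
    also have "{..?q} = insert 0 (insert ?q {0<..<?q})" by auto
    also have "(\<Sum>k\<in>\<dots>. of_nat (?q choose k) * x ^ k * y ^ (?q - k)) =
        y ^ ?q + x ^ ?q + (\<Sum>k\<in>{0<..<?q}. of_nat (?q choose k) * x ^ k * y ^ (?q - k))"
      by simp
    also have "(\<Sum>k\<in>{0<..<?q}. of_nat (?q choose k) * x ^ k * y ^ (?q - k)) = 0"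
    proof (rule sum.neutral, rule ballI)
      fix k assume "k \<in> {0<..<?q}"
      then have "to_ac (of_nat (?q choose k) :: 'f) = 0"
        using binomial_CARD_eq_0[of k, where 'f='f] by simp
      then show "of_nat (?q choose k) * x ^ k * y ^ (?q - k) = 0" by simp
    qed
    finally show ?thesis by simp
  qed
  then show ?thesis by (simp add: is_ring_hom_def power_mult_distrib)
qed

lemma to_ac_power_CARD [simp]: "to_ac c ^ CARD('f) = to_ac (c :: 'f::{field,finite})"
  by (metis to_ac_power power_CARD_eq_self)

text \<open>\<open>X^q - X\<close> has at most \<open>q\<close> roots and the elements of
  \<open>F\<close> are already \<open>q\<close> of them. This is the descent criterion for
  scalars.\<close>

lemma power_CARD_eq_self_iff:
  "x ^ CARD('f) = x \<longleftrightarrow> x \<in> range (to_ac :: 'f::{field,finite} \<Rightarrow> 'f alg_closure)"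
proof
  let ?q = "CARD('f)"
  assume x: "x ^ ?q = x"
  let ?p = "Polynomial.monom 1 ?q - Polynomial.monom 1 1 :: 'f alg_closure poly"
  have "poly.coeff ?p ?q = 1" using CARD_field_gt_1[where 'f='f] by simp
  then have nz: "?p \<noteq> 0" by (metis coeff_0 zero_neq_one)
  have "Polynomial.degree ?p \<le> ?q"
    by (rule degree_diff_le) (use CARD_field_gt_1[where 'f='f] in \<open>auto simp: degree_monom_eq\<close>)
  then have le: "card {x. poly ?p x = 0} \<le> ?q"
    using card_poly_roots_bound[OF nz] by simp
  have fin: "finite {x. poly ?p x = 0}" using nz by (rule poly_roots_finite)
  have sub: "range to_ac \<subseteq> {x. poly ?p x = 0}"
    by (auto simp: poly_monom)
  have "card (range (to_ac :: 'f \<Rightarrow> _)) = ?q" by (simp add: card_image inj_to_ac)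
  then have "range to_ac = {x. poly ?p x = 0}"
    using card_subset_eq[OF fin sub] card_mono[OF fin sub] le by simp
  then show "x \<in> range to_ac" using x by (simp add: poly_monom)
next
  assume "x \<in> range (to_ac :: 'f \<Rightarrow> 'f alg_closure)"
  then show "x ^ CARD('f) = x" by auto
qed

text \<open>The power map permutes the two primitive cube roots of unity.\<close>

lemma three_dvd_CARD_power:
  assumes "CHAR('f::{field,finite}) \<noteq> 3"
  shows "3 dvd CARD('f) ^ 6 - 1"
proof -
  let ?q = "CARD('f)"
  have three: "(3 :: 'f alg_closure) \<noteq> 0"
  proof
    assume "(3 :: 'f alg_closure) = 0"
    then have "CHAR('f alg_closure) dvd 3" using of_nat_eq_0_iff_char_dvd[where 'a="'f alg_closure" and n=3] by simp
    then have "CHAR('f) dvd 3" by simp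
    moreover have "CHAR('f) \<noteq> 1" using of_nat_CHAR[where 'a='f] by (metis of_nat_1 zero_neq_one)
    moreover have "prime (3::nat)" by simp
    ultimately show False using assms prime_nat_iff[of 3] by blast
  qed
  obtain w :: "'f alg_closure" where "poly [:1, 1, 1:] w = 0"
    using alg_closed_imp_poly_has_root[of "[:1, 1, 1:]"] by auto
  then have w: "w\<^sup>2 + w + 1 = 0" by (simp add: power2_eq_square algebra_simps)
  have "w ^ 3 - 1 = (w - 1) * (w\<^sup>2 + w + 1)"
    by (simp add: algebra_simps power2_eq_square power3_eq_cube)
  then have w3: "w ^ 3 = 1" using w by simp
  have w1: "w \<noteq> 1" using w three by auto
  note h = ring_hom_simps[OF ring_hom_power_CARD[where 'f='f]]
  have "(w ^ ?q)\<^sup>2 + w ^ ?q + 1 = 0"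
  proof -
    have "(w\<^sup>2 + w + 1) ^ ?q = (w\<^sup>2) ^ ?q + w ^ ?q + 1" by (simp only: h(3) power_one)
    moreover have "(w\<^sup>2) ^ ?q = (w ^ ?q)\<^sup>2" by (simp add: mult.commute flip: power_mult)
    ultimately show ?thesis using w h(2) by simp
  qed
  \<comment> \<open>The roots of \<open>X^2 + X + 1\<close> are \<open>w\<close> and its square, and
    \<open>w^q\<close> is again a root; so the q-power map either fixes or swaps them, and its
    square fixes \<open>w\<close>.\<close>
  moreover have "(v - w) * (v - w\<^sup>2) = (v\<^sup>2 + v + 1) - v * (w\<^sup>2 + w + 1) + (w ^ 3 - 1)" for v
    by (simp add: algebra_simps power2_eq_square power3_eq_cube)
  ultimately have "(w ^ ?q - w) * (w ^ ?q - w\<^sup>2) = 0" using w w3 by simp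
  then have "w ^ ?q = w \<or> w ^ ?q = w\<^sup>2" by simp
  moreover have w4: "(w\<^sup>2)\<^sup>2 = w" using w3 by (simp add: power2_eq_square power3_eq_cube mult.assoc)
  ultimately have "(w ^ ?q) ^ ?q = w"
  proof (elim disjE)
    assume "w ^ ?q = w\<^sup>2"
    moreover have "(w\<^sup>2) ^ ?q = (w ^ ?q)\<^sup>2" by (simp add: mult.commute flip: power_mult)
    ultimately show ?thesis using w4 by simp
  qed simp
  then have a: "w ^ (?q\<^sup>2) = w" by (simp add: power2_eq_square power_mult)
  have "?q ^ 6 = ?q\<^sup>2 * ?q\<^sup>2 * ?q\<^sup>2" by (simp flip: power_add)
  then have "w ^ (?q ^ 6) = ((w ^ ?q\<^sup>2) ^ ?q\<^sup>2) ^ ?q\<^sup>2" by (simp only: power_mult)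
  then have "w ^ (?q ^ 6) = w" using a by simp
  moreover have "?q ^ 6 = Suc (?q ^ 6 - 1)" using CARD_field_gt_1[where 'f='f] by simp
  ultimately have "w * w ^ (?q ^ 6 - 1) = w" by (metis power_Suc)
  moreover have "w \<noteq> 0" using w by auto
  ultimately have n: "w ^ (?q ^ 6 - 1) = 1" by simp
  define n where "n = ?q ^ 6 - 1"
  have "w ^ n = (w ^ 3) ^ (n div 3) * w ^ (n mod 3)"
    by (simp flip: power_mult power_add)
  then have m: "w ^ (n mod 3) = 1" using n w3 n_def by simp
  have "n mod 3 < 3" by simp
  then consider "n mod 3 = 0" | "n mod 3 = 1" | "n mod 3 = 2" by linarith
  then show ?thesis
  proof cases
    case 3
    then have "w\<^sup>2 = 1" using m by simp
    then have False using w w3 w1 by (simp add: numeral_3_eq_3 power2_eq_square)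
    then show ?thesis ..
  qed (use m w1 in \<open>auto simp: n_def mod_eq_0_iff_dvd\<close>)
qed

section \<open>Cubic algebras with three geometric embeddings\<close>

text \<open>Artin's elimination: comparing the relation at \<open>x * y\<close> with
  \<open>\<phi>0 y\<close> times the relation at \<open>x\<close> removes \<open>\<phi>0\<close>,
  and choosing \<open>y\<close> where \<open>\<phi>\<close> and \<open>\<phi>0\<close> differ
  multiplies the coefficient of \<open>\<phi>\<close> by a nonzero factor.\<close>

lemma dedekind_independence:
  fixes A :: "('b::comm_ring_1 \<Rightarrow> 'k::field) set"
  assumes "finite A" "\<forall>\<phi>\<in>A. is_ring_hom \<phi>" "\<forall>x. (\<Sum>\<phi>\<in>A. a \<phi> * \<phi> x) = 0"
  shows "\<forall>\<phi>\<in>A. a \<phi> = 0"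
  using assms
proof (induction A arbitrary: a rule: finite_induct)
  case (insert \<phi>0 A)
  have s: "a \<phi>0 * \<phi>0 x + (\<Sum>\<phi>\<in>A. a \<phi> * \<phi> x) = 0" for x
    using insert.prems(2) insert.hyps by simp
  have A: "a \<phi> = 0" if "\<phi> \<in> A" for \<phi>
  proof -
    have "\<phi> \<noteq> \<phi>0" using insert.hyps \<open>\<phi> \<in> A\<close> by blast
    then obtain y where y: "\<phi> y \<noteq> \<phi>0 y" by (auto simp: fun_eq_iff)
    have "(\<Sum>\<phi>\<in>A. (a \<phi> * (\<phi> y - \<phi>0 y)) * \<phi> x) = 0" for x
    proof -
      have "(\<Sum>\<phi>\<in>A. (a \<phi> * (\<phi> y - \<phi>0 y)) * \<phi> x) =
          (\<Sum>\<phi>\<in>A. a \<phi> * \<phi> (x * y)) - \<phi>0 y * (\<Sum>\<phi>\<in>A. a \<phi> * \<phi> x)"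
        unfolding sum_distrib_left sum_subtractf[symmetric]
        by (rule sum.cong) (use insert.prems(1) in \<open>auto simp: ring_hom_simps(4) algebra_simps\<close>)
      also have "\<dots> = - (a \<phi>0 * \<phi>0 (x * y)) + \<phi>0 y * (a \<phi>0 * \<phi>0 x)"
        using s[of x] s[of "x * y"] by (simp add: add_eq_0_iff)
      also have "\<dots> = 0" using insert.prems(1) by (simp add: ring_hom_simps(4))
      finally show ?thesis .
    qed
    then have "\<forall>\<phi>\<in>A. a \<phi> * (\<phi> y - \<phi>0 y) = 0"
      using insert.IH[of "\<lambda>\<phi>. a \<phi> * (\<phi> y - \<phi>0 y)"] insert.prems(1) by simp
    then show ?thesis using y that by auto
  qed
  then have "a \<phi>0 * \<phi>0 1 = 0" using s[of 1] by simp
  then show ?case using A insert.prems(1) by (auto simp: ring_hom_simps(1))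
qed simp

lemma prod_UNIV_3: "(\<Prod>i\<in>(UNIV :: 3 set). f i) = f 1 * f 2 * f 3"
  unfolding UNIV_3 by (simp add: mult.assoc)

text \<open>Six is the exponent of the symmetric group on three letters. All 27 combinations of
  images are checked, and injectivity leaves six of them.\<close>

lemma permutation_3_power_6:
  fixes p :: "3 \<Rightarrow> 3"
  assumes "bij p" shows "(p ^^ 6) i = i"
proof -
  have inj: "p a = p b \<longleftrightarrow> a = b" for a b using assms by (simp add: bij_is_inj inj_eq)
  have 6: "p ^^ 6 = p o p o p o p o p o p" by (simp add: numeral_eq_Suc o_assoc)
  have "(1::3) \<noteq> 2" "(1::3) \<noteq> 3" "(2::3) \<noteq> 3" by simp_all
  then have "p 1 \<noteq> p 2" "p 1 \<noteq> p 3" "p 2 \<noteq> p 3" using inj by blast+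
  then have "(p ^^ 6) 1 = 1 \<and> (p ^^ 6) 2 = 2 \<and> (p ^^ 6) 3 = 3"
    unfolding 6 o_def using exhaust_3[of "p 1"] exhaust_3[of "p 2"] exhaust_3[of "p 3"]
    by (elim disjE) (simp_all only: simp_thms)
  then show ?thesis using exhaust_3[of i] by (elim disjE) (simp_all only:)
qed

text \<open>Separability of the algebra is used in the form of three distinct homomorphisms to the
  algebraic closure; finiteness of \<open>F\<close> supplies Frobenius and makes all sums below
  finite.\<close>

locale cubic_algebra =
  fixes \<iota> :: "'f::{field,finite} \<Rightarrow> 'b::comm_ring_1" and e :: "3 \<Rightarrow> 'b \<Rightarrow> 'f alg_closure"
  assumes \<iota>: "is_ring_hom \<iota>" and ex_basis: "\<exists>\<beta>. is_basis3 \<iota> \<beta>"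
    and bij_e: "bij_betw e UNIV (geometric_embeddings \<iota>)"
begin

section \<open>Conjugates as coordinates over the algebraic closure\<close>

definition \<beta> :: "3 \<Rightarrow> 'b" where "\<beta> = (SOME \<beta>. is_basis3 \<iota> \<beta>)"

lemmas \<iota>_simps = ring_hom_simps[OF \<iota>]

lemma basis: "is_basis3 \<iota> \<beta>"
  unfolding \<beta>_def using ex_basis by (rule someI_ex)

lemma coords_eq: "x = (\<Sum>i\<in>UNIV. \<iota> (coords \<iota> \<beta> x i) * \<beta> i)"
  using basis theI'[of "\<lambda>c. x = (\<Sum>i\<in>UNIV. \<iota> (c i) * \<beta> i)"]
  by (simp add: is_basis3_def coords_def)

lemma coords_unique: "coords \<iota> \<beta> (\<Sum>i\<in>UNIV. \<iota> (c i) * \<beta> i) = c"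
  using basis coords_eq[of "\<Sum>i\<in>UNIV. \<iota> (c i) * \<beta> i"] unfolding is_basis3_def by metis

lemma bij_coords: "bij (coords \<iota> \<beta>)"
proof (rule bijI)
  show "inj (coords \<iota> \<beta>)" by (rule injI) (metis coords_eq)
  show "surj (coords \<iota> \<beta>)" by (rule surjI[OF coords_unique])
qed

lemma finite_B: "finite (UNIV :: 'b set)"
  using bij_betw_finite[OF bij_coords] by simp

lemma card_B: "card (UNIV :: 'b set) = CARD('f) ^ 3"
  using bij_betw_same_card[OF bij_coords] by (simp add: card_fun)

lemma e_hom: "is_ring_hom (e i)" and e_\<iota> [simp]: "e i (\<iota> c) = to_ac c"
  using bij_betwE[OF bij_e] by (auto simp: geometric_embeddings_def)

lemma e_simps [simp]:
  "e i 1 = 1" "e i 0 = 0" "e i (x + y) = e i x + e i y" "e i (x * y) = e i x * e i y"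
  "e i (- x) = - e i x" "e i (x - y) = e i x - e i y" "e i (x ^ n) = e i x ^ n"
  by (rule ring_hom_simps[OF e_hom])+

lemma inj_e: "inj e" using bij_e by (simp add: bij_betw_def)

lemma e_independent:
  assumes "\<And>x. (\<Sum>i\<in>UNIV. a i * e i x) = 0" shows "a i = 0"
proof -
  have "\<forall>\<phi>\<in>range e. a (inv_into UNIV e \<phi>) = 0"
  proof (rule dedekind_independence)
    show "\<forall>x. (\<Sum>\<phi>\<in>range e. a (inv_into UNIV e \<phi>) * \<phi> x) = 0"
      using assms by (simp add: sum.reindex[OF inj_e] inv_f_f[OF inj_e])
  qed (auto simp: e_hom)
  then show ?thesis by (simp add: inv_f_f[OF inj_e])
qed

text \<open>Takes coordinates in the basis to the vector of conjugates; the square of its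
  determinant is the discriminant of the basis.\<close>

definition P :: "'f alg_closure ^ 3 ^ 3" where "P = (\<chi> i j. e i (\<beta> j))"

lemma e_expand: "e i x = (\<Sum>j\<in>UNIV. to_ac (coords \<iota> \<beta> x j) * e i (\<beta> j))"
proof -
  have "e i x = e i (\<Sum>j\<in>UNIV. \<iota> (coords \<iota> \<beta> x j) * \<beta> j)" by (rule arg_cong[OF coords_eq])
  then show ?thesis by (simp add: ring_hom_sum[OF e_hom])
qed

lemma e_coords: "e i x = (P *v (\<chi> j. to_ac (coords \<iota> \<beta> x j))) $ i"
  by (subst e_expand) (simp add: P_def matrix_vector_mult_def mult.commute)

text \<open>A linear relation among the rows holds on the basis, hence on all of \<open>B\<close> by
  linearity over \<open>F\<close>, and independence of the embeddings makes it trivial.\<close>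

lemma invertible_P: "invertible P"
proof -
  have "a = 0" if "transpose P *v a = 0" for a
  proof -
    have b: "(\<Sum>i\<in>UNIV. a $ i * e i (\<beta> j)) = 0" for j
      using arg_cong[OF that, of "\<lambda>v. v $ j"]
      by (simp add: matrix_vector_mult_def transpose_def P_def mult.commute)
    have "(\<Sum>i\<in>UNIV. a $ i * e i x) = 0" for x
    proof -
      have "(\<Sum>i\<in>UNIV. a $ i * e i x) = (\<Sum>i\<in>UNIV. \<Sum>j\<in>UNIV. to_ac (coords \<iota> \<beta> x j) * (a $ i * e i (\<beta> j)))"
        by (intro sum.cong refl, subst e_expand) (simp add: sum_distrib_left mult_ac)
      also have "\<dots> = (\<Sum>j\<in>UNIV. to_ac (coords \<iota> \<beta> x j) * (\<Sum>i\<in>UNIV. a $ i * e i (\<beta> j)))"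
        by (subst sum.swap) (simp add: sum_distrib_left)
      finally show ?thesis using b by simp
    qed
    then have "a $ i = 0" for i by (rule e_independent)
    then show ?thesis by (simp add: vec_eq_iff)
  qed
  then have "\<exists>B. B ** transpose P = mat 1" by (simp add: matrix_left_invertible_ker)
  then obtain B where "B ** transpose P = mat 1" ..
  then have "P ** transpose B = mat 1" by (metis matrix_transpose_mul transpose_mat transpose_transpose)
  then show ?thesis using invertible_right_inverse by blast
qed

lemma P_solve: "\<exists>c. P *v c = z"
  using invertible_P by (metis invertible_def matrix_vector_mul_assoc matrix_vector_mul_lid)

lemma P_inj: "P *v c = P *v c' \<Longrightarrow> c = c'"
  using invertible_P by (metis invertible_def matrix_vector_mul_assoc matrix_vector_mul_lid)

text \<open>The conjugates determine the element because \<open>P\<close> is injective. Most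
  identities in \<open>B\<close> below are verified conjugate by conjugate through this
  lemma.\<close>

lemma e_inj: assumes "\<And>i. e i x = e i y" shows "x = y"
proof -
  have "(P *v (\<chi> j. to_ac (coords \<iota> \<beta> x j))) $ i = (P *v (\<chi> j. to_ac (coords \<iota> \<beta> y j))) $ i" for i
    using assms[of i] by (simp only: e_coords)
  then have "P *v (\<chi> j. to_ac (coords \<iota> \<beta> x j)) = P *v (\<chi> j. to_ac (coords \<iota> \<beta> y j))"
    by (subst vec_eq_iff) blast
  from P_inj[OF this] have "coords \<iota> \<beta> x = coords \<iota> \<beta> y" by (simp add: vec_eq_iff fun_eq_iff)
  then show ?thesis using bij_coords by (simp add: bij_is_inj inj_eq)
qed

text \<open>Conjugating by \<open>P\<close> turns multiplication by \<open>x\<close> into the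
  diagonal matrix of its conjugates, since
  \<open>e i (x * \<beta> j) = e i x * e i (\<beta> j)\<close>; trace and determinant are read off
  there.\<close>

lemma Tr_Nm_e:
  shows Tr_e: "to_ac (Tr \<iota> x) = e 1 x + e 2 x + e 3 x"
    and Nm_e: "to_ac (Nm \<iota> x) = e 1 x * e 2 x * e 3 x"
proof -
  define M where "M = mult_matrix \<iota> x"
  have M: "M $ i $ j = coords \<iota> \<beta> (x * \<beta> j) i" for i j
    by (simp add: M_def mult_matrix_def \<beta>_def[symmetric] Let_def)
  define Mk :: "'f alg_closure ^ 3 ^ 3" where "Mk = (\<chi> i j. to_ac (M $ i $ j))"
  define D :: "'f alg_closure ^ 3 ^ 3" where "D = (\<chi> i j. if i = j then e i x else 0)"
  have PM: "P ** Mk = D ** P"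
  proof -
    have "(P ** Mk) $ i $ j = (D ** P) $ i $ j" for i j
    proof -
      have "(P ** Mk) $ i $ j = e i (x * \<beta> j)"
        by (subst e_coords) (simp add: matrix_matrix_mult_def matrix_vector_mult_def Mk_def M)
      also have "\<dots> = (\<Sum>k\<in>UNIV. if i = k then e i x * e k (\<beta> j) else 0)"
        by (simp only: sum.delta' finite_class.finite_UNIV UNIV_I if_True e_simps(4))
      also have "\<dots> = (D ** P) $ i $ j"
        unfolding matrix_matrix_mult_def D_def P_def vec_lambda_beta
        by (rule sum.cong) auto
      finally show ?thesis .
    qed
    then show ?thesis by (subst vec_eq_iff, subst vec_eq_iff) blast
  qed
  obtain Q where Q: "Q ** P = mat 1" "P ** Q = mat 1" using invertible_P by (auto simp: invertible_def)
  have Mk: "Mk = Q ** (D ** P)" using PM Q by (metis matrix_mul_assoc matrix_mul_lid)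
  have "trace Mk = trace ((D ** P) ** Q)" unfolding Mk by (rule trace_mul_sym)
  then have tr: "trace Mk = trace D" using Q by (metis matrix_mul_assoc matrix_mul_rid)
  have "det Mk = det Q * det P * det D" unfolding Mk by (simp add: det_mul mult_ac)
  also have "det Q * det P = 1" using Q by (metis det_I det_mul)
  finally have dt: "det Mk = det D" by simp
  show "to_ac (Tr \<iota> x) = e 1 x + e 2 x + e 3 x"
    using tr by (simp add: Tr_def M_def[symmetric] Mk_def D_def trace_def sum_3)
  show "to_ac (Nm \<iota> x) = e 1 x * e 2 x * e 3 x"
    using dt by (simp add: Nm_def M_def[symmetric] Mk_def D_def det_3)
qed

lemma Tr_add: "Tr \<iota> (x + y) = Tr \<iota> x + Tr \<iota> y"
  by (subst to_ac_eq_iff[symmetric]) (simp add: Tr_e)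

lemma Tr_diff: "Tr \<iota> (x - y) = Tr \<iota> x - Tr \<iota> y"
  by (subst to_ac_eq_iff[symmetric]) (simp add: Tr_e)

lemma Tr_scale: "Tr \<iota> (\<iota> c * x) = c * Tr \<iota> x"
  by (subst to_ac_eq_iff[symmetric]) (simp add: Tr_e algebra_simps)

lemma Nm_mult: "Nm \<iota> (x * y) = Nm \<iota> x * Nm \<iota> y"
  by (subst to_ac_eq_iff[symmetric]) (simp add: Nm_e)

lemma Nm_1: "Nm \<iota> 1 = 1"
  by (subst to_ac_eq_iff[symmetric]) (simp add: Nm_e)

lemma Nm_scale: "Nm \<iota> (\<iota> c * x) = c ^ 3 * Nm \<iota> x"
  by (subst to_ac_eq_iff[symmetric]) (simp add: Nm_e power3_eq_cube)

lemma Tr_nondegenerate: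
  assumes "\<And>y. Tr \<iota> (x * y) = 0" shows "x = 0"
proof -
  have "(\<Sum>i\<in>UNIV. e i x * e i y) = 0" for y
    using Tr_e[of "x * y"] assms[of y] by (simp add: sum_3)
  then have "e i x = 0" for i by (rule e_independent)
  then show ?thesis by (intro e_inj) simp
qed

section \<open>The Frobenius permutation of the embeddings and descent to \<open>B\<close>\<close>

definition \<pi> :: "3 \<Rightarrow> 3" where "\<pi> i = (THE j. \<forall>x. e i x = e j x ^ CARD('f))"

text \<open>The q-th power of an embedding is an embedding, and the q-power map is injective, so it
  induces a permutation \<open>r\<close> of the three indices; \<open>\<pi>\<close> is the inverse
  of \<open>r\<close>.\<close>

lemma \<pi>_unique: "\<exists>!j. \<forall>x. e i x = e j x ^ CARD('f)"
proof -
  define r where "r j = inv_into UNIV e (\<lambda>x. e j x ^ CARD('f))" for j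
  have "(\<lambda>x. e j x ^ CARD('f)) \<in> geometric_embeddings \<iota>" for j
    using ring_hom_comp[OF e_hom[of j] ring_hom_power_CARD]
    by (simp add: geometric_embeddings_def)
  then have "(\<lambda>x. e j x ^ CARD('f)) \<in> range e" for j using bij_e by (simp add: bij_betw_def)
  then have r: "e (r j) = (\<lambda>x. e j x ^ CARD('f))" for j unfolding r_def by (rule f_inv_into_f)
  have pinj: "x = y" if "x ^ CARD('f) = y ^ CARD('f)" for x y :: "'f alg_closure"
    using ring_hom_field_inj[OF ring_hom_power_CARD[where 'f='f]] that by (auto dest: injD)
  have ej: "j = j'" if "\<And>x. e j x ^ CARD('f) = e j' x ^ CARD('f)" for j j'
  proof -
    have "e j = e j'" using that pinj by blast
    then show ?thesis using inj_e by (simp add: inj_eq)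
  qed
  have "inj r"
  proof (rule injI)
    fix j j' assume "r j = r j'"
    then have "(\<lambda>x. e j x ^ CARD('f)) = (\<lambda>x. e j' x ^ CARD('f))" using r by metis
    then show "j = j'" by (intro ej) (rule fun_cong)
  qed
  then have "surj r" by (simp add: finite_UNIV_inj_surj)
  then obtain j where "i = r j" by blast
  then have "\<forall>x. e i x = e j x ^ CARD('f)" using r by simp
  then show ?thesis using ej by (intro ex1I[of _ j]) auto
qed

lemma e_\<pi>: "e i x = e (\<pi> i) x ^ CARD('f)"
  using theI'[OF \<pi>_unique[of i]] unfolding \<pi>_def by blast

lemma bij_\<pi>: "bij \<pi>"
proof -
  have "inj \<pi>"
  proof (rule injI)
    fix i j assume "\<pi> i = \<pi> j"
    then have "e i = e j" using e_\<pi>[of i] e_\<pi>[of j] by auto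
    then show "i = j" using inj_e by (simp add: inj_eq)
  qed
  then show ?thesis by (simp add: bij_def finite_UNIV_inj_surj)
qed

lemma prod_\<pi>: "f (\<pi> 1) * f (\<pi> 2) * f (\<pi> 3) = f 1 * f 2 * (f 3 :: 'c::comm_monoid_mult)"
  using prod.reindex_bij_betw[OF bij_\<pi>, of f] by (simp add: prod_UNIV_3)

text \<open>Galois descent: the vector \<open>c\<close> of coordinates of \<open>z\<close> solves a
  linear system with matrix \<open>P\<close>, and so does its vector of q-th powers by the
  compatibility of \<open>z\<close>; uniqueness puts the coordinates in \<open>F\<close>.\<close>

lemma descent:
  assumes "\<And>i. z i = z (\<pi> i) ^ CARD('f)" shows "\<exists>x. \<forall>i. e i x = z i"
proof -
  obtain c where c: "P *v c = (\<chi> i. z i)" using P_solve by blast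
  then have zc: "z i = (\<Sum>j\<in>UNIV. e i (\<beta> j) * c $ j)" for i
    by (simp add: vec_eq_iff matrix_vector_mult_def P_def)
  note h = ring_hom_power_CARD[where 'f='f]
  have "z i = (\<Sum>j\<in>UNIV. e i (\<beta> j) * (c $ j) ^ CARD('f))" for i
  proof -
    have "z i = (\<Sum>j\<in>UNIV. e (\<pi> i) (\<beta> j) * c $ j) ^ CARD('f)" using assms zc by metis
    also have "\<dots> = (\<Sum>j\<in>UNIV. e i (\<beta> j) * (c $ j) ^ CARD('f))"
      by (simp only: ring_hom_sum[OF h] power_mult_distrib e_\<pi>[of i, symmetric])
    finally show ?thesis .
  qed
  then have "P *v c = P *v (\<chi> j. (c $ j) ^ CARD('f))"
    unfolding c by (simp add: vec_eq_iff matrix_vector_mult_def P_def)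
  then have "(c $ j) ^ CARD('f) = c $ j" for j using P_inj[of c] by (metis vec_lambda_beta)
  then have "\<forall>j. \<exists>a. c $ j = to_ac a" by (metis power_CARD_eq_self_iff imageE)
  then obtain a where a: "\<And>j. c $ j = to_ac (a j)" by metis
  define x where "x = (\<Sum>j\<in>UNIV. \<iota> (a j) * \<beta> j)"
  have "e i x = z i" for i
    by (simp add: zc a x_def ring_hom_sum[OF e_hom] mult.commute)
  then show ?thesis by blast
qed

text \<open>For the converse, the inverses of the conjugates are again compatible with Frobenius and
  descend to an inverse in \<open>B\<close>.\<close>

lemma unit_iff: "x dvd 1 \<longleftrightarrow> (\<forall>i. e i x \<noteq> 0)"
proof
  assume "x dvd 1"
  then obtain y where "1 = x * y" by (auto simp: dvd_def)
  then have "e i x * e i y = 1" for i by (metis e_simps(1,4))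
  then show "\<forall>i. e i x \<noteq> 0" by (metis mult_zero_left zero_neq_one)
next
  assume a: "\<forall>i. e i x \<noteq> 0"
  have "inverse (e i x) = inverse (e (\<pi> i) x) ^ CARD('f)" for i using e_\<pi>[of i x] by (simp add: power_inverse)
  from descent[of "\<lambda>i. inverse (e i x)", OF this] obtain y where y: "\<And>i. e i y = inverse (e i x)" by blast
  have "x * y = 1" by (rule e_inj) (simp add: y a)
  then show "x dvd 1" by (metis dvd_triv_left)
qed

lemma unit_iff_Nm: "x dvd 1 \<longleftrightarrow> Nm \<iota> x \<noteq> 0"
proof -
  have "Nm \<iota> x = 0 \<longleftrightarrow> e 1 x * e 2 x * e 3 x = 0"
    by (simp flip: Nm_e)
  then show ?thesis unfolding unit_iff by (simp add: forall_3)
qed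

lemma unit_mult_iff: "x * y dvd 1 \<longleftrightarrow> x dvd 1 \<and> (y::'b) dvd 1"
  by (auto simp: unit_iff)

lemma unit_\<iota>_iff: "\<iota> c dvd 1 \<longleftrightarrow> c \<noteq> 0"
  by (simp add: unit_iff)

section \<open>The norm-one group and the isogeny into it\<close>

lemma carrier_TB: "h \<in> carrier (TB \<iota>) \<longleftrightarrow> Nm \<iota> h = 1"
  by (auto simp: TB_def unit_iff_Nm)

lemma mult_TB [simp]: "x \<otimes>\<^bsub>TB \<iota>\<^esub> y = x * y" and one_TB [simp]: "\<one>\<^bsub>TB \<iota>\<^esub> = 1"
  by (simp_all add: TB_def)

lemma comm_group_TB: "comm_group (TB \<iota>)"
proof (rule comm_groupI)
  fix x assume "x \<in> carrier (TB \<iota>)"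
  then have "x dvd 1" "Nm \<iota> x = 1" by (auto simp: TB_def)
  then obtain y where y: "1 = x * y" by (auto simp: dvd_def)
  then have "Nm \<iota> y = 1" using Nm_mult[of x y] \<open>Nm \<iota> x = 1\<close> Nm_1 by simp
  then show "\<exists>y\<in>carrier (TB \<iota>). y \<otimes>\<^bsub>TB \<iota>\<^esub> x = \<one>\<^bsub>TB \<iota>\<^esub>"
    using y by (intro bexI[of _ y]) (auto simp: carrier_TB mult.commute)
qed (auto simp: carrier_TB Nm_mult Nm_1 mult_ac)

text \<open>Descends to units modulo nonzero scalars, because scaling by \<open>c\<close> multiplies
  cube and norm alike by \<open>c^3\<close>. Outside the units the norm is 0, its inverse is 0 by
  convention, and so is the value.\<close>

definition isog :: "'b \<Rightarrow> 'b" where "isog d = d ^ 3 * \<iota> (inverse (Nm \<iota> d))"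

lemma e_isog: "e i (isog d) = e i d ^ 3 / (e 1 d * e 2 d * e 3 d)"
  by (simp add: isog_def divide_inverse Nm_e[symmetric])

lemma isog_mult: "isog (c * d) = isog c * isog d"
  by (rule e_inj) (simp add: e_isog power_mult_distrib mult_ac)

lemma isog_\<iota>: "c \<noteq> 0 \<Longrightarrow> isog (\<iota> c) = 1"
  by (rule e_inj) (simp add: e_isog power3_eq_cube)

lemma isog_in_TB: "d dvd 1 \<Longrightarrow> isog d \<in> carrier (TB \<iota>)"
  unfolding carrier_TB
  by (subst to_ac_eq_iff[symmetric])
    (simp add: Nm_e e_isog unit_iff forall_3 field_simps power3_eq_cube)

end

section \<open>Characters of finite abelian groups\<close>

definition partial_char :: "('a, 'm) monoid_scheme \<Rightarrow> 'a set \<Rightarrow> ('a \<Rightarrow> complex) \<Rightarrow> bool" where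
  "partial_char G K \<theta> \<longleftrightarrow> (\<forall>x\<in>K. \<theta> x \<noteq> 0) \<and> (\<forall>x\<in>K. \<forall>y\<in>K. \<theta> (x \<otimes>\<^bsub>G\<^esub> y) = \<theta> x * \<theta> y)"

lemma (in group) subgroup_nat_pow_closed:
  assumes "subgroup K G" "x \<in> K" shows "x [^] (n::nat) \<in> K"
  by (induction n) (use assms in \<open>auto simp: subgroup.one_closed subgroup.m_closed\<close>)

lemma (in comm_group) partial_char_power:
  assumes K: "subgroup K G" and c: "partial_char G K \<theta>" and x: "x \<in> K"
  shows "\<theta> (x [^] (n::nat)) = \<theta> x ^ n"
proof (induction n)
  case 0
  have "\<theta> (\<one> \<otimes> \<one>) = \<theta> \<one> * \<theta> \<one>" "\<theta> \<one> \<noteq> 0"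
    using c subgroup.one_closed[OF K] unfolding partial_char_def by blast+
  then show ?case by simp
next
  case (Suc n)
  have "x [^] n \<in> K" using K x by (rule subgroup_nat_pow_closed)
  then show ?case using Suc c x unfolding partial_char_def by simp
qed

text \<open>Put \<open>\<theta>' (k x^j) = \<theta> k * w^j\<close>. The exponents \<open>m\<close>
  with \<open>x^m\<close> in \<open>K\<close> are multiples of \<open>n\<close>, which together with
  \<open>w^n = \<theta> (x^n)\<close> makes this well defined. The choice of the root
  \<open>w\<close> stays free for the separation of points.\<close>

lemma (in comm_group) partial_char_extend_one:
  assumes K: "subgroup K G" and c: "partial_char G K \<theta>" and x: "x \<in> carrier G"
    and n: "n > 0" "x [^] n \<in> K" "\<And>m. 0 < m \<Longrightarrow> m < n \<Longrightarrow> x [^] m \<notin> K"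
    and w: "w ^ n = \<theta> (x [^] (n::nat))"
    and fin: "finite (carrier G)"
  shows "\<exists>K' \<theta>'. subgroup K' G \<and> insert x K \<subseteq> K' \<and> partial_char G K' \<theta>' \<and>
    (\<forall>k\<in>K. \<theta>' k = \<theta> k) \<and> \<theta>' x = w"
proof -
  have KG: "K \<subseteq> carrier G" using K by (rule subgroup.subset)
  have kc: "k \<in> carrier G" if "k \<in> K" for k using that KG by blast
  have Kpow: "y [^] (i::nat) \<in> K" if "y \<in> K" for y i
    using K that by (rule subgroup_nat_pow_closed)
  have w0: "w \<noteq> 0" using w n c unfolding partial_char_def by (metis zero_power)
  have one: "\<theta> \<one> = 1" using partial_char_power[OF K c subgroup.one_closed[OF K], of 0] by simp
  have dv: "n dvd m" if "x [^] m \<in> K" for m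
  proof -
    have e: "x [^] m = (x [^] n) [^] (m div n) \<otimes> x [^] (m mod n)"
      using x by (simp add: nat_pow_pow nat_pow_mult)
    have p: "(x [^] n) [^] (m div n) \<in> K" using Kpow n by blast
    have "x [^] (m mod n) = inv ((x [^] n) [^] (m div n)) \<otimes> x [^] m"
      unfolding e using x by (simp add: m_assoc[symmetric])
    then have "x [^] (m mod n) \<in> K"
      using p that K by (simp add: subgroup.m_closed subgroup.m_inv_closed)
    then have "m mod n = 0" using n(3)[of "m mod n"] n(1) by force
    then show ?thesis by auto
  qed
  have xm: "\<theta> (x [^] m) = w ^ m" if xK: "x [^] m \<in> K" for m
  proof -
    obtain r where r: "m = n * r" using dv[OF xK] by blast
    then have "x [^] m = (x [^] n) [^] r" using x by (simp add: nat_pow_pow)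
    then show ?thesis using partial_char_power[OF K c n(2), of r] w by (simp add: r power_mult)
  qed
  have wd: "\<theta> k * w ^ i = \<theta> k' * w ^ j"
    if kk: "k \<in> K" "k' \<in> K" and eq: "k \<otimes> x [^] i = k' \<otimes> x [^] j" and ij: "i \<le> j" for k k' i j
  proof -
    have "k' \<otimes> x [^] j = (k' \<otimes> x [^] (j - i)) \<otimes> x [^] i"
      using kk ij x kc by (simp add: m_assoc nat_pow_mult)
    then have k: "k = k' \<otimes> x [^] (j - i)"
      using eq kk x kc by (metis m_closed nat_pow_closed right_cancel)
    then have "x [^] (j - i) = inv k' \<otimes> k" using kk x kc by (simp add: m_assoc[symmetric])
    then have m: "x [^] (j - i) \<in> K"
      using kk K by (simp add: subgroup.m_closed subgroup.m_inv_closed)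
    have "\<theta> k = \<theta> k' * w ^ (j - i)"
      using k m kk c xm[OF m] unfolding partial_char_def by metis
    then show ?thesis using ij by (simp flip: power_add)
  qed
  have wd: "\<theta> k * w ^ i = \<theta> k' * w ^ j"
    if "k \<in> K" "k' \<in> K" "k \<otimes> x [^] i = k' \<otimes> x [^] j" for k k' i j
    using wd[of k k' i j] wd[of k' k j i] that by (metis nat_le_linear)
  define K' where "K' = {k \<otimes> x [^] (j::nat) | k j. k \<in> K}"
  define \<theta>' where "\<theta>' z = (SOME v. \<exists>k\<in>K. \<exists>j::nat. z = k \<otimes> x [^] j \<and> v = \<theta> k * w ^ j)" for z
  have val: "\<theta>' (k \<otimes> x [^] j) = \<theta> k * w ^ j" if "k \<in> K" for k and j :: nat
  proof -
    have "\<exists>v. \<exists>k'\<in>K. \<exists>j'::nat. k \<otimes> x [^] j = k' \<otimes> x [^] j' \<and> v = \<theta> k' * w ^ j'"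
      using that by blast
    from someI_ex[OF this] show ?thesis
      unfolding \<theta>'_def using wd that by metis
  qed
  have prod: "(k \<otimes> x [^] i) \<otimes> (k' \<otimes> x [^] j) = (k \<otimes> k') \<otimes> x [^] (i + j)"
    if "k \<in> K" "k' \<in> K" for k k' and i j :: nat
    using that x kc by (simp add: nat_pow_mult[symmetric] m_ac)
  have "subgroup K' G"
  proof (rule subgroupI)
    show "K' \<subseteq> carrier G" unfolding K'_def using x kc by auto
    show "K' \<noteq> {}" unfolding K'_def using subgroup.one_closed[OF K] by blast
    show "a \<otimes> b \<in> K'" if "a \<in> K'" "b \<in> K'" for a b
      using that prod K unfolding K'_def by (auto dest: subgroup.m_closed[OF K]) (metis subgroup.m_closed)
    show "inv a \<in> K'" if "a \<in> K'" for a
    proof -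
      obtain k j where a: "a = k \<otimes> x [^] (j::nat)" "k \<in> K" using \<open>a \<in> K'\<close> unfolding K'_def by blast
      \<comment> \<open>Elements of \<open>K'\<close> use natural exponents, so the inverse of
        \<open>x^j\<close> is rewritten as a nonnegative power by means of the group order.\<close>
      let ?o = "Coset.order G"
      have o: "?o > 0" "x [^] ?o = \<one>" using fin x by (auto simp: order_gt_0_iff_finite pow_order_eq_1)
      have le: "j \<le> ?o * j" using o(1) by simp
      have "x [^] (?o * j - j) \<otimes> x [^] j = \<one>"
        using x o le by (simp add: nat_pow_mult nat_pow_pow[symmetric])
      then have i: "inv (x [^] j) = x [^] (?o * j - j)"
        using x by (metis inv_equality nat_pow_closed)
      have "inv a = inv k \<otimes> x [^] (?o * j - j)"
        using a x kc i by (simp add: inv_mult_group m_comm)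
      then show ?thesis unfolding K'_def using a K by (auto simp: subgroup.m_inv_closed)
    qed
  qed
  moreover have "insert x K \<subseteq> K'"
  proof -
    have "x = \<one> \<otimes> x [^] (1::nat)" using x by simp
    then have "x \<in> K'" unfolding K'_def using subgroup.one_closed[OF K] by blast
    moreover have "k \<in> K'" if "k \<in> K" for k
    proof -
      have "k = k \<otimes> x [^] (0::nat)" using that kc by simp
      then show ?thesis unfolding K'_def using that by blast
    qed
    ultimately show ?thesis by blast
  qed
  moreover have "partial_char G K' \<theta>'"
    unfolding partial_char_def
  proof (intro conjI ballI)
    fix a assume "a \<in> K'"
    then obtain k and i :: nat where a: "a = k \<otimes> x [^] i" "k \<in> K" using K'_def by blast
    then show "\<theta>' a \<noteq> 0" using val w0 c unfolding partial_char_def by simp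
    fix b assume "b \<in> K'"
    then obtain k' and j :: nat where b: "b = k' \<otimes> x [^] j" "k' \<in> K" using K'_def by blast
    show "\<theta>' (a \<otimes> b) = \<theta>' a * \<theta>' b"
      using a b prod val c subgroup.m_closed[OF K a(2) b(2)] unfolding partial_char_def
      by (simp add: power_add)
  qed
  moreover have "\<theta>' k = \<theta> k" if "k \<in> K" for k using val[OF that, of 0] that kc by simp
  moreover have "\<theta>' x = w" using val[OF subgroup.one_closed[OF K], of 1] x one by simp
  ultimately show ?thesis by blast
qed

lemma (in comm_group) least_power_in_subgroup:
  assumes K: "subgroup K G" and x: "x \<in> carrier G" and fin: "finite (carrier G)"
  obtains n :: nat where "n > 0" "x [^] n \<in> K" "\<And>m. 0 < m \<Longrightarrow> m < n \<Longrightarrow> x [^] m \<notin> K"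
proof -
  let ?P = "\<lambda>n::nat. 0 < n \<and> x [^] n \<in> K"
  have "?P (Coset.order G)" using fin x K by (simp add: order_gt_0_iff_finite pow_order_eq_1 subgroup.one_closed)
  then have "?P (LEAST n. ?P n)" by (rule LeastI)
  moreover have "\<not> ?P m" if "m < (LEAST n. ?P n)" for m using not_less_Least[OF that] .
  ultimately show ?thesis using that by blast
qed

lemma (in comm_group) partial_char_extend:
  assumes "subgroup K G" "partial_char G K \<theta>" and fin: "finite (carrier G)"
  shows "\<exists>\<psi>\<in>characters G. \<forall>k\<in>K. \<psi> k = \<theta> k"
  using assms(1,2)
proof (induction "card (carrier G) - card K" arbitrary: K \<theta> rule: less_induct)
  case less
  have KG: "K \<subseteq> carrier G" using less.prems(1) by (rule subgroup.subset)
  show ?case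
  proof (cases "K = carrier G")
    case True
    have "(\<lambda>x. if x \<in> carrier G then \<theta> x else 0) \<in> characters G"
      using less.prems(2) unfolding True characters_def partial_char_def by auto
    then show ?thesis using True by (intro bexI) auto
  next
    case False
    then obtain x where x: "x \<in> carrier G" "x \<notin> K" using KG by blast
    obtain n :: nat where n: "n > 0" "x [^] n \<in> K" "\<And>m. 0 < m \<Longrightarrow> m < n \<Longrightarrow> x [^] m \<notin> K"
      using least_power_in_subgroup[OF less.prems(1) x(1) fin] by blast
    obtain w where "w ^ n = \<theta> (x [^] n)" using nth_root_exists[OF n(1)] by blast
    from partial_char_extend_one[OF less.prems x(1) n this fin]
    obtain K' \<theta>' where K': "subgroup K' G" "insert x K \<subseteq> K'" "partial_char G K' \<theta>'"
      "\<forall>k\<in>K. \<theta>' k = \<theta> k" by blast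
    have fK': "finite K'" and K'G: "K' \<subseteq> carrier G"
      using subgroup.subset[OF K'(1)] fin finite_subset by auto
    have "card K < card K'" using K'(2) x(2) fK' by (intro psubset_card_mono) auto
    then have "card (carrier G) - card K' < card (carrier G) - card K"
      using card_mono[OF fin K'G] by linarith
    from less.hyps[OF this K'(1,3)] show ?thesis using K'(2,4) by (metis insert_subset subsetD)
  qed
qed

text \<open>The trivial character of \<open>H\<close> is extended by sending \<open>x\<close> to a
  primitive n-th root of unity, where \<open>n \<ge> 2\<close> is the least positive exponent with
  \<open>x^n\<close> in \<open>H\<close>.\<close>

lemma (in comm_group) characters_separate:
  assumes H: "subgroup H G" and fin: "finite (carrier G)" and x: "x \<in> carrier G" "x \<notin> H"
  shows "\<exists>\<psi>\<in>annihilator G H. \<psi> x \<noteq> 1"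
proof -
  obtain n :: nat where n: "n > 0" "x [^] n \<in> H" "\<And>m. 0 < m \<Longrightarrow> m < n \<Longrightarrow> x [^] m \<notin> H"
    using least_power_in_subgroup[OF H x(1) fin] by blast
  have "n \<noteq> 1" using n(2) x by auto
  then have n2: "n \<ge> 2" using n(1) by simp
  define w where "w = cis (2 * pi / n)"
  have wn: "w ^ n = 1" using n(1) by (simp add: w_def DeMoivre)
  have w1: "w \<noteq> 1"
  proof
    assume "w = 1"
    then have "cos (2 * pi / n) = 1" by (metis w_def cis.sel(1) one_complex.sel(1))
    then obtain k :: int where "2 * pi / n = of_int k * 2 * pi" by (auto simp: cos_one_2pi_int)
    then have "(2 * pi) * (1 / n) = (2 * pi) * of_int k" by simp
    then have "1 / real n = of_int k" by (subst (asm) mult_cancel_left) simp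
    then have "real_of_int (k * int n) = 1" using n2 by (simp add: field_simps)
    then have "k * int n = 1" by linarith
    then show False using n2 by (simp add: zmult_eq_1_iff)
  qed
  have "partial_char G H (\<lambda>_. 1)" by (simp add: partial_char_def)
  from partial_char_extend_one[OF H this x(1) n, of w] wn fin
  obtain K' \<theta>' where K': "subgroup K' G" "insert x H \<subseteq> K'" "partial_char G K' \<theta>'"
    "\<forall>k\<in>H. \<theta>' k = 1" "\<theta>' x = w" by auto
  from partial_char_extend[OF K'(1,3) fin] obtain \<psi> where
    "\<psi> \<in> characters G" "\<forall>k\<in>K'. \<psi> k = \<theta>' k" by blast
  then show ?thesis using K' w1 unfolding annihilator_def by (intro bexI[of _ \<psi>]) auto
qed

section \<open>Orthogonality relations\<close>

lemma (in comm_group) character_simps: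
  assumes "\<psi> \<in> characters G"
  shows "x \<in> carrier G \<Longrightarrow> y \<in> carrier G \<Longrightarrow> \<psi> (x \<otimes> y) = \<psi> x * \<psi> y"
    and "\<psi> \<one> = 1" and "x \<in> carrier G \<Longrightarrow> \<psi> x \<noteq> 0"
    and "x \<in> carrier G \<Longrightarrow> \<psi> (inv x) = inverse (\<psi> x)"
proof -
  show m: "\<psi> (x \<otimes> y) = \<psi> x * \<psi> y" if "x \<in> carrier G" "y \<in> carrier G" for x y
    using assms that by (simp add: characters_def)
  show nz: "\<psi> x \<noteq> 0" if "x \<in> carrier G" for x
    using assms that by (simp add: characters_def)
  show one: "\<psi> \<one> = 1" using m[of \<one> \<one>] nz[of \<one>] by simp
  show "\<psi> (inv x) = inverse (\<psi> x)" if "x \<in> carrier G"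
  proof (rule inverse_unique[symmetric])
    show "\<psi> x * \<psi> (inv x) = 1" using m[of x "inv x"] that one by simp
  qed
qed

lemma (in comm_group) character_power_order:
  assumes "\<psi> \<in> characters G" "x \<in> carrier G" "finite (carrier G)"
  shows "\<psi> x ^ Coset.order G = 1"
proof -
  have "\<psi> (x [^] n) = \<psi> x ^ n" for n :: nat
    by (induction n) (use assms in \<open>auto simp: character_simps\<close>)
  then show ?thesis using pow_order_eq_1[OF assms(2)] character_simps(2)[OF assms(1)] by metis
qed

lemma (in comm_group) norm_character:
  assumes "\<psi> \<in> characters G" "x \<in> carrier G" "finite (carrier G)"
  shows "norm (\<psi> x) = 1"
proof -
  have "norm (\<psi> x) ^ Coset.order G = 1" using character_power_order[OF assms] by (metis norm_one norm_power)
  then show ?thesis using assms(3) order_gt_0_iff_finite power_eq_imp_eq_base[of "norm (\<psi> x)" "Coset.order G" 1]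
    by simp
qed

lemma (in comm_group) finite_characters:
  assumes "finite (carrier G)" shows "finite (characters G)"
proof (rule finite_subset)
  let ?B = "{z :: complex. z ^ Coset.order G = 1}"
  show "characters G \<subseteq> {f. \<forall>x. (x \<in> carrier G \<longrightarrow> f x \<in> ?B) \<and> (x \<notin> carrier G \<longrightarrow> f x = 0)}"
    using character_power_order assms by (auto simp: characters_def)
  have "finite ?B" using assms by (intro finite_roots_unity) (simp add: order_gt_0_iff_finite Suc_le_eq)
  then show "finite {f. \<forall>x. (x \<in> carrier G \<longrightarrow> f x \<in> ?B) \<and> (x \<notin> carrier G \<longrightarrow> f x = 0)}"
    by (intro finite_set_of_finite_funs assms)
qed

lemma (in comm_group) sum_character_eq_0:
  assumes "\<psi> \<in> characters G" "y \<in> carrier G" "\<psi> y \<noteq> 1"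
  shows "(\<Sum>x\<in>carrier G. \<psi> x) = 0"
proof -
  have "(\<Sum>x\<in>carrier G. \<psi> x) = (\<Sum>x\<in>carrier G. \<psi> (y \<otimes> x))"
    by (rule sum.reindex_bij_witness[of _ "\<lambda>x. y \<otimes> x" "\<lambda>x. inv y \<otimes> x"])
      (use assms(2) in \<open>auto simp: m_assoc[symmetric]\<close>)
  also have "\<dots> = \<psi> y * (\<Sum>x\<in>carrier G. \<psi> x)"
    unfolding sum_distrib_left
    by (rule sum.cong) (use assms(1,2) in \<open>auto simp: character_simps\<close>)
  finally show ?thesis using assms(3) by (metis mult_cancel_right1)
qed

lemma (in comm_group) annihilator_mult:
  assumes "\<psi> \<in> annihilator G H" "\<theta> \<in> annihilator G H" "H \<subseteq> carrier G"
  shows "(\<lambda>x. \<psi> x * \<theta> x) \<in> annihilator G H" "(\<lambda>x. inverse (\<psi> x)) \<in> annihilator G H"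
  using assms by (auto simp: annihilator_def characters_def)

text \<open>Off \<open>H\<close>, multiplying by a character of the annihilator that is not 1 at
  \<open>x\<close> permutes the annihilator and forces the sum to 0. Its size then comes from
  summing over characters and group elements in both orders.\<close>

lemma (in comm_group) annihilator_orthogonality:
  assumes H: "subgroup H G" and fin: "finite (carrier G)" and x: "x \<in> carrier G"
  shows "card (annihilator G H) = card (rcosets H)"
    and "(\<Sum>\<psi>\<in>annihilator G H. \<psi> x) = (if x \<in> H then of_nat (card (rcosets H)) else 0)"
proof -
  let ?A = "annihilator G H"
  have HG: "H \<subseteq> carrier G" using H by (rule subgroup.subset)
  have finA: "finite ?A" using finite_characters[OF fin] by (simp add: annihilator_def)
  have z: "(\<Sum>\<psi>\<in>?A. \<psi> x) = 0" if x: "x \<in> carrier G" "x \<notin> H" for x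
  proof -
    obtain \<theta> where \<theta>: "\<theta> \<in> ?A" "\<theta> x \<noteq> 1" using characters_separate[OF H fin x] by blast
    have nz: "y \<in> carrier G \<Longrightarrow> \<theta> y \<noteq> 0" for y using \<theta>(1) by (auto simp: annihilator_def characters_def)
    have out: "y \<notin> carrier G \<Longrightarrow> \<psi> y = 0" if "\<psi> \<in> ?A" for y \<psi>
      using that by (auto simp: annihilator_def characters_def)
    have "(\<Sum>\<psi>\<in>?A. \<psi> x) = (\<Sum>\<psi>\<in>?A. \<theta> x * \<psi> x)"
    proof (rule sum.reindex_bij_witness[of _ "\<lambda>\<psi> y. \<theta> y * \<psi> y" "\<lambda>\<psi> y. inverse (\<theta> y) * \<psi> y"])
      fix \<psi> assume \<psi>: "\<psi> \<in> ?A"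
      show "(\<lambda>y. \<theta> y * \<psi> y) \<in> ?A" using annihilator_mult(1)[OF \<theta>(1) \<psi> HG] .
      show "(\<lambda>y. inverse (\<theta> y) * \<psi> y) \<in> ?A"
        using annihilator_mult(1)[OF annihilator_mult(2)[OF \<theta>(1) \<theta>(1) HG] \<psi> HG] .
      show "(\<lambda>y. \<theta> y * (inverse (\<theta> y) * \<psi> y)) = \<psi>" "(\<lambda>y. inverse (\<theta> y) * (\<theta> y * \<psi> y)) = \<psi>"
        using nz out[OF \<psi>] by (auto simp: fun_eq_iff) (metis mult.commute mult.left_commute mult_cancel_left2 right_inverse mult_zero_right)+
      show "\<theta> x * (inverse (\<theta> x) * \<psi> x) = \<psi> x" using nz x by simp
    qed
    also have "\<dots> = \<theta> x * (\<Sum>\<psi>\<in>?A. \<psi> x)" by (simp add: sum_distrib_left)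
    finally show ?thesis using \<theta>(2) by (metis mult_cancel_right1)
  qed
  have one: "(\<Sum>\<psi>\<in>?A. \<psi> x) = of_nat (card ?A)" if "x \<in> H" for x
    using that by (simp add: annihilator_def)
  let ?t = "\<lambda>x. if x \<in> carrier G then 1 else 0 :: complex"
  have t: "?t \<in> ?A" using HG by (auto simp: annihilator_def characters_def)
  have s0: "(\<Sum>x\<in>carrier G. \<psi> x) = 0" if "\<psi> \<in> ?A - {?t}" for \<psi>
  proof -
    have "\<psi> \<noteq> ?t" "\<psi> \<in> characters G" using that by (auto simp: annihilator_def)
    then obtain y where y: "\<psi> y \<noteq> ?t y" by blast
    then have "y \<in> carrier G" "\<psi> y \<noteq> 1"
      using \<open>\<psi> \<in> characters G\<close> by (auto simp: characters_def split: if_splits)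
    then show ?thesis using sum_character_eq_0 \<open>\<psi> \<in> characters G\<close> by blast
  qed
  \<comment> \<open>Summing over the group first, only the trivial character \<open>?t\<close>
    survives and gives the group order; summing over characters first, only \<open>H\<close>
    survives.\<close>
  have "(\<Sum>\<psi>\<in>?A. \<Sum>x\<in>carrier G. \<psi> x) = (\<Sum>x\<in>carrier G. ?t x) + (\<Sum>\<psi>\<in>?A - {?t}. \<Sum>x\<in>carrier G. \<psi> x)"
    by (rule sum.remove[OF finA t])
  also have "\<dots> = of_nat (Coset.order G)" using s0 by (simp add: Coset.order_def)
  also have "(\<Sum>\<psi>\<in>?A. \<Sum>x\<in>carrier G. \<psi> x) = (\<Sum>x\<in>carrier G. \<Sum>\<psi>\<in>?A. \<psi> x)" by (rule sum.swap)
  also have "\<dots> = (\<Sum>x\<in>H. \<Sum>\<psi>\<in>?A. \<psi> x)"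
    by (rule sum.mono_neutral_right) (use fin HG z in auto)
  also have "\<dots> = of_nat (card H * card ?A)" using one by simp
  finally have 1: "card H * card ?A = Coset.order G" by (metis of_nat_eq_iff)
  have "card H > 0" using H fin HG by (metis card_gt_0_iff empty_iff finite_subset subgroup.one_closed)
  moreover have "card (rcosets H) * card H = Coset.order G" using lagrange[OF H] .
  ultimately show 2: "card ?A = card (rcosets H)" using 1 by (metis mult.commute mult_cancel1 not_gr_zero)
  show "(\<Sum>\<psi>\<in>?A. \<psi> x) = (if x \<in> H then of_nat (card (rcosets H)) else 0)"
    using z[OF x] one[of x] 2 by auto
qed

text \<open>Separates 1 from the zero subgroup in the additive group of \<open>F\<close>.
  Nontriviality at 1 is enough, since the other frequencies are reached by scaling the
  argument.\<close>

lemma exists_additive_character: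
  obtains \<xi> :: "'f::{field,finite} \<Rightarrow> complex"
  where "\<And>a b. \<xi> (a + b) = \<xi> a * \<xi> b" "\<And>a. norm (\<xi> a) = 1" "\<xi> 1 \<noteq> 1"
proof -
  define G :: "'f monoid" where "G = \<lparr>carrier = UNIV, mult = (+), one = 0\<rparr>"
  have "comm_group G"
    by (rule comm_groupI) (auto simp: G_def add_ac intro: exI[of _ "- x" for x])
  then interpret comm_group G .
  have "inv\<^bsub>G\<^esub> 0 = 0" using inv_one by (simp add: G_def)
  then have "subgroup {0} G" by (intro subgroupI) (auto simp: G_def)
  from characters_separate[OF this, of 1] obtain \<psi> where \<psi>: "\<psi> \<in> characters G" "\<psi> 1 \<noteq> 1"
    by (auto simp: G_def annihilator_def)
  show ?thesis
  proof
    show "\<psi> (a + b) = \<psi> a * \<psi> b" for a b using character_simps(1)[OF \<psi>(1)] by (simp add: G_def)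
    show "norm (\<psi> a) = 1" for a using norm_character[OF \<psi>(1)] by (simp add: G_def)
  qed (rule \<psi>)
qed

section \<open>Gauss sums on the cubic algebra\<close>

context cubic_algebra
begin

text \<open>Both are translation arguments: a shift by an element whose product with
  \<open>c\<close>, or whose trace against \<open>z\<close>, equals 1 multiplies the sum by
  \<open>\<xi> 1\<close>. The second shift exists because the trace form is nondegenerate.\<close>

lemma additive_character_sums:
  fixes \<xi> :: "'f \<Rightarrow> complex"
  assumes add: "\<And>a b. \<xi> (a + b) = \<xi> a * \<xi> b" and one: "\<xi> 1 \<noteq> 1" and nz: "\<And>a. \<xi> a \<noteq> 0"
  shows "(\<Sum>a\<in>UNIV. \<xi> (a * c)) = (if c = 0 then of_nat CARD('f) else 0)"
    and "(\<Sum>b\<in>UNIV. \<xi> (Tr \<iota> (b * z))) = (if z = 0 then of_nat CARD('f) ^ 3 else 0)"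
proof -
  have 0: "\<xi> 0 = 1" using add[of 0 0] nz[of 0] by simp
  show "(\<Sum>a\<in>UNIV. \<xi> (a * c)) = (if c = 0 then of_nat CARD('f) else 0)"
  proof (cases "c = 0")
    case False
    have e: "\<xi> ((a + 1 / c) * c) = \<xi> 1 * \<xi> (a * c)" for a
      using False add[of 1 "a * c"] by (simp add: distrib_right add.commute)
    have "(\<Sum>a\<in>UNIV. \<xi> (a * c)) = (\<Sum>a\<in>UNIV. \<xi> ((a + 1 / c) * c))"
      by (rule sum.reindex_bij_witness[of _ "\<lambda>a. a + 1 / c" "\<lambda>a. a - 1 / c"]) auto
    also have "\<dots> = \<xi> 1 * (\<Sum>a\<in>UNIV. \<xi> (a * c))" by (simp only: e sum_distrib_left)
    finally show ?thesis using one False by (metis mult_cancel_right1)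
  qed (simp add: 0)
  show "(\<Sum>b\<in>UNIV. \<xi> (Tr \<iota> (b * z))) = (if z = 0 then of_nat CARD('f) ^ 3 else 0)"
  proof (cases "z = 0")
    case True
    have "Tr \<iota> 0 = 0" using Tr_diff[of 0 0] by simp
    then show ?thesis using True by (simp add: 0 card_B)
  next
    case False
    obtain y where y: "Tr \<iota> (z * y) \<noteq> 0" using Tr_nondegenerate[of z] False by blast
    define y' where "y' = \<iota> (1 / Tr \<iota> (z * y)) * y"
    have y': "Tr \<iota> (y' * z) = 1"
      using y Tr_scale[of "1 / Tr \<iota> (z * y)" "z * y"] by (simp add: y'_def mult_ac)
    have e: "\<xi> (Tr \<iota> ((b + y') * z)) = \<xi> 1 * \<xi> (Tr \<iota> (b * z))" for b
      using add[of 1 "Tr \<iota> (b * z)"] by (simp only: distrib_right Tr_add y' add.commute)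
    have "(\<Sum>b\<in>UNIV. \<xi> (Tr \<iota> (b * z))) = (\<Sum>b\<in>UNIV. \<xi> (Tr \<iota> ((b + y') * z)))"
      by (rule sum.reindex_bij_witness[of _ "\<lambda>a. a + y'" "\<lambda>a. a - y'"]) auto
    also have "\<dots> = \<xi> 1 * (\<Sum>b\<in>UNIV. \<xi> (Tr \<iota> (b * z)))" by (simp only: e sum_distrib_left)
    finally show ?thesis using one False by (metis mult_cancel_right1)
  qed
qed

lemma unit_obtain_inverse:
  assumes "u dvd (1::'b)"
  obtains u' where "u' dvd 1" "u * u' = 1" "u' * u = 1"
proof -
  obtain u' where "1 = u * u'" using assms by (auto simp: dvd_def)
  then show ?thesis using that[of u'] by (metis dvd_triv_right mult.commute)
qed

text \<open>The Gauss sum at a unit has constant modulus, so Parseval over all of \<open>B\<close> bounds it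
  without decomposing \<open>B\<close> into fields.\<close>

lemma gauss_sum_bound:
  fixes \<Psi> :: "'b \<Rightarrow> complex" and \<xi> :: "'f \<Rightarrow> complex"
  assumes mult: "\<And>x y. x dvd 1 \<Longrightarrow> y dvd 1 \<Longrightarrow> \<Psi> (x * y) = \<Psi> x * \<Psi> y"
    and norm1: "\<And>x. x dvd 1 \<Longrightarrow> norm (\<Psi> x) = 1"
    and add: "\<And>a b. \<xi> (a + b) = \<xi> a * \<xi> b" and \<xi>1: "\<xi> 1 \<noteq> 1" and n\<xi>: "\<And>a. norm (\<xi> a) = 1"
  shows "norm (\<Sum>d | d dvd 1. \<Psi> d * \<xi> (Tr \<iota> d)) ^ 2 \<le> real CARD('f) ^ 3"
proof -
  let ?U = "{d :: 'b. d dvd 1}"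
  define Gs where "Gs b = (\<Sum>d\<in>?U. \<Psi> d * \<xi> (Tr \<iota> (b * d)))" for b
  have finU: "finite ?U" by (rule finite_subset[OF subset_UNIV finite_B])
  have nz: "\<xi> a \<noteq> 0" for a using n\<xi>[of a] by auto
  have cnj: "cnj (\<xi> a) = \<xi> (- a)" for a
  proof -
    have "\<xi> 0 = 1" using add[of 0 0] nz[of 0] by simp
    then have "\<xi> a * \<xi> (- a) = 1" using add[of a "- a"] by simp
    moreover have "\<xi> a * cnj (\<xi> a) = 1" using n\<xi>[of a] by (simp add: complex_norm_square[symmetric])
    ultimately show ?thesis using nz by (metis mult_cancel_left)
  qed
  have unit: "norm (Gs u) = norm (Gs 1)" if u: "u \<in> ?U" for u
  proof -
    obtain u' where u': "u' dvd 1" "u * u' = 1" "u' * u = 1" using unit_obtain_inverse u by blast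
    have "Gs u = (\<Sum>d\<in>?U. \<Psi> (u' * d) * \<xi> (Tr \<iota> d))"
      unfolding Gs_def
    proof (rule sum.reindex_bij_witness[of _ "\<lambda>d. u' * d" "\<lambda>d. u * d"])
      fix d assume "d \<in> ?U"
      show "u' * (u * d) = d" "u * (u' * d) = d" using u' by (simp_all add: mult.assoc[symmetric])
      then show "\<Psi> (u' * (u * d)) * \<xi> (Tr \<iota> (u * d)) = \<Psi> d * \<xi> (Tr \<iota> (u * d))" by simp
    qed (use u u' in \<open>auto simp: unit_mult_iff\<close>)
    also have "\<dots> = \<Psi> u' * Gs 1"
      unfolding Gs_def sum_distrib_left by (rule sum.cong) (use u' mult in auto)
    finally show ?thesis using norm1 u' by (simp add: norm_mult)
  qed
  \<comment> \<open>Parseval: summing over \<open>b\<close> by orthogonality keeps only the diagonal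
    \<open>d = d'\<close>.\<close>
  have pars: "(\<Sum>b\<in>UNIV. complex_of_real (norm (Gs b) ^ 2)) = of_nat CARD('f) ^ 3 * of_nat (card ?U)"
  proof -
    have "complex_of_real (norm (Gs b) ^ 2) =
        (\<Sum>d\<in>?U. \<Sum>d'\<in>?U. \<Psi> d * cnj (\<Psi> d') * \<xi> (Tr \<iota> (b * (d - d'))))" for b
    proof -
      have "complex_of_real (norm (Gs b) ^ 2) = Gs b * cnj (Gs b)" by (rule complex_norm_square)
      also have "\<dots> = (\<Sum>d\<in>?U. \<Sum>d'\<in>?U. (\<Psi> d * \<xi> (Tr \<iota> (b * d))) * (cnj (\<Psi> d') * cnj (\<xi> (Tr \<iota> (b * d')))))"
        unfolding Gs_def by (simp add: sum_product)
      also have "\<dots> = (\<Sum>d\<in>?U. \<Sum>d'\<in>?U. \<Psi> d * cnj (\<Psi> d') * \<xi> (Tr \<iota> (b * (d - d'))))"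
      proof (intro sum.cong refl)
        fix d d'
        have "\<xi> (Tr \<iota> (b * (d - d'))) = \<xi> (Tr \<iota> (b * d)) * cnj (\<xi> (Tr \<iota> (b * d')))"
          unfolding cnj add[symmetric] by (simp add: right_diff_distrib Tr_diff)
        then show "(\<Psi> d * \<xi> (Tr \<iota> (b * d))) * (cnj (\<Psi> d') * cnj (\<xi> (Tr \<iota> (b * d')))) =
            \<Psi> d * cnj (\<Psi> d') * \<xi> (Tr \<iota> (b * (d - d')))" by (simp add: mult_ac)
      qed
      finally show ?thesis .
    qed
    then have "(\<Sum>b\<in>UNIV. complex_of_real (norm (Gs b) ^ 2)) =
        (\<Sum>b\<in>UNIV. \<Sum>d\<in>?U. \<Sum>d'\<in>?U. \<Psi> d * cnj (\<Psi> d') * \<xi> (Tr \<iota> (b * (d - d'))))" by (simp only:)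
    also have "\<dots> = (\<Sum>d\<in>?U. \<Sum>b\<in>UNIV. \<Sum>d'\<in>?U. \<Psi> d * cnj (\<Psi> d') * \<xi> (Tr \<iota> (b * (d - d'))))"
      by (rule sum.swap)
    also have "\<dots> = (\<Sum>d\<in>?U. \<Sum>d'\<in>?U. \<Sum>b\<in>UNIV. \<Psi> d * cnj (\<Psi> d') * \<xi> (Tr \<iota> (b * (d - d'))))"
      by (intro sum.cong refl sum.swap)
    also have "\<dots> = (\<Sum>d\<in>?U. \<Sum>d'\<in>?U. \<Psi> d * cnj (\<Psi> d') * (if d = d' then of_nat CARD('f) ^ 3 else 0))"
      by (simp only: sum_distrib_left[symmetric] additive_character_sums(2)[of \<xi>, OF add \<xi>1 nz]
          right_minus_eq)
    also have "\<dots> = (\<Sum>d\<in>?U. \<Psi> d * cnj (\<Psi> d) * of_nat CARD('f) ^ 3)"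
    proof (rule sum.cong[OF refl])
      fix d assume d: "d \<in> ?U"
      have "(\<Sum>d'\<in>?U. \<Psi> d * cnj (\<Psi> d') * (if d = d' then of_nat CARD('f) ^ 3 else 0)) =
          (\<Sum>d'\<in>?U. if d = d' then \<Psi> d * cnj (\<Psi> d') * of_nat CARD('f) ^ 3 else 0)"
        by (rule sum.cong) auto
      also have "\<dots> = \<Psi> d * cnj (\<Psi> d) * of_nat CARD('f) ^ 3"
        using d finU by (simp only: sum.delta' if_True)
      finally show "(\<Sum>d'\<in>?U. \<Psi> d * cnj (\<Psi> d') * (if d = d' then of_nat CARD('f) ^ 3 else 0)) =
        \<Psi> d * cnj (\<Psi> d) * of_nat CARD('f) ^ 3" .
    qed
    also have "\<dots> = (\<Sum>d\<in>?U. of_nat CARD('f) ^ 3)"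
    proof (rule sum.cong[OF refl])
      fix d assume "d \<in> ?U"
      then have "\<Psi> d * cnj (\<Psi> d) = 1" using norm1[of d] by (simp add: complex_norm_square[symmetric])
      then show "\<Psi> d * cnj (\<Psi> d) * of_nat CARD('f) ^ 3 = of_nat CARD('f) ^ 3" by simp
    qed
    also have "\<dots> = of_nat CARD('f) ^ 3 * of_nat (card ?U)" by simp
    finally show ?thesis .
  qed
  then have "complex_of_real (\<Sum>b\<in>UNIV. norm (Gs b) ^ 2) = complex_of_real (real CARD('f) ^ 3 * real (card ?U))"
    by (simp only: of_real_sum of_real_mult of_real_power of_real_of_nat_eq)
  then have P: "(\<Sum>b\<in>UNIV. norm (Gs b) ^ 2) = real CARD('f) ^ 3 * real (card ?U)"
    by (simp only: of_real_eq_iff)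
  \<comment> \<open>The units contribute equal terms, one per element of \<open>?U\<close>; dropping
    the nonnegative terms at nonunits turns Parseval into the bound \<open>q^3\<close> for
    each.\<close>
  have "(\<Sum>b\<in>?U. norm (Gs b) ^ 2) = (\<Sum>b\<in>?U. norm (Gs 1) ^ 2)"
    by (rule sum.cong[OF refl], rule arg_cong[OF unit])
  then have "real (card ?U) * norm (Gs 1) ^ 2 = (\<Sum>b\<in>?U. norm (Gs b) ^ 2)" by simp
  also have "\<dots> \<le> (\<Sum>b\<in>UNIV. norm (Gs b) ^ 2)" by (rule sum_mono2) (use finite_B in auto)
  finally have "real (card ?U) * norm (Gs 1) ^ 2 \<le> real (card ?U) * real CARD('f) ^ 3"
    using P by (simp add: mult.commute)
  moreover have "card ?U > 0" using finU by (auto simp: card_gt_0_iff intro: exI[of _ 1])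
  ultimately have "norm (Gs 1) ^ 2 \<le> real CARD('f) ^ 3" by (simp add: mult_le_cancel_left_pos)
  then show ?thesis by (simp add: Gs_def)
qed

text \<open>Trace zero is detected by averaging \<open>\<xi> (a * Tr d)\<close> over
  \<open>a\<close>. The term \<open>a = 0\<close> vanishes as \<open>\<Psi>\<close> is nontrivial;
  every other term is the same Gauss sum, as \<open>\<Psi>\<close> is trivial on scalars. So the sum
  is \<open>(q-1)/q\<close> times a Gauss sum of modulus at most \<open>q^(3/2)\<close>.\<close>

lemma trace_zero_sum_bound:
  fixes \<Psi> :: "'b \<Rightarrow> complex"
  assumes mult: "\<And>x y. x dvd 1 \<Longrightarrow> y dvd 1 \<Longrightarrow> \<Psi> (x * y) = \<Psi> x * \<Psi> y"
    and norm1: "\<And>x. x dvd 1 \<Longrightarrow> norm (\<Psi> x) = 1"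
    and triv: "\<And>c. c \<noteq> 0 \<Longrightarrow> \<Psi> (\<iota> c) = 1" and nontriv: "u dvd 1" "\<Psi> u \<noteq> 1"
  shows "norm (\<Sum>d | d dvd 1 \<and> Tr \<iota> d = 0. \<Psi> d) \<le> (real CARD('f) - 1) * sqrt (real CARD('f))"
proof -
  let ?U = "{d :: 'b. d dvd 1}" and ?q = "CARD('f)"
  obtain \<xi> :: "'f \<Rightarrow> complex"
    where \<xi>: "\<And>a b. \<xi> (a + b) = \<xi> a * \<xi> b" "\<And>a. norm (\<xi> a) = 1" "\<xi> 1 \<noteq> 1"
    by (rule exists_additive_character) blast
  have nz: "\<xi> a \<noteq> 0" for a using \<xi>(2)[of a] by auto
  have l0: "\<xi> 0 = 1" using \<xi>(1)[of 0 0] nz[of 0] by simp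
  have finU: "finite ?U" by (rule finite_subset[OF subset_UNIV finite_B])
  define A where "A = (\<Sum>d | d dvd 1 \<and> Tr \<iota> d = 0. \<Psi> d)"
  define G1 where "G1 = (\<Sum>d\<in>?U. \<Psi> d * \<xi> (Tr \<iota> d))"
  have sub: "(\<Sum>d\<in>?U. f (v * d)) = (\<Sum>d\<in>?U. f d)" if v: "v dvd 1" for v and f :: "'b \<Rightarrow> complex"
  proof -
    obtain v' where v': "v' dvd 1" "v * v' = 1" "v' * v = 1" using unit_obtain_inverse v by blast
    show ?thesis
      by (rule sum.reindex_bij_witness[of _ "\<lambda>d. v' * d" "\<lambda>d. v * d"])
        (use v v' in \<open>auto simp: unit_mult_iff mult.assoc[symmetric]\<close>)
  qed
  have z: "(\<Sum>d\<in>?U. \<Psi> d) = 0"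
  proof -
    have "(\<Sum>d\<in>?U. \<Psi> d) = (\<Sum>d\<in>?U. \<Psi> (u * d))" using sub[OF nontriv(1)] by simp
    also have "\<dots> = \<Psi> u * (\<Sum>d\<in>?U. \<Psi> d)"
      unfolding sum_distrib_left by (rule sum.cong) (use mult nontriv in auto)
    finally show ?thesis using nontriv(2) by (metis mult_cancel_right1)
  qed
  have g: "(\<Sum>d\<in>?U. \<Psi> d * \<xi> (a * Tr \<iota> d)) = (if a = 0 then 0 else G1)" for a
  proof (cases "a = 0")
    case True
    then show ?thesis using z by (simp add: l0)
  next
    case False
    have "(\<Sum>d\<in>?U. \<Psi> d * \<xi> (a * Tr \<iota> d)) = (\<Sum>d\<in>?U. \<Psi> (\<iota> a * d) * \<xi> (Tr \<iota> (\<iota> a * d)))"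
      by (rule sum.cong) (use False mult triv unit_\<iota>_iff in \<open>auto simp: Tr_scale\<close>)
    also have "\<dots> = G1" unfolding G1_def using sub[of "\<iota> a" "\<lambda>d. \<Psi> d * \<xi> (Tr \<iota> d)"] False
      by (simp add: unit_\<iota>_iff)
    finally show ?thesis using False by simp
  qed
  have "A = (\<Sum>d\<in>?U. if Tr \<iota> d = 0 then \<Psi> d else 0)"
    unfolding A_def using sum.inter_filter[OF finU, of \<Psi> "\<lambda>d. Tr \<iota> d = 0"] by simp
  then have "of_nat ?q * A = (\<Sum>d\<in>?U. \<Psi> d * (\<Sum>a\<in>UNIV. \<xi> (a * Tr \<iota> d)))"
    by (simp add: additive_character_sums(1)[of \<xi>, OF \<xi>(1,3) nz] sum_distrib_left) (rule sum.cong, auto)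
  also have "\<dots> = (\<Sum>a\<in>UNIV. \<Sum>d\<in>?U. \<Psi> d * \<xi> (a * Tr \<iota> d))"
    unfolding sum_distrib_left by (rule sum.swap)
  also have "\<dots> = (\<Sum>a\<in>(UNIV :: 'f set). if a = 0 then 0 else G1)" by (simp only: g)
  also have "\<dots> = (\<Sum>a\<in>UNIV - {0 :: 'f}. G1)"
    by (rule sum.mono_neutral_cong_right) auto
  also have "\<dots> = of_nat (?q - 1) * G1" by (simp add: card_Diff_singleton)
  finally have "norm (of_nat ?q * A) = norm (of_nat (?q - 1) * G1)" by simp
  then have qA: "real ?q * norm A = (real ?q - 1) * norm G1"
    unfolding norm_mult norm_of_nat using CARD_field_gt_1[where 'f='f] by (simp add: of_nat_diff)
  have "norm G1 ^ 2 \<le> real ?q ^ 3"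
    unfolding G1_def by (rule gauss_sum_bound[OF mult norm1 \<xi>(1,3,2)])
  also have "\<dots> = (real ?q * sqrt (real ?q)) ^ 2" by (simp add: power_mult_distrib eval_nat_numeral)
  finally have "norm G1 \<le> real ?q * sqrt (real ?q)" by (rule power2_le_imp_le) simp
  then have "real ?q * norm A \<le> (real ?q - 1) * (real ?q * sqrt (real ?q))"
    unfolding qA using CARD_field_gt_1[where 'f='f] by (intro mult_left_mono) auto
  also have "\<dots> = real ?q * ((real ?q - 1) * sqrt (real ?q))" by simp
  finally show ?thesis
    unfolding A_def[symmetric] using CARD_field_gt_1[where 'f='f]
    by (subst (asm) mult_le_cancel_left_pos) auto
qed

end

section \<open>Exceptional characters and the isogeny\<close>

lemma torus_iff: "y \<in> torus \<longleftrightarrow> y 1 * y 2 * y 3 = 1"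
  by (simp add: torus_def)

context cubic_algebra
begin

text \<open>Polymorphic in the field, like \<open>nrm\<close>, as it is applied both to triples of
  constants and to points over \<open>'f geom\<close>.\<close>

definition frob :: "(3 \<Rightarrow> 'c::field) \<Rightarrow> 3 \<Rightarrow> 'c" where
  "frob t i = t (\<pi> i) ^ CARD('f)"

text \<open>On triples over the field of \<open>q^6\<close> elements this is the norm down to
  \<open>B\<close> from its extension of scalars to that field, written in conjugates.\<close>

definition nrm :: "(3 \<Rightarrow> 'c::field) \<Rightarrow> 3 \<Rightarrow> 'c" where
  "nrm t i = (\<Prod>j<6. t ((\<pi> ^^ j) i) ^ (CARD('f) ^ j))"

lemma Frobenius_eq: "Frobenius e = frob"
  by (simp add: Frobenius_def frob_def \<pi>_def fun_eq_iff)

lemma frob_nrm_shift: "frob (nrm t) i = (\<Prod>j<6. t ((\<pi> ^^ Suc j) i) ^ (CARD('f) ^ Suc j))"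
  unfolding frob_def nrm_def prod_power_distrib
  by (rule prod.cong) (simp_all add: power_mult[symmetric] funpow_swap1 mult.commute)

lemma nrm_frob: "nrm (frob t) i = frob (nrm t) i"
  unfolding frob_nrm_shift unfolding frob_def nrm_def
  by (rule prod.cong) (simp_all add: power_mult[symmetric] mult.commute)

text \<open>Frobenius shifts the product by one step, losing the factor \<open>t i\<close> and
  gaining \<open>t i^(q^6)\<close>, because six steps of \<open>\<pi>\<close> return to
  \<open>i\<close>.\<close>

lemma frob_nrm:
  assumes "t i \<noteq> 0" shows "frob (nrm t) i = nrm t i * t i ^ (CARD('f) ^ 6 - 1)"
proof -
  let ?f = "\<lambda>j. t ((\<pi> ^^ j) i) ^ (CARD('f) ^ j)"
  have "t i * frob (nrm t) i = prod ?f {..<Suc 6}"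
    unfolding frob_nrm_shift by (subst prod.lessThan_Suc_shift) simp
  also have "\<dots> = nrm t i * t i ^ (CARD('f) ^ 6)"
    unfolding nrm_def by (subst prod.lessThan_Suc) (simp only: permutation_3_power_6[OF bij_\<pi>])
  also have "CARD('f) ^ 6 = Suc (CARD('f) ^ 6 - 1)" by simp
  then have "t i ^ (CARD('f) ^ 6) = t i * t i ^ (CARD('f) ^ 6 - 1)" by (metis power_Suc)
  finally show ?thesis using assms by (simp add: mult.left_commute)
qed

lemma nrm_mult: "nrm (\<lambda>i. s i * t i) i = nrm s i * nrm t i"
  by (simp add: nrm_def power_mult_distrib prod.distrib)

lemma nrm_divide: "nrm (\<lambda>i. s i / t i) i = nrm s i / nrm t i"
  by (simp add: nrm_def power_divide prod_dividef)

lemma nrm_power: "nrm (\<lambda>i. s i ^ n) i = nrm s i ^ n"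
  by (simp add: nrm_def prod_power_distrib power_mult[symmetric] mult.commute)

lemma nrm_nz: "(\<And>i. t i \<noteq> 0) \<Longrightarrow> nrm t i \<noteq> 0"
  by (simp add: nrm_def)

lemma nrm_hom: "is_ring_hom f \<Longrightarrow> f (nrm t i) = nrm (\<lambda>i. f (t i)) i"
  by (simp add: nrm_def ring_hom_prod ring_hom_simps)

lemma prod_\<pi>_funpow: "f ((\<pi> ^^ n) 1) * f ((\<pi> ^^ n) 2) * f ((\<pi> ^^ n) 3) = f 1 * f 2 * (f 3 :: 'c::field)"
  by (induction n) (use prod_\<pi>[of "\<lambda>i. f ((\<pi> ^^ n) i)" for n] in \<open>simp_all add: funpow_swap1\<close>)

text \<open>At each step the coordinates are only permuted and raised to a common power, so their
  product is respected. The index \<open>i\<close> is arbitrary since the triple on the right is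
  constant.\<close>

lemma nrm_prod: "nrm t 1 * nrm t 2 * nrm t 3 = nrm (\<lambda>_. t 1 * t 2 * t 3) i"
  unfolding nrm_def prod.distrib[symmetric] power_mult_distrib[symmetric] prod_\<pi>_funpow ..

lemma TB_descent:
  assumes "\<And>i. z i = frob z i" "z 1 * z 2 * z 3 = 1"
  shows "\<exists>a\<in>carrier (TB \<iota>). \<forall>i. e i a = z i"
proof -
  have "z i = z (\<pi> i) ^ CARD('f)" for i using assms(1)[of i] unfolding frob_def .
  from descent[of z, OF this] obtain a where a: "\<And>i. e i a = z i" by blast
  have "Nm \<iota> a = 1" by (subst to_ac_eq_iff[symmetric]) (simp add: Nm_e a assms(2))
  then show ?thesis using a by (intro bexI[of _ a]) (simp_all add: carrier_TB)
qed

lemma e_frob: "frob (\<lambda>i. e i a) i = e i a"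
  using e_\<pi>[of i a] by (simp add: frob_def)

lemma e_prod_TB: "a \<in> carrier (TB \<iota>) \<Longrightarrow> e 1 a * e 2 a * e 3 a = 1"
  using Nm_e[of a] by (simp add: carrier_TB)

section \<open>The Lang and Kummer fibres above the generic point\<close>

definition act :: "'b \<Rightarrow> (3 \<Rightarrow> 'f geom) \<Rightarrow> 3 \<Rightarrow> 'f geom" where
  "act a y = (\<lambda>i. const_geom (e i a) * y i)"

abbreviation lang_fibre :: "(3 \<Rightarrow> 'f geom) set" where
  "lang_fibre \<equiv> generic_fibre torus (lang e)"

abbreviation kummer_fibre :: "((3 \<Rightarrow> 'f geom) \<times> 'f geom) set" where
  "kummer_fibre \<equiv> generic_fibre kummer_cover fst"

lemma generic_point_simps [simp]:
  "generic_point 2 = tgen2" "generic_point 3 = tgen3" "generic_point 1 = inverse (tgen2 * tgen3)"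
  by (simp_all add: generic_point_eq)

lemma generic_point_torus: "(generic_point :: 3 \<Rightarrow> 'f geom) \<in> torus"
  by (simp add: torus_iff tgen_nz field_simps)

lemma generic_point_nz: "(generic_point i :: 'f geom) \<noteq> 0"
  using exhaust_3[of i] by (auto simp: tgen_nz)

lemma kummer_fibre_iff:
  "x \<in> kummer_fibre \<longleftrightarrow> fst x = generic_point \<and> snd x ^ 3 = tgen2 * tgen3 ^ 2"
  using generic_point_torus by (cases x) (auto simp: generic_fibre_def kummer_cover_def)

lemma torus_nz: "y \<in> torus \<Longrightarrow> y i \<noteq> (0 :: 'f geom)"
  using exhaust_3[of i] by (auto simp: torus_iff)

lemma lang_fibre_iff:
  "y \<in> lang_fibre \<longleftrightarrow> y \<in> torus \<and> (\<forall>i. frob y i = generic_point i * y i)"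
proof (cases "y \<in> torus")
  case True
  have "frob y i * inverse (y i) = generic_point i \<longleftrightarrow> frob y i = generic_point i * y i" for i
    using torus_nz[OF True, of i] by (auto simp: field_simps)
  then show ?thesis using True by (auto simp: generic_fibre_def lang_def Frobenius_eq fun_eq_iff)
qed (simp add: generic_fibre_def)

lemma act_lang_fibre:
  assumes "a \<in> carrier (TB \<iota>)" "y \<in> lang_fibre" shows "act a y \<in> lang_fibre"
proof -
  have "const_geom (e 1 a) * const_geom (e 2 a) * const_geom (e 3 a) = 1"
    using e_prod_TB[OF assms(1)] by (simp flip: const_geom_simps)
  moreover have "y 1 * y 2 * y 3 = 1" using assms(2) by (simp add: lang_fibre_iff torus_iff)
  ultimately have "(const_geom (e 1 a) * const_geom (e 2 a) * const_geom (e 3 a)) * (y 1 * y 2 * y 3) = 1" by simp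
  then have "act a y \<in> torus" by (simp add: torus_iff act_def mult_ac)
  moreover have "frob (act a y) i = generic_point i * act a y i" for i
  proof -
    have "frob (act a y) i = const_geom (frob (\<lambda>i. e i a) i) * frob y i"
      by (simp add: frob_def act_def power_mult_distrib const_geom_simps)
    then show ?thesis using assms(2) by (simp add: e_frob lang_fibre_iff act_def mult_ac)
  qed
  ultimately show ?thesis by (simp add: lang_fibre_iff)
qed

text \<open>The ratio of two points is fixed by Frobenius, hence by its sixth iterate, the
  \<open>q^6\<close>-power map. So its coordinates are roots of unity, thus constants, and descend
  to a norm-one element of \<open>B\<close>.\<close>

lemma lang_fibre_torsor:
  assumes y0: "y0 \<in> lang_fibre" and y: "y \<in> lang_fibre"
  shows "\<exists>a\<in>carrier (TB \<iota>). y = act a y0"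
proof -
  define r where "r i = y i / y0 i" for i
  have nz: "y i \<noteq> 0" "y0 i \<noteq> 0" for i using y y0 torus_nz by (auto simp: lang_fibre_iff)
  have fr: "r i = frob r i" for i
  proof -
    have "frob r i = frob y i / frob y0 i" by (simp add: frob_def r_def power_divide)
    then show ?thesis using y y0 nz generic_point_nz[of i] by (simp add: lang_fibre_iff r_def)
  qed
  have "r i = r ((\<pi> ^^ n) i) ^ (CARD('f) ^ n)" for n i
  proof (induction n arbitrary: i)
    case (Suc n)
    have "r i = r (\<pi> i) ^ CARD('f)" using fr[of i] by (simp add: frob_def)
    also have "r (\<pi> i) = r ((\<pi> ^^ n) (\<pi> i)) ^ (CARD('f) ^ n)" by (rule Suc)
    finally show ?case by (simp add: power_mult[symmetric] funpow_swap1 mult.commute)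
  qed simp
  from this[of _ 6] have r6: "r i = r i ^ (CARD('f) ^ 6)" for i
    by (simp only: permutation_3_power_6[OF bij_\<pi>])
  have "\<exists>c. r i = const_geom c" for i
  proof -
    have "CARD('f) ^ 6 = Suc (CARD('f) ^ 6 - 1)" by simp
    then have "r i * r i ^ (CARD('f) ^ 6 - 1) = r i * 1" using r6[of i] by (metis power_Suc mult.right_neutral)
    then have "r i ^ (CARD('f) ^ 6 - 1) = 1" using nz[of i] by (simp add: r_def)
    moreover have "CARD('f) ^ 6 - 1 > 0" using CARD_field_gt_1[where 'f='f] one_less_power[of "CARD('f)" 6] by simp
    ultimately show ?thesis by (metis root_of_unity_const_geom)
  qed
  then obtain c where c: "\<And>i. r i = const_geom (c i)" by metis
  have "c i = frob c i" for i
  proof -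
    have "const_geom (c i) = const_geom (frob c i)"
      using fr[of i] by (simp add: c frob_def const_geom_simps)
    then show ?thesis by simp
  qed
  moreover have "c 1 * c 2 * c 3 = 1"
  proof -
    have "const_geom (c 1 * c 2 * c 3) = (y 1 * y 2 * y 3) / (y0 1 * y0 2 * y0 3)"
      by (simp add: const_geom_simps(4) c[symmetric] r_def)
    also have "\<dots> = const_geom 1" using y y0 by (simp add: lang_fibre_iff torus_iff const_geom_simps)
    finally show ?thesis by simp
  qed
  ultimately obtain a where a: "a \<in> carrier (TB \<iota>)" "\<And>i. e i a = c i" using TB_descent[of c] by blast
  have "y = act a y0" using nz by (simp add: act_def a fun_eq_iff c[symmetric] r_def)
  with a show ?thesis by blast
qed

lemma act_free:
  assumes "y \<in> lang_fibre" "act a y = act b y" shows "a = b"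
proof (rule e_inj)
  fix i
  have "y i \<noteq> 0" using assms torus_nz by (auto simp: lang_fibre_iff)
  then show "e i a = e i b" using fun_cong[OF assms(2), of i] by (simp add: act_def)
qed

lemma act_mult: "act (a * b) y = act a (act b y)"
  by (simp add: act_def const_geom_simps mult.assoc)

lemma act_torus_act: "\<sigma> \<in> galois_group \<Longrightarrow> act_torus \<sigma> (act a y) = act a (act_torus \<sigma> y)"
  by (simp add: act_torus_def act_def ring_hom_simps[OF galois_groupD(1)] galois_groupD(3))

lemma galois_generic_point: "\<sigma> \<in> galois_group \<Longrightarrow> \<sigma> (generic_point i) = (generic_point i :: 'f geom)"
  using exhaust_3[of i] galois_groupD(4,5)[of \<sigma>]
  by (auto simp: ring_hom_inverse[OF galois_groupD(1)] ring_hom_simps[OF galois_groupD(1)])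

lemma act_torus_lang_fibre:
  assumes \<sigma>: "\<sigma> \<in> galois_group" and y: "y \<in> lang_fibre" shows "act_torus \<sigma> y \<in> lang_fibre"
proof -
  note s = ring_hom_simps[OF galois_groupD(1)[OF \<sigma>]]
  have "y 1 * y 2 * y 3 = 1" using y by (simp add: lang_fibre_iff torus_iff)
  then have "\<sigma> (y 1 * y 2 * y 3) = 1" by (simp add: s)
  moreover have "\<sigma> (frob y i) = \<sigma> (generic_point i * y i)" for i using y by (simp add: lang_fibre_iff)
  ultimately show ?thesis
    by (simp add: lang_fibre_iff torus_iff act_torus_def s frob_def galois_generic_point[OF \<sigma>])
qed

lemma act_kummer_fibre:
  assumes \<sigma>: "\<sigma> \<in> galois_group" and x: "x \<in> kummer_fibre" shows "act_kummer \<sigma> x \<in> kummer_fibre"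
proof -
  note s = ring_hom_simps[OF galois_groupD(1)[OF \<sigma>]]
  have "\<sigma> (snd x ^ 3) = \<sigma> (tgen2 * tgen3 ^ 2)" using x by (simp add: kummer_fibre_iff)
  then show ?thesis using x
    by (cases x) (simp add: kummer_fibre_iff act_kummer_def act_torus_def s galois_groupD[OF \<sigma>]
        galois_generic_point[OF \<sigma>])
qed

lemma galois_cancel:
  assumes "\<sigma> \<in> galois_group"
  shows "act_torus (inv_into UNIV \<sigma>) (act_torus \<sigma> y) = y" "act_torus \<sigma> (act_torus (inv_into UNIV \<sigma>) y) = y"
    "act_kummer (inv_into UNIV \<sigma>) (act_kummer \<sigma> x) = x" "act_kummer \<sigma> (act_kummer (inv_into UNIV \<sigma>) x) = x"
  using galois_groupD(2)[OF assms]
  by (auto simp: act_torus_def act_kummer_def bij_is_inj bij_is_surj surj_f_inv_f split: prod.splits)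

text \<open>The Galois elements fixing the Kummer fibre act on the Lang fibre exactly through the image
  of the isogeny.\<close>

lemma coverings_geometry:
  assumes char: "CHAR('f) \<noteq> 3"
  obtains y0 :: "3 \<Rightarrow> 'f geom" and u0 :: "'f geom"
  where "y0 \<in> lang_fibre" "(generic_point, u0) \<in> kummer_fibre"
    "\<And>d. d dvd 1 \<Longrightarrow> \<exists>\<sigma>\<in>galois_group. \<sigma> u0 = u0 \<and> act_torus \<sigma> y0 = act (isog d) y0"
    "\<And>\<sigma>. \<sigma> \<in> galois_group \<Longrightarrow> \<sigma> u0 = u0 \<Longrightarrow> \<exists>d. d dvd 1 \<and> act_torus \<sigma> y0 = act (isog d) y0"
    "\<And>u. (generic_point, u) \<in> kummer_fibre \<Longrightarrow> \<exists>\<sigma>\<in>galois_group. \<sigma> u0 = u"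
    "\<And>\<sigma> u. \<sigma> \<in> galois_group \<Longrightarrow> \<sigma> u0 = u0 \<Longrightarrow> (generic_point, u) \<in> kummer_fibre \<Longrightarrow> \<sigma> u = u"
proof -
  define M where "M = CARD('f) ^ 6 - 1"
  have M0: "M > 0" unfolding M_def using one_less_power[of "CARD('f)" 6] CARD_field_gt_1[where 'f='f] by simp
  define M3 where "M3 = M div 3"
  have M3: "M = 3 * M3" using three_dvd_CARD_power[OF char] by (simp add: M3_def M_def)
  have M30: "M3 > 0" using M0 M3 by simp
  obtain T2 T3 :: "'f geom" where T: "T2 ^ M = tgen2" "T3 ^ M = tgen3"
    and aut: "\<And>a b :: 'f alg_closure. a ^ M = 1 \<Longrightarrow> b ^ M = 1 \<Longrightarrow>
       \<exists>\<sigma>\<in>galois_group. \<sigma> T2 = const_geom a * T2 \<and> \<sigma> T3 = const_geom b * T3"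
    using exists_kummer_automorphisms[OF M0] by blast
  define t :: "3 \<Rightarrow> 'f geom" where "t i = (if i = 2 then T2 else if i = 3 then T3 else inverse (T2 * T3))" for i
  have t_simps: "t 1 = inverse (T2 * T3)" "t 2 = T2" "t 3 = T3" by (simp_all add: t_def)
  have Tnz: "T2 \<noteq> 0" "T3 \<noteq> 0" using T tgen_nz M0 by (auto simp: power_0_left)
  have tM: "t i ^ M = generic_point i" for i
    using exhaust_3[of i] by (auto simp: t_simps T power_inverse power_mult_distrib)
  have tnz: "t i \<noteq> 0" for i using exhaust_3[of i] by (auto simp: t_simps Tnz)
  define y0 where "y0 = nrm t"
  define u0 where "u0 = (T2 * T3 ^ 2) ^ M3"
  have "t 1 * t 2 * t 3 = 1" by (simp add: t_simps Tnz field_simps)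
  then have "y0 1 * y0 2 * y0 3 = 1" unfolding y0_def by (simp only: nrm_prod[of t 1]) (simp add: nrm_def)
  then have y0: "y0 \<in> lang_fibre"
    unfolding lang_fibre_iff torus_iff y0_def frob_nrm[of t, OF tnz, folded M_def] tM
    by (simp add: mult.commute)
  have "u0 ^ 3 = (T2 * T3 ^ 2) ^ M" by (simp add: u0_def M3 power_mult[symmetric] mult.commute)
  also have "\<dots> = T2 ^ M * (T3 ^ M) ^ 2" by (simp add: power_mult_distrib power_mult[symmetric] mult.commute)
  finally have u03: "u0 ^ 3 = tgen2 * tgen3 ^ 2" by (simp only: T)
  have u0nz: "u0 \<noteq> 0" by (simp add: u0_def Tnz)
  \<comment> \<open>The M-th power of \<open>t i\<close> lies in the function field, so
    \<open>\<sigma>\<close> changes \<open>t i\<close> by an M-th root of unity, and the product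
    relation passes to these roots of unity.\<close>
  have sig: "\<exists>\<zeta>. (\<forall>i. \<zeta> i ^ M = 1) \<and> \<zeta> 1 * \<zeta> 2 * \<zeta> 3 = 1 \<and> (\<forall>i. \<sigma> (t i) = const_geom (\<zeta> i) * t i)"
    if \<sigma>: "\<sigma> \<in> galois_group" for \<sigma>
  proof -
    note s = ring_hom_simps[OF galois_groupD(1)[OF \<sigma>]]
    have "\<exists>c. \<sigma> (t i) = const_geom c * t i \<and> c ^ M = 1" for i
    proof -
      have "\<sigma> (t i) ^ M = t i ^ M" by (simp add: s(7)[symmetric] tM galois_generic_point[OF \<sigma>])
      then have "(\<sigma> (t i) / t i) ^ M = 1" using tnz[of i] by (simp add: power_divide)
      then obtain c where "\<sigma> (t i) / t i = const_geom c" "c ^ M = 1"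
        using M0 by (rule root_of_unity_const_geom)
      then show ?thesis using tnz[of i] by (intro exI[of _ c]) (simp add: field_simps)
    qed
    then obtain \<zeta> where \<zeta>: "\<And>i. \<sigma> (t i) = const_geom (\<zeta> i) * t i" "\<And>i. \<zeta> i ^ M = 1" by metis
    have "\<sigma> (t 1 * t 2 * t 3) = const_geom (\<zeta> 1 * \<zeta> 2 * \<zeta> 3) * (t 1 * t 2 * t 3)"
      by (simp only: s \<zeta> const_geom_simps) (simp add: mult_ac)
    then have "const_geom (\<zeta> 1 * \<zeta> 2 * \<zeta> 3) = const_geom 1"
      by (simp only: \<open>t 1 * t 2 * t 3 = 1\<close> s mult_1_right const_geom_simps(1))
    then show ?thesis using \<zeta> by (intro exI[of _ \<zeta>]) simp
  qed
  \<comment> \<open>Conversely every triple of M-th roots of unity with product 1 occurs: two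
    coordinates are prescribed independently and the product relation fixes the third.\<close>
  have ex: "\<exists>\<sigma>\<in>galois_group. \<forall>i. \<sigma> (t i) = const_geom (\<zeta> i) * t i"
    if \<zeta>: "\<And>i. \<zeta> i ^ M = 1" "\<zeta> 1 * \<zeta> 2 * \<zeta> 3 = 1" for \<zeta>
  proof -
    obtain \<sigma> where \<sigma>: "\<sigma> \<in> galois_group" "\<sigma> T2 = const_geom (\<zeta> 2) * T2" "\<sigma> T3 = const_geom (\<zeta> 3) * T3"
      using aut[OF \<zeta>(1)[of 2] \<zeta>(1)[of 3]] by blast
    have "\<zeta> 1 * (\<zeta> 2 * \<zeta> 3) = 1" using \<zeta>(2) by (simp add: mult.assoc)
    then have "\<zeta> 1 = inverse (\<zeta> 2 * \<zeta> 3)" by (metis inverse_unique mult.commute)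
    then have z1: "const_geom (\<zeta> 1) = inverse (const_geom (\<zeta> 2) * const_geom (\<zeta> 3))"
      by (simp only: const_geom_simps)
    have "\<sigma> (t 1) = const_geom (\<zeta> 1) * t 1"
      unfolding t_simps z1 using \<sigma>
      by (simp add: ring_hom_inverse[OF galois_groupD(1)] ring_hom_simps[OF galois_groupD(1)] mult_ac)
    then have "\<sigma> (t i) = const_geom (\<zeta> i) * t i" for i
      using exhaust_3[of i] \<sigma> by (elim disjE) (simp_all only: t_simps)
    then show ?thesis using \<sigma>(1) by blast
  qed
  have su0: "\<sigma> u0 = const_geom ((\<zeta> 2 * \<zeta> 3 ^ 2) ^ M3) * u0"
    if "\<sigma> \<in> galois_group" "\<forall>i. \<sigma> (t i) = const_geom (\<zeta> i) * t i" for \<sigma> \<zeta>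
  proof -
    note s = ring_hom_simps[OF galois_groupD(1)[OF that(1)]]
    have "\<sigma> u0 = (\<sigma> (t 2) * \<sigma> (t 3) ^ 2) ^ M3" by (simp add: u0_def s t_simps)
    also have "\<dots> = (const_geom (\<zeta> 2) * const_geom (\<zeta> 3) ^ 2) ^ M3 * (t 2 * t 3 ^ 2) ^ M3"
      using that(2) by (simp add: power_mult_distrib mult_ac)
    finally show ?thesis by (simp only: t_simps u0_def const_geom_simps)
  qed
  have sy0: "act_torus \<sigma> y0 = (\<lambda>i. const_geom (nrm \<zeta> i) * y0 i)"
    if "\<sigma> \<in> galois_group" "\<forall>i. \<sigma> (t i) = const_geom (\<zeta> i) * t i" for \<sigma> \<zeta>
    using that(2)
    by (simp add: act_torus_def y0_def nrm_hom[OF galois_groupD(1)[OF that(1)]] nrm_mult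
        nrm_hom[OF ring_hom_const_geom])
  have ku: "\<exists>c. c ^ 3 = 1 \<and> u = const_geom c * u0" if "(generic_point, u) \<in> kummer_fibre" for u
  proof -
    have "u ^ 3 = u0 ^ 3" using that u03 by (simp add: kummer_fibre_iff)
    then have "(u / u0) ^ 3 = 1" using u0nz by (simp add: power_divide)
    then obtain c where "u / u0 = const_geom c" "c ^ 3 = 1" by (rule root_of_unity_const_geom) simp
    then show ?thesis using u0nz by (intro exI[of _ c]) (auto simp: field_simps)
  qed
  show thesis
  proof (rule that)
    show "y0 \<in> lang_fibre" by (rule y0)
    show "(generic_point, u0) \<in> kummer_fibre" by (simp add: kummer_fibre_iff u03)
  next
    fix d :: 'b assume d: "d dvd 1"
    then have dnz: "e i d \<noteq> 0" for i by (simp add: unit_iff)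
    have "\<exists>r. r ^ M = e i d" for i using nth_root_exists[OF M0] by blast
    then obtain r where r: "\<And>i. r i ^ M = e i d" by metis
    have rnz: "r i \<noteq> 0" for i using r[of i] dnz[of i] M0 by (auto simp: power_0_left)
    \<comment> \<open>A triple of M-th roots of unity with norm \<open>d\<close>: Frobenius fixes
      the triple of conjugates of \<open>d\<close>, which gives \<open>\<rho>^M = 1\<close>, while
      \<open>nrm \<rho> = frob (nrm r) / nrm r = r^M = d\<close> by telescoping.\<close>
    define \<rho> where "\<rho> i = frob r i / r i" for i
    have \<rho>M: "\<rho> i ^ M = 1" for i
    proof -
      have "frob r i ^ M = frob (\<lambda>i. e i d) i"
        by (simp add: frob_def r[symmetric] power_mult[symmetric] mult.commute)
      then show ?thesis using r[of i] dnz[of i] by (simp add: \<rho>_def power_divide e_frob)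
    qed
    have \<rho>nz: "\<rho> i \<noteq> 0" for i using \<rho>M[of i] M0 by (auto simp: power_0_left)
    have n\<rho>: "nrm \<rho> i = e i d" for i
    proof -
      have "nrm \<rho> i = frob (nrm r) i / nrm r i"
        unfolding \<rho>_def[abs_def] nrm_divide nrm_frob ..
      then show ?thesis using nrm_nz[of r i, OF rnz]
        by (simp add: frob_nrm[of r i, OF rnz, folded M_def] r)
    qed
    define p where "p = \<rho> 1 * \<rho> 2 * \<rho> 3"
    have pnz: "p \<noteq> 0" by (simp add: p_def \<rho>nz)
    have pM: "p ^ M = 1" by (simp add: p_def power_mult_distrib \<rho>M)
    \<comment> \<open>The isogeny applied to \<open>\<rho>\<close>; therefore its norm is
      \<open>isog d\<close>, and \<open>\<zeta> 2 * \<zeta> 3^2\<close> is the cube of an M-th root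
      of unity, which leaves \<open>u0\<close> fixed.\<close>
    define \<zeta> where "\<zeta> i = \<rho> i ^ 3 / p" for i
    have \<zeta>M: "\<zeta> i ^ M = 1" for i
    proof -
      have "(\<rho> i ^ 3) ^ M = (\<rho> i ^ M) ^ 3" by (simp add: mult.commute flip: power_mult)
      then show ?thesis by (simp add: \<zeta>_def power_divide pM \<rho>M)
    qed
    have "\<zeta> 1 * \<zeta> 2 * \<zeta> 3 = (\<rho> 1 * \<rho> 2 * \<rho> 3) ^ 3 / p ^ 3"
      by (simp add: \<zeta>_def power_mult_distrib power3_eq_cube)
    then have \<zeta>1: "\<zeta> 1 * \<zeta> 2 * \<zeta> 3 = 1" using pnz by (simp add: p_def)
    obtain \<sigma> where \<sigma>: "\<sigma> \<in> galois_group" "\<forall>i. \<sigma> (t i) = const_geom (\<zeta> i) * t i"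
      using ex[OF \<zeta>M \<zeta>1] by blast
    have n\<zeta>: "nrm \<zeta> i = e i (isog d)" for i
    proof -
      have "nrm \<zeta> i = nrm \<rho> i ^ 3 / nrm (\<lambda>_. p) i"
        unfolding \<zeta>_def[abs_def] nrm_divide nrm_power ..
      also have "nrm (\<lambda>_. p) i = nrm \<rho> 1 * nrm \<rho> 2 * nrm \<rho> 3" unfolding p_def by (rule nrm_prod[symmetric])
      finally show ?thesis by (simp add: n\<rho> e_isog)
    qed
    have "\<zeta> 2 * \<zeta> 3 ^ 2 = (\<rho> 2 * \<rho> 3 ^ 2 / p) ^ 3"
      by (simp add: \<zeta>_def power_divide power_mult_distrib power3_eq_cube power2_eq_square mult_ac)
    then have "(\<zeta> 2 * \<zeta> 3 ^ 2) ^ M3 = (\<rho> 2 * \<rho> 3 ^ 2 / p) ^ M"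
      by (simp only: M3 power_mult)
    also have "\<dots> = \<rho> 2 ^ M * (\<rho> 3 ^ M) ^ 2 / p ^ M"
      by (simp add: power_divide power_mult_distrib mult.commute flip: power_mult)
    also have "\<dots> = 1" by (simp add: \<rho>M pM)
    finally have "\<sigma> u0 = u0" using su0[OF \<sigma>] by (simp add: const_geom_simps)
    moreover have "act_torus \<sigma> y0 = act (isog d) y0" using sy0[OF \<sigma>] by (simp add: act_def n\<zeta>)
    ultimately show "\<exists>\<sigma>\<in>galois_group. \<sigma> u0 = u0 \<and> act_torus \<sigma> y0 = act (isog d) y0"
      using \<sigma>(1) by blast
  next
    fix \<sigma> :: "'f geom \<Rightarrow> 'f geom" assume \<sigma>: "\<sigma> \<in> galois_group" and fx: "\<sigma> u0 = u0"
    obtain \<zeta> where \<zeta>: "\<And>i. \<zeta> i ^ M = 1" "\<zeta> 1 * \<zeta> 2 * \<zeta> 3 = 1" "\<forall>i. \<sigma> (t i) = const_geom (\<zeta> i) * t i"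
      using sig[OF \<sigma>] by blast
    have \<zeta>nz: "\<zeta> i \<noteq> 0" for i using \<zeta>(1)[of i] M0 by (auto simp: power_0_left)
    have "const_geom ((\<zeta> 2 * \<zeta> 3 ^ 2) ^ M3) * u0 = const_geom 1 * u0"
      using su0[OF \<sigma> \<zeta>(3)] fx by (simp add: const_geom_simps(1))
    then have k1: "(\<zeta> 2 * \<zeta> 3 ^ 2) ^ M3 = 1" using u0nz by (subst (asm) mult_cancel_right) simp
    \<comment> \<open>Fixing \<open>u0\<close> says that the power \<open>M/3\<close> of
      \<open>\<zeta> 2 * \<zeta> 3^2\<close> is 1, so any cube root \<open>v\<close> of that element
      is an M-th root of unity.\<close>
    obtain v where v: "v ^ 3 = \<zeta> 2 * \<zeta> 3 ^ 2" using nth_root_exists[of 3] by auto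
    have vM: "v ^ M = 1" by (simp only: M3 power_mult v k1)
    \<comment> \<open>Found by solving \<open>d^3 / N(d) = \<zeta>\<close> with first coordinate 1:
      the second equation gives \<open>\<gamma> = \<alpha>^2 / \<zeta> 2\<close>, and the third then
      requires \<open>\<alpha>^3 = \<zeta> 2^2 * \<zeta> 3\<close>, which
      \<open>v^2 / \<zeta> 3\<close> satisfies.\<close>
    define \<alpha> where "\<alpha> = v ^ 2 / \<zeta> 3"
    define \<gamma> where "\<gamma> = \<alpha> ^ 2 / \<zeta> 2"
    have sq: "(x ^ 2) ^ M = (x ^ M) ^ 2" for x :: "'f alg_closure"
      by (simp add: mult.commute flip: power_mult)
    have \<alpha>M: "\<alpha> ^ M = 1" by (simp add: \<alpha>_def power_divide sq vM \<zeta>)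
    have \<gamma>M: "\<gamma> ^ M = 1" by (simp add: \<gamma>_def power_divide sq \<alpha>M \<zeta>)
    have \<alpha>3: "\<alpha> ^ 3 = \<zeta> 2 ^ 2 * \<zeta> 3"
    proof -
      have "\<alpha> ^ 3 = (v ^ 3) ^ 2 / \<zeta> 3 ^ 3" by (simp add: \<alpha>_def power_divide flip: power_mult)
      also have "\<dots> = (\<zeta> 2 * \<zeta> 3 ^ 2) ^ 2 / \<zeta> 3 ^ 3" by (simp only: v)
      also have "\<dots> = \<zeta> 2 ^ 2 * \<zeta> 3" using \<zeta>nz[of 3]
        by (simp add: power_mult_distrib field_simps eval_nat_numeral)
      finally show ?thesis .
    qed
    have \<alpha>nz: "\<alpha> \<noteq> 0" and \<gamma>nz: "\<gamma> \<noteq> 0" using \<alpha>M \<gamma>M M0 by (auto simp: power_0_left)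
    define d' :: "3 \<Rightarrow> 'f alg_closure" where "d' i = (if i = 2 then \<alpha> else if i = 3 then \<gamma> else 1)" for i
    have d's: "d' 1 = 1" "d' 2 = \<alpha>" "d' 3 = \<gamma>" by (simp_all add: d'_def)
    have d'M: "d' i ^ M = 1" for i using exhaust_3[of i] by (elim disjE) (simp_all only: d's \<alpha>M \<gamma>M power_one)
    have d'nz: "d' i \<noteq> 0" for i by (simp add: d'_def \<alpha>nz \<gamma>nz)
    have ag: "\<alpha> * \<gamma> = \<zeta> 2 * \<zeta> 3"
      using \<alpha>3 \<zeta>nz[of 2] by (simp add: \<gamma>_def field_simps eval_nat_numeral)
    have g2: "\<gamma> ^ 2 = \<alpha> * \<zeta> 3"
    proof -
      have "\<gamma> ^ 2 = \<alpha> * \<alpha> ^ 3 / \<zeta> 2 ^ 2" by (simp add: \<gamma>_def power_divide eval_nat_numeral)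
      then show ?thesis using \<zeta>nz[of 2] by (simp add: \<alpha>3)
    qed
    have \<zeta>d: "\<zeta> i = d' i ^ 3 / (d' 1 * d' 2 * d' 3)" for i
    proof -
      have 1: "\<zeta> 1 = d' 1 ^ 3 / (d' 1 * d' 2 * d' 3)"
        using \<zeta>(2) \<zeta>nz by (simp add: d's ag field_simps)
      have 2: "\<zeta> 2 = d' 2 ^ 3 / (d' 1 * d' 2 * d' 3)"
        unfolding d's mult_1 ag \<alpha>3 using \<zeta>nz by (simp add: power2_eq_square)
      have "\<gamma> ^ 3 = \<gamma> ^ 2 * \<gamma>" by (simp add: eval_nat_numeral)
      also have "\<dots> = \<zeta> 3 * (\<alpha> * \<gamma>)" by (simp add: g2)
      finally have 3: "\<zeta> 3 = d' 3 ^ 3 / (d' 1 * d' 2 * d' 3)"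
        using \<alpha>nz \<gamma>nz by (simp add: d's)
      show ?thesis using exhaust_3[of i] 1 2 3 by (elim disjE) (simp_all only:)
    qed
    \<comment> \<open>Since the coordinates of \<open>d'\<close> are M-th roots of unity,
      telescoping makes its norm Frobenius-invariant, so the norm descends to a unit of
      \<open>B\<close>.\<close>
    have "nrm d' i = nrm d' (\<pi> i) ^ CARD('f)" for i
      using frob_nrm[of d' i, OF d'nz, folded M_def] unfolding d'M by (simp add: frob_def)
    from descent[of "nrm d'", OF this] obtain x where x: "\<And>i. e i x = nrm d' i" by blast
    have "x dvd 1" by (simp add: unit_iff x nrm_nz[OF d'nz])
    have "nrm \<zeta> i = e i (isog x)" for i
    proof -
      have "nrm \<zeta> i = nrm (\<lambda>i. d' i ^ 3 / (d' 1 * d' 2 * d' 3)) i"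
        by (rule arg_cong[of _ _ "\<lambda>f. nrm f i"]) (rule ext, rule \<zeta>d)
      also have "\<dots> = nrm d' i ^ 3 / (nrm d' 1 * nrm d' 2 * nrm d' 3)"
        unfolding nrm_divide nrm_power nrm_prod[of d' i] ..
      finally show ?thesis by (simp add: e_isog x)
    qed
    then have "act_torus \<sigma> y0 = act (isog x) y0" using sy0[OF \<sigma> \<zeta>(3)] by (simp add: act_def)
    with \<open>x dvd 1\<close> show "\<exists>d. d dvd 1 \<and> act_torus \<sigma> y0 = act (isog d) y0" by blast
  next
    fix u :: "'f geom" assume "(generic_point, u) \<in> kummer_fibre"
    then obtain c where c: "c ^ 3 = 1" "u = const_geom c * u0" using ku by blast
    \<comment> \<open>Scaling \<open>T2\<close> by \<open>\<eta>\<close> and fixing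
      \<open>T3\<close> multiplies \<open>u0\<close> by \<open>\<eta>^(M/3) = c\<close>, which
      reaches every point of the Kummer fibre.\<close>
    obtain \<eta> where \<eta>: "\<eta> ^ M3 = c" using nth_root_exists[OF M30] by blast
    have \<eta>M: "\<eta> ^ M = 1" using c by (simp add: M3 mult.commute[of 3] power_mult \<eta>)
    then have \<eta>nz: "\<eta> \<noteq> 0" using M0 by (auto simp: power_0_left)
    define \<zeta> :: "3 \<Rightarrow> 'f alg_closure" where "\<zeta> i = (if i = 2 then \<eta> else if i = 3 then 1 else inverse \<eta>)" for i
    have s: "\<zeta> 1 = inverse \<eta>" "\<zeta> 2 = \<eta>" "\<zeta> 3 = 1" by (simp_all add: \<zeta>_def)
    have "\<zeta> i ^ M = 1" for i by (simp add: \<zeta>_def \<eta>M power_inverse)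
    moreover have "\<zeta> 1 * \<zeta> 2 * \<zeta> 3 = 1" by (simp add: s \<eta>nz)
    ultimately obtain \<sigma> where \<sigma>: "\<sigma> \<in> galois_group" "\<forall>i. \<sigma> (t i) = const_geom (\<zeta> i) * t i"
      using ex[of \<zeta>] by blast
    have "\<sigma> u0 = u" using su0[OF \<sigma>] by (simp add: s \<eta> c)
    then show "\<exists>\<sigma>\<in>galois_group. \<sigma> u0 = u" using \<sigma> by blast
  next
    fix \<sigma> :: "'f geom \<Rightarrow> 'f geom" and u
    assume \<sigma>: "\<sigma> \<in> galois_group" "\<sigma> u0 = u0" "(generic_point, u) \<in> kummer_fibre"
    then obtain c where c: "u = const_geom c * u0" using ku by blast
    show "\<sigma> u = u"
      using \<sigma> by (simp add: c ring_hom_simps[OF galois_groupD(1)] galois_groupD(3))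
  qed
qed

end

section \<open>Galois action on functions on the two fibres\<close>

lemma functions_onD: "v \<in> functions_on Y \<Longrightarrow> x \<notin> Y \<Longrightarrow> v x = 0"
  unfolding functions_on_def by blast

lemma functions_onI: "(\<And>x. x \<notin> Y \<Longrightarrow> v x = 0) \<Longrightarrow> v \<in> functions_on Y"
  unfolding functions_on_def by blast

context cubic_algebra
begin

interpretation TB: comm_group "TB \<iota>" by (rule comm_group_TB)

text \<open>Translation of \<open>y0\<close> gives a homomorphism \<open>c\<close> from the Galois
  group to \<open>T_B(F)\<close>, and \<open>lang_sheaf\<close> is a line on which
  \<open>\<sigma>\<close> acts by the inverse of \<open>\<psi> (c \<sigma>)\<close>. Such a line
  occurs in the functions on the Kummer fibre, a transitive set, exactly when this character is
  trivial on the stabiliser of \<open>u0\<close>; the image of the stabiliser under \<open>c\<close>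
  consists of the values of \<open>isog\<close> at units.\<close>

theorem exceptional_iff:
  assumes char: "CHAR('f) \<noteq> 3" and \<psi>: "\<psi> \<in> characters (TB \<iota>)"
  shows "\<psi> \<in> exceptional \<iota> e \<longleftrightarrow> (\<forall>d. d dvd 1 \<longrightarrow> \<psi> (isog d) = 1)"
proof -
  obtain y0 u0 where y0: "y0 \<in> lang_fibre" and u0: "(generic_point, u0) \<in> kummer_fibre"
    and F4: "\<And>d. d dvd 1 \<Longrightarrow> \<exists>\<sigma>\<in>galois_group. \<sigma> u0 = u0 \<and> act_torus \<sigma> y0 = act (isog d) y0"
    and F5: "\<And>\<sigma>. \<sigma> \<in> galois_group \<Longrightarrow> \<sigma> u0 = u0 \<Longrightarrow> \<exists>d. d dvd 1 \<and> act_torus \<sigma> y0 = act (isog d) y0"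
    and F6: "\<And>u. (generic_point, u) \<in> kummer_fibre \<Longrightarrow> \<exists>\<sigma>\<in>galois_group. \<sigma> u0 = u"
    and F7: "\<And>\<sigma> u. \<sigma> \<in> galois_group \<Longrightarrow> \<sigma> u0 = u0 \<Longrightarrow> (generic_point, u) \<in> kummer_fibre \<Longrightarrow> \<sigma> u = u"
    by (rule coverings_geometry[OF char]) (rule that; assumption)
  let ?Gal = "galois_group :: ('f geom \<Rightarrow> 'f geom) set"
  let ?L = "lang_sheaf \<iota> e \<psi>"
  have \<psi>m: "\<psi> (a * b) = \<psi> a * \<psi> b" if "a \<in> carrier (TB \<iota>)" "b \<in> carrier (TB \<iota>)" for a b
    using TB.character_simps(1)[OF \<psi> that] by simp
  have \<psi>nz: "\<psi> a \<noteq> 0" if "a \<in> carrier (TB \<iota>)" for a using TB.character_simps(3)[OF \<psi> that] .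
  have "\<exists>a. a \<in> carrier (TB \<iota>) \<and> act_torus \<sigma> y0 = act a y0" if "\<sigma> \<in> galois_group" for \<sigma>
    using lang_fibre_torsor[OF y0 act_torus_lang_fibre[OF that y0]] by blast
  then obtain c where cTB: "\<And>\<sigma>. \<sigma> \<in> galois_group \<Longrightarrow> c \<sigma> \<in> carrier (TB \<iota>)"
    and c: "\<And>\<sigma>. \<sigma> \<in> galois_group \<Longrightarrow> act_torus \<sigma> y0 = act (c \<sigma>) y0" by metis
  have inv: "inv_into UNIV \<sigma> \<in> galois_group" if "\<sigma> \<in> galois_group" for \<sigma> :: "'f geom \<Rightarrow> 'f geom"
    using galois_group_inv[OF that] .
  have c_comp: "c (\<lambda>x. \<sigma> (\<tau> x)) = c \<sigma> * c \<tau>"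
    if \<sigma>: "\<sigma> \<in> galois_group" and \<tau>: "\<tau> \<in> galois_group" for \<sigma> \<tau>
  proof -
    have "act (c (\<lambda>x. \<sigma> (\<tau> x))) y0 = act_torus \<sigma> (act_torus \<tau> y0)"
      using c[OF galois_group_comp[OF \<sigma> \<tau>]] by (simp add: act_torus_def)
    also have "\<dots> = act (c \<tau> * c \<sigma>) y0"
      by (simp add: c[OF \<sigma>] c[OF \<tau>] act_torus_act[OF \<sigma>] act_mult)
    finally show ?thesis using act_free[OF y0] by (simp add: mult.commute)
  qed
  have cinv: "c (inv_into UNIV \<sigma>) * c \<sigma> = 1" if \<sigma>: "\<sigma> \<in> galois_group" for \<sigma>
  proof -
    have "act (c (inv_into UNIV \<sigma>) * c \<sigma>) y0 = act_torus \<sigma> (act_torus (inv_into UNIV \<sigma>) y0)"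
      by (simp add: c[OF \<sigma>] c[OF inv[OF \<sigma>]] act_torus_act[OF \<sigma>] act_mult)
    also have "\<dots> = act 1 y0" by (simp add: galois_cancel[OF \<sigma>] act_def const_geom_simps)
    finally show ?thesis using act_free[OF y0] by blast
  qed
  have \<psi>inv: "\<psi> (c (inv_into UNIV \<sigma>)) = inverse (\<psi> (c \<sigma>))" if \<sigma>: "\<sigma> \<in> galois_group" for \<sigma>
  proof -
    have "\<psi> (c (inv_into UNIV \<sigma>)) * \<psi> (c \<sigma>) = 1"
      using \<psi>m[OF cTB[OF inv[OF \<sigma>]] cTB[OF \<sigma>]] cinv[OF \<sigma>] TB.character_simps(2)[OF \<psi>] by simp
    then show ?thesis by (metis inverse_unique mult.commute)
  qed

  have Lout: "v y = 0" if "v \<in> ?L" "y \<notin> lang_fibre" for v y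
    using that by (simp add: lang_sheaf_def functions_on_def)
  have Lact: "v (act a y) = \<psi> a * v y" if "v \<in> ?L" "a \<in> carrier (TB \<iota>)" "y \<in> lang_fibre" for v a y
    using that by (simp add: lang_sheaf_def act_def)
  have Lscale: "(\<lambda>y. z * v y) \<in> ?L" if "v \<in> ?L" for z v
    using that by (auto simp: lang_sheaf_def functions_on_def)
  have Lgal: "act_fun act_torus \<sigma> v = (\<lambda>y. inverse (\<psi> (c \<sigma>)) * v y)"
    if \<sigma>: "\<sigma> \<in> galois_group" and v: "v \<in> ?L" for \<sigma> v
  proof
    fix y
    show "act_fun act_torus \<sigma> v y = inverse (\<psi> (c \<sigma>)) * v y"
    proof (cases "y \<in> lang_fibre")
      case True
      then obtain a where a: "a \<in> carrier (TB \<iota>)" "y = act a y0" using lang_fibre_torsor[OF y0] by blast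
      have "act_torus (inv_into UNIV \<sigma>) y = act (c (inv_into UNIV \<sigma>)) y"
        unfolding a(2) act_torus_act[OF inv[OF \<sigma>]] c[OF inv[OF \<sigma>]] act_mult[symmetric]
        by (simp only: mult.commute)
      then show ?thesis using Lact[OF v cTB[OF inv[OF \<sigma>]] True] \<psi>inv[OF \<sigma>] by (simp add: act_fun_def)
    next
      case False
      have "act_torus (inv_into UNIV \<sigma>) y \<notin> lang_fibre"
        using act_torus_lang_fibre[OF \<sigma>] galois_cancel(2)[OF \<sigma>] False by metis
      then show ?thesis using False Lout[OF v] by (simp add: act_fun_def)
    qed
  qed
  define v0 where "v0 y = (if y \<in> lang_fibre then \<psi> (THE a. a \<in> carrier (TB \<iota>) \<and> y = act a y0) else 0)" for y
  have v0: "v0 (act a y0) = \<psi> a" if "a \<in> carrier (TB \<iota>)" for a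
  proof -
    have "(THE b. b \<in> carrier (TB \<iota>) \<and> act a y0 = act b y0) = a"
      using that act_free[OF y0] by (intro the_equality) auto
    then show ?thesis using act_lang_fibre[OF that y0] by (simp add: v0_def)
  qed
  have v0L: "v0 \<in> ?L"
    unfolding lang_sheaf_def functions_on_def mem_Collect_eq
  proof (intro conjI ballI allI impI)
    fix a y assume a: "a \<in> carrier (TB \<iota>)" and y: "y \<in> lang_fibre"
    then obtain b where b: "b \<in> carrier (TB \<iota>)" "y = act b y0" using lang_fibre_torsor[OF y0] by blast
    have ab: "a * b \<in> carrier (TB \<iota>)" using a b TB.m_closed[of a b] by simp
    show "v0 (\<lambda>i. const_geom (e i a) * y i) = \<psi> a * v0 y"
      using v0[OF ab] v0[OF b(1)] \<psi>m[OF a b(1)] unfolding b(2) act_mult by (simp add: act_def)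
  qed (simp add: v0_def)
  have v0y0: "v0 y0 = 1"
    using v0[OF TB.one_closed] TB.character_simps(2)[OF \<psi>] by (simp add: act_def const_geom_simps)
  have Lspan: "v = (\<lambda>y. v y0 * v0 y)" if v: "v \<in> ?L" for v
  proof
    fix y
    show "v y = v y0 * v0 y"
    proof (cases "y \<in> lang_fibre")
      case True
      then obtain b where b: "b \<in> carrier (TB \<iota>)" "y = act b y0" using lang_fibre_torsor[OF y0] by blast
      show ?thesis using Lact[OF v b(1) y0] v0[OF b(1)] by (simp add: b(2))
    next
      case False
      then show ?thesis using Lout[OF v] by (simp add: v0_def)
    qed
  qed

  show ?thesis
  proof (intro iffI allI impI)
    fix d :: 'b assume "\<psi> \<in> exceptional \<iota> e" and d: "d dvd 1"
    then obtain W where W: "direct_summand ?Gal (act_fun act_kummer) W (functions_on kummer_fibre)"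
      and iso: "rep_isomorphic ?Gal (act_fun act_torus) ?L (act_fun act_kummer) W"
      unfolding exceptional_def by blast
    obtain \<Phi> where \<Phi>: "bij_betw \<Phi> ?L W" "\<And>\<sigma> v. \<sigma> \<in> ?Gal \<Longrightarrow> v \<in> ?L \<Longrightarrow>
        \<Phi> (act_fun act_torus \<sigma> v) = act_fun act_kummer \<sigma> (\<Phi> v)"
      using iso unfolding rep_isomorphic_def by blast
    obtain \<sigma> where \<sigma>: "\<sigma> \<in> galois_group" "\<sigma> u0 = u0" "act_torus \<sigma> y0 = act (isog d) y0"
      using F4[OF d] by blast
    have "c \<sigma> = isog d" using c[OF \<sigma>(1)] \<sigma>(3) act_free[OF y0] by simp
    have wf: "\<Phi> v0 \<in> functions_on kummer_fibre"
      using W bij_betwE[OF \<Phi>(1)] v0L unfolding direct_summand_def subrepresentation_def by blast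
    have i0: "inv_into UNIV \<sigma> u0 = u0"
      using \<sigma>(2) galois_groupD(2)[OF \<sigma>(1)] by (metis bij_is_inj inv_f_f)
    \<comment> \<open>Fixing \<open>u0\<close> fixes the whole Kummer fibre, so
      \<open>\<sigma>\<close> acts trivially on all functions there, in particular on the image of
      \<open>v0\<close>.\<close>
    have "act_fun act_kummer \<sigma> (\<Phi> v0) = \<Phi> v0"
    proof
      fix x
      show "act_fun act_kummer \<sigma> (\<Phi> v0) x = \<Phi> v0 x"
      proof (cases "x \<in> kummer_fibre")
        case True
        then have "x = (generic_point, snd x)" by (cases x) (simp add: kummer_fibre_iff)
        then have "act_kummer (inv_into UNIV \<sigma>) x = x"
          using F7[OF inv[OF \<sigma>(1)] i0, of "snd x"] True galois_generic_point[OF inv[OF \<sigma>(1)]]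
          by (cases x) (auto simp: act_kummer_def act_torus_def)
        then show ?thesis by (simp add: act_fun_def)
      next
        case False
        then have "act_kummer (inv_into UNIV \<sigma>) x \<notin> kummer_fibre"
          using act_kummer_fibre[OF \<sigma>(1)] galois_cancel(4)[OF \<sigma>(1)] by metis
        then show ?thesis using False by (simp add: act_fun_def functions_onD[OF wf])
      qed
    qed
    then have "\<Phi> (act_fun act_torus \<sigma> v0) = \<Phi> v0" using \<Phi>(2)[OF \<sigma>(1) v0L] by simp
    moreover have "act_fun act_torus \<sigma> v0 \<in> ?L" unfolding Lgal[OF \<sigma>(1) v0L] by (rule Lscale[OF v0L])
    ultimately have "act_fun act_torus \<sigma> v0 = v0"
      using \<Phi>(1) v0L by (meson bij_betw_imp_inj_on inj_onD)
    then have "inverse (\<psi> (c \<sigma>)) * v0 y0 = v0 y0" unfolding Lgal[OF \<sigma>(1) v0L] by (rule fun_cong)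
    then show "\<psi> (isog d) = 1" by (simp add: v0y0 \<open>c \<sigma> = isog d\<close>)
  next
    assume triv: "\<forall>d. d dvd 1 \<longrightarrow> \<psi> (isog d) = 1"
    have fix1: "\<psi> (c \<sigma>) = 1" if \<sigma>: "\<sigma> \<in> galois_group" "\<sigma> u0 = u0" for \<sigma>
    proof -
      obtain d where d: "d dvd 1" "act_torus \<sigma> y0 = act (isog d) y0" using F5[OF \<sigma>] by blast
      then have "c \<sigma> = isog d" using c[OF \<sigma>(1)] act_free[OF y0] by simp
      then show ?thesis using triv d(1) by simp
    qed
    have same: "\<psi> (c \<sigma>) = \<psi> (c \<tau>)"
      if \<sigma>: "\<sigma> \<in> galois_group" and \<tau>: "\<tau> \<in> galois_group" and eq: "\<sigma> u0 = \<tau> u0" for \<sigma> \<tau>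
    proof -
      have "inv_into UNIV \<sigma> (\<tau> u0) = u0"
        unfolding eq[symmetric] using galois_groupD(2)[OF \<sigma>] by (simp add: bij_is_inj)
      then have "\<psi> (c (\<lambda>x. inv_into UNIV \<sigma> (\<tau> x))) = 1"
        using fix1[OF galois_group_comp[OF inv[OF \<sigma>] \<tau>]] by simp
      then have "inverse (\<psi> (c \<sigma>)) * \<psi> (c \<tau>) = 1"
        using c_comp[OF inv[OF \<sigma>] \<tau>] \<psi>m[OF cTB[OF inv[OF \<sigma>]] cTB[OF \<tau>]] \<psi>inv[OF \<sigma>] by simp
      then show ?thesis using \<psi>nz[OF cTB[OF \<sigma>]] by (simp add: field_simps)
    qed
    \<comment> \<open>The eigenfunction on the Kummer fibre: its value at \<open>\<sigma> u0\<close>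
      is \<open>\<psi> (c \<sigma>)\<close>, which depends only on \<open>\<sigma> u0\<close> by
      \<open>same\<close>.\<close>
    define w0 where "w0 x = (if x \<in> kummer_fibre then \<psi> (c (SOME \<sigma>. \<sigma> \<in> galois_group \<and> \<sigma> u0 = snd x)) else 0)"
      for x :: "(3 \<Rightarrow> 'f geom) \<times> 'f geom"
    have w0: "w0 x = \<psi> (c \<tau>)" if x: "x \<in> kummer_fibre" and \<tau>: "\<tau> \<in> galois_group" "\<tau> u0 = snd x" for x \<tau>
    proof -
      have "\<exists>\<sigma>. \<sigma> \<in> galois_group \<and> \<sigma> u0 = snd x" using \<tau> by blast
      from someI_ex[OF this] show ?thesis using same[OF _ \<tau>(1)] \<tau>(2) x unfolding w0_def by simp
    qed
    have ex: "\<exists>\<tau>\<in>galois_group. \<tau> u0 = snd x" if "x \<in> kummer_fibre" for x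
    proof -
      have "(generic_point, snd x) \<in> kummer_fibre" using that by (simp add: kummer_fibre_iff)
      then show ?thesis by (rule F6)
    qed
    have w0nz: "w0 x \<noteq> 0" if x: "x \<in> kummer_fibre" for x
      using ex[OF x] w0[OF x] \<psi>nz cTB by auto
    have w0out: "w0 x = 0" if "x \<notin> kummer_fibre" for x using that by (simp add: w0_def)
    have kout: "act_kummer \<sigma> x \<notin> kummer_fibre" if "\<sigma> \<in> galois_group" "x \<notin> kummer_fibre" for \<sigma> x
      using act_kummer_fibre[OF inv[OF that(1)]] galois_cancel(3)[OF that(1)] that(2) by metis
    have w0act: "w0 (act_kummer \<sigma> x) = \<psi> (c \<sigma>) * w0 x" if \<sigma>: "\<sigma> \<in> galois_group" for \<sigma> x
    proof (cases "x \<in> kummer_fibre")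
      case True
      then obtain \<tau> where \<tau>: "\<tau> \<in> galois_group" "\<tau> u0 = snd x" using ex by blast
      have "snd (act_kummer \<sigma> x) = \<sigma> (\<tau> u0)" by (cases x) (simp add: act_kummer_def \<tau>)
      then have "w0 (act_kummer \<sigma> x) = \<psi> (c (\<lambda>u. \<sigma> (\<tau> u)))"
        by (intro w0 act_kummer_fibre[OF \<sigma> True] galois_group_comp[OF \<sigma> \<tau>(1)]) simp
      then show ?thesis using c_comp[OF \<sigma> \<tau>(1)] \<psi>m[OF cTB[OF \<sigma>] cTB[OF \<tau>(1)]] w0[OF True \<tau>] by simp
    next
      case False
      then show ?thesis using kout[OF \<sigma> False] by (simp add: w0out)
    qed
    have w0gal: "act_fun act_kummer \<sigma> w0 = (\<lambda>x. inverse (\<psi> (c \<sigma>)) * w0 x)" if \<sigma>: "\<sigma> \<in> galois_group" for \<sigma>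
      using w0act[OF inv[OF \<sigma>]] \<psi>inv[OF \<sigma>] by (simp add: act_fun_def)

    define W where "W = {\<lambda>x. z * w0 x | z. True}"
    have fin: "finite kummer_fibre"
    proof (rule finite_subset)
      let ?a = "tgen2 * tgen3 ^ 2 :: 'f geom"
      let ?p = "Polynomial.monom 1 3 - [:?a:]"
      show "kummer_fibre \<subseteq> Pair generic_point ` {u. poly ?p u = 0}"
        by (auto simp: kummer_fibre_iff poly_monom)
      have "poly.coeff ?p 3 = 1" by (simp add: numeral_3_eq_3)
      then have "?p \<noteq> 0" by (metis coeff_0 zero_neq_one)
      then show "finite (Pair (generic_point :: 3 \<Rightarrow> 'f geom) ` {u. poly ?p u = 0})"
        by (intro finite_imageI poly_roots_finite)
    qed
    define n where "n = (of_nat (card kummer_fibre) :: complex)"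
    have n0: "n \<noteq> 0" using fin u0 by (auto simp: n_def)
    \<comment> \<open>Pairing with the inverse eigenfunction \<open>1 / w0\<close>. Under Galois it
      scales by the same character as \<open>w0\<close>, so its kernel is an invariant complement of
      the line; on \<open>w0\<close> itself it takes the nonzero value \<open>n\<close>.\<close>
    define ip where "ip v = (\<Sum>x\<in>kummer_fibre. v x * inverse (w0 x))" for v
    have ipw0: "ip (\<lambda>x. z * w0 x) = z * n" for z
    proof -
      have "ip (\<lambda>x. z * w0 x) = (\<Sum>x\<in>kummer_fibre. z)"
        unfolding ip_def by (rule sum.cong) (use w0nz in auto)
      then show ?thesis by (simp add: n_def)
    qed
    have ipadd: "ip (\<lambda>x. v x + w x) = ip v + ip w" for v w
      by (simp add: ip_def distrib_right sum.distrib)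
    have ipscale: "ip (\<lambda>x. z * v x) = z * ip v" for z v
      by (simp add: ip_def sum_distrib_left mult.assoc)
    have ipgal: "ip (act_fun act_kummer \<sigma> v) = inverse (\<psi> (c \<sigma>)) * ip v" if \<sigma>: "\<sigma> \<in> galois_group" for \<sigma> v
    proof -
      have "ip (act_fun act_kummer \<sigma> v) = (\<Sum>x\<in>kummer_fibre. v x * inverse (w0 (act_kummer \<sigma> x)))"
        unfolding ip_def act_fun_def
        by (rule sum.reindex_bij_witness[of _ "act_kummer \<sigma>" "act_kummer (inv_into UNIV \<sigma>)"])
          (simp_all add: galois_cancel[OF \<sigma>] act_kummer_fibre[OF \<sigma>] act_kummer_fibre[OF inv[OF \<sigma>]])
      also have "\<dots> = inverse (\<psi> (c \<sigma>)) * ip v"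
        unfolding ip_def sum_distrib_left by (rule sum.cong) (simp_all add: w0act[OF \<sigma>] mult_ac)
      finally show ?thesis .
    qed
    define V' where "V' = {v \<in> functions_on kummer_fibre. ip v = 0}"
    have act_out: "act_fun act_kummer \<sigma> v \<in> functions_on kummer_fibre"
      if "\<sigma> \<in> galois_group" "v \<in> functions_on kummer_fibre" for \<sigma> v
      unfolding act_fun_def by (rule functions_onI, rule functions_onD[OF that(2)]) (rule kout[OF inv[OF that(1)]])
    have W0: "(\<lambda>x. z * w0 x) \<in> functions_on kummer_fibre" for z
      by (rule functions_onI) (simp add: w0out)
    have Wgal: "act_fun act_kummer \<sigma> (\<lambda>x. z * w0 x) = (\<lambda>x. (z * inverse (\<psi> (c \<sigma>))) * w0 x)"
      if "\<sigma> \<in> galois_group" for \<sigma> z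
      using fun_cong[OF w0gal[OF that]] by (simp add: act_fun_def mult.assoc)
    have sW: "subrepresentation ?Gal (act_fun act_kummer) W (functions_on kummer_fibre)"
      unfolding subrepresentation_def
    proof (intro conjI ballI allI)
      show "W \<subseteq> functions_on kummer_fibre" unfolding W_def using W0 by blast
      have "(\<lambda>x. 0 * w0 x) \<in> W" unfolding W_def by blast
      then show "(\<lambda>x. 0) \<in> W" by simp
      fix v w assume "v \<in> W" "w \<in> W"
      then obtain a b where "v = (\<lambda>x. a * w0 x)" "w = (\<lambda>x. b * w0 x)" unfolding W_def by blast
      then have "(\<lambda>x. v x + w x) = (\<lambda>x. (a + b) * w0 x)" by (simp add: distrib_right)
      then show "(\<lambda>x. v x + w x) \<in> W" unfolding W_def by blast
    next
      fix k v assume "v \<in> W"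
      then obtain a where "v = (\<lambda>x. a * w0 x)" unfolding W_def by blast
      then have "(\<lambda>x. k * v x) = (\<lambda>x. (k * a) * w0 x)" by (simp add: mult.assoc)
      then show "(\<lambda>x. k * v x) \<in> W" unfolding W_def by blast
    next
      fix \<sigma> v assume "\<sigma> \<in> ?Gal" "v \<in> W"
      then show "act_fun act_kummer \<sigma> v \<in> W" unfolding W_def using Wgal by blast
    qed
    have sV: "subrepresentation ?Gal (act_fun act_kummer) V' (functions_on kummer_fibre)"
      unfolding subrepresentation_def
    proof (intro conjI ballI allI)
      show "V' \<subseteq> functions_on kummer_fibre" unfolding V'_def by blast
      show "(\<lambda>x. 0) \<in> V'" by (simp add: V'_def functions_on_def ip_def)
    next
      fix v w assume "v \<in> V'" "w \<in> V'"
      then show "(\<lambda>x. v x + w x) \<in> V'" by (auto simp: V'_def functions_on_def ipadd)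
    next
      fix k v assume "v \<in> V'"
      then show "(\<lambda>x. k * v x) \<in> V'" by (auto simp: V'_def functions_on_def ipscale)
    next
      fix \<sigma> v assume "\<sigma> \<in> ?Gal" "v \<in> V'"
      then show "act_fun act_kummer \<sigma> v \<in> V'" by (simp add: V'_def act_out ipgal)
    qed
    have int: "W \<inter> V' = {\<lambda>x. 0}"
    proof (intro equalityI subsetI)
      fix v assume "v \<in> W \<inter> V'"
      then obtain z where z: "v = (\<lambda>x. z * w0 x)" and "ip v = 0" unfolding W_def V'_def by blast
      then have "z = 0" using ipw0 n0 by simp
      then show "v \<in> {\<lambda>x. 0}" using z by simp
    next
      fix v :: "(3 \<Rightarrow> 'f geom) \<times> 'f geom \<Rightarrow> complex" assume "v \<in> {\<lambda>x. 0}"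
      then show "v \<in> W \<inter> V'" using sW sV unfolding subrepresentation_def by simp
    qed
    have dec: "\<exists>v\<in>W. \<exists>v'\<in>V'. w = (\<lambda>x. v x + v' x)" if w: "w \<in> functions_on kummer_fibre" for w
    proof -
      define z where "z = ip w / n"
      define v' where "v' x = w x + (- z) * w0 x" for x
      have "ip v' = 0" unfolding v'_def[abs_def] ipadd ipw0 by (simp add: z_def n0)
      moreover have "v' \<in> functions_on kummer_fibre"
        unfolding v'_def[abs_def] by (rule functions_onI) (simp add: w0out functions_onD[OF w])
      ultimately have "v' \<in> V'" by (simp add: V'_def)
      moreover have "(\<lambda>x. z * w0 x) \<in> W" unfolding W_def by blast
      moreover have "w = (\<lambda>x. z * w0 x + v' x)" by (simp add: v'_def)
      ultimately show ?thesis by (intro bexI[of _ "\<lambda>x. z * w0 x"] bexI[of _ v'])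
    qed
    have ds: "direct_summand ?Gal (act_fun act_kummer) W (functions_on kummer_fibre)"
      unfolding direct_summand_def using sW sV int dec by blast
    define \<Phi> where "\<Phi> v = (\<lambda>x. v y0 * w0 x)" for v :: "(3 \<Rightarrow> 'f geom) \<Rightarrow> complex"
    have "rep_isomorphic ?Gal (act_fun act_torus) ?L (act_fun act_kummer) W"
      unfolding rep_isomorphic_def
    proof (intro exI[of _ \<Phi>] conjI ballI allI)
      show "bij_betw \<Phi> ?L W"
        unfolding bij_betw_def
      proof
        show "inj_on \<Phi> ?L"
        proof (rule inj_onI)
          fix v w assume v: "v \<in> ?L" and w: "w \<in> ?L" and vw: "\<Phi> v = \<Phi> w"
          have "v y0 * w0 (generic_point, u0) = w y0 * w0 (generic_point, u0)"
            using fun_cong[OF vw, of "(generic_point, u0)"] by (simp add: \<Phi>_def)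
          then have eq: "v y0 = w y0" using w0nz[OF u0] by simp
          have "v = (\<lambda>y. v y0 * v0 y)" by (rule Lspan[OF v])
          also have "\<dots> = w" unfolding eq by (rule Lspan[OF w, symmetric])
          finally show "v = w" .
        qed
        show "\<Phi> ` ?L = W"
        proof (intro equalityI subsetI)
          fix x assume "x \<in> \<Phi> ` ?L"
          then show "x \<in> W" unfolding W_def \<Phi>_def by blast
        next
          fix x assume "x \<in> W"
          then obtain z where z: "x = (\<lambda>x. z * w0 x)" unfolding W_def by blast
          have "x = \<Phi> (\<lambda>y. z * v0 y)" by (simp add: \<Phi>_def v0y0 z)
          then show "x \<in> \<Phi> ` ?L" using Lscale[OF v0L] by blast
        qed
      qed
      fix v assume v: "v \<in> ?L"
      show "\<Phi> (\<lambda>x. v x + w x) = (\<lambda>y. \<Phi> v y + \<Phi> w y)" for w by (simp add: \<Phi>_def distrib_right)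
      show "\<Phi> (\<lambda>x. k * v x) = (\<lambda>y. k * \<Phi> v y)" for k by (simp add: \<Phi>_def mult.assoc)
      show "\<Phi> (act_fun act_torus \<sigma> v) = act_fun act_kummer \<sigma> (\<Phi> v)" if \<sigma>: "\<sigma> \<in> ?Gal" for \<sigma>
        unfolding \<Phi>_def Wgal[OF \<sigma>] Lgal[OF \<sigma> v] by (simp add: mult.commute)
    qed
    with ds \<psi> show "\<psi> \<in> exceptional \<iota> e" unfolding exceptional_def by blast
  qed
qed

end

section \<open>The nodal curve\<close>

text \<open>The first symmetric function being 0, the product condition says that the second is
  minus the third, so \<open>a\<close> is a root of \<open>X^3 - abc (X + 1)\<close>.\<close>

lemma nodal_cubic_cube:
  fixes a b c :: "'k::field"
  assumes s: "a + b + c = 0" and p: "(1 + a) * (1 + b) * (1 + c) = 1"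
  shows "a ^ 3 = a * b * c * (1 + a)"
proof -
  have "c = (a + b + c) - a - b" by simp
  then have c: "c = - a - b" using s by simp
  have "a ^ 3 - a * b * c * (1 + a) = a * (1 - (1 + a) * (1 + b) * (1 + c))"
    unfolding c by (simp add: algebra_simps power3_eq_cube)
  then show ?thesis using p by simp
qed

text \<open>The elements \<open>a\<close>, \<open>b\<close>, \<open>c\<close> are the roots of
  \<open>X^3 + (ab + bc + ca) X - abc\<close>; the sum of the three relations is the first
  identity.\<close>

lemma sum_cubes_eq:
  fixes a b c :: "'k::field"
  assumes s: "a + b + c = 0"
  shows "a ^ 3 + b ^ 3 + c ^ 3 = 3 * (a * b * c)"
    and "a ^ 3 = a * b * c - (a * b + b * c + c * a) * a"
proof -
  have "c = (a + b + c) - a - b" by simp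
  then have c: "c = - a - b" using s by simp
  show "a ^ 3 + b ^ 3 + c ^ 3 = 3 * (a * b * c)"
    unfolding c by (simp add: algebra_simps power3_eq_cube)
  show "a ^ 3 = a * b * c - (a * b + b * c + c * a) * a"
    unfolding c by (simp add: algebra_simps power3_eq_cube)
qed

context cubic_algebra
begin

interpretation TB: comm_group "TB \<iota>" by (rule comm_group_TB)

definition nodal :: "'b set" where "nodal = {x. Nm \<iota> x = 1 \<and> Tr \<iota> x = 3}"

lemma Tr_1: "Tr \<iota> 1 = 3"
  by (subst to_ac_eq_iff[symmetric]) (simp add: Tr_e)

lemma one_nodal: "1 \<in> nodal" by (simp add: nodal_def Nm_1 Tr_1)

lemma finite_nodal: "finite nodal" by (rule finite_subset[OF subset_UNIV finite_B])

lemma Tr_0_iff: "Tr \<iota> d = 0 \<longleftrightarrow> e 1 d + e 2 d + e 3 d = 0"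
  by (simp flip: Tr_e)

text \<open>With \<open>y = x - 1\<close> the equations of the curve become
  \<open>y^3 = N(y) (1 + y)\<close> on conjugates. If \<open>N(y)\<close> were 0, every conjugate of
  \<open>y\<close> would vanish; hence only the node escapes.\<close>

lemma nodal_isog:
  assumes x: "x \<in> nodal" "x \<noteq> 1"
  shows "x - 1 dvd 1" "Tr \<iota> (x - 1) = 0" "isog (x - 1) = x"
proof -
  let ?y = "\<lambda>i. e i (x - 1)"
  show t: "Tr \<iota> (x - 1) = 0" using x by (simp add: Tr_diff Tr_1 nodal_def)
  have s: "?y 1 + ?y 2 + ?y 3 = 0" using t by (simp only: Tr_0_iff)
  have "e 1 x * e 2 x * e 3 x = 1" using x Nm_e[of x] by (simp add: nodal_def)
  then have p: "(1 + ?y 1) * (1 + ?y 2) * (1 + ?y 3) = 1" by simp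
  have 1: "?y 1 ^ 3 = (?y 1 * ?y 2 * ?y 3) * (1 + ?y 1)" by (rule nodal_cubic_cube[OF s p])
  have 2: "?y 2 ^ 3 = (?y 1 * ?y 2 * ?y 3) * (1 + ?y 2)"
    using nodal_cubic_cube[of "?y 2" "?y 1" "?y 3"] s p by (simp only: mult_ac add_ac)
  have 3: "?y 3 ^ 3 = (?y 1 * ?y 2 * ?y 3) * (1 + ?y 3)"
    using nodal_cubic_cube[of "?y 3" "?y 1" "?y 2"] s p by (simp only: mult_ac add_ac)
  have cube: "?y i ^ 3 = (?y 1 * ?y 2 * ?y 3) * (1 + ?y i)" for i
    using exhaust_3[of i] 1 2 3 by (elim disjE) (simp_all only:)
  have nz: "?y 1 * ?y 2 * ?y 3 \<noteq> 0"
  proof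
    assume "?y 1 * ?y 2 * ?y 3 = 0"
    then have "?y i ^ 3 = 0" for i by (simp only: cube[of i]) simp
    then have "e i x = e i 1" for i by (metis e_simps(6) eq_iff_diff_eq_0 power_eq_0_iff)
    then show False using x(2) e_inj by blast
  qed
  show "x - 1 dvd 1" using nz unfolding unit_iff forall_3
    by (simp only: mult_eq_0_iff de_Morgan_disj simp_thms)
  show "isog (x - 1) = x"
  proof (rule e_inj)
    fix i
    have "e i (isog (x - 1)) = (?y 1 * ?y 2 * ?y 3) * (1 + ?y i) / (?y 1 * ?y 2 * ?y 3)"
      unfolding e_isog by (rule arg_cong[OF cube])
    also have "\<dots> = 1 + ?y i" by (rule nonzero_mult_div_cancel_left[OF nz])
    finally show "e i (isog (x - 1)) = e i x" by simp
  qed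
qed

lemma isog_nodal:
  assumes d: "d dvd 1" "Tr \<iota> d = 0" shows "isog d \<in> nodal"
proof -
  have s: "e 1 d + e 2 d + e 3 d = 0" using d(2) by (simp only: Tr_0_iff)
  have nz: "e 1 d * e 2 d * e 3 d \<noteq> 0" using d(1) by (simp add: unit_iff)
  have "to_ac (Tr \<iota> (isog d)) = (e 1 d ^ 3 + e 2 d ^ 3 + e 3 d ^ 3) / (e 1 d * e 2 d * e 3 d)"
    by (simp only: Tr_e e_isog add_divide_distrib)
  also have "\<dots> = to_ac 3" unfolding sum_cubes_eq(1)[OF s] using nz by (simp add: d unit_iff)
  finally have "Tr \<iota> (isog d) = 3" by (simp only: to_ac_eq_iff)
  then show ?thesis using isog_in_TB[OF d(1)] by (simp add: nodal_def carrier_TB)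
qed

text \<open>Comparing the first conjugate with the one that Frobenius carries to it shows
  \<open>l^q = l\<close>, so the ratio is a scalar of \<open>F\<close>.\<close>

lemma scalar_ratio:
  assumes d: "d dvd 1" and l: "\<And>i. e i d' = l * e i d" and "l \<noteq> 0"
  shows "\<exists>k. k \<noteq> 0 \<and> d' = \<iota> k * d"
proof -
  have "l * e 1 d = l ^ CARD('f) * e 1 d"
    using e_\<pi>[of 1 d'] e_\<pi>[of 1 d] l[of 1] l[of "\<pi> 1"] by (metis power_mult_distrib)
  moreover have "e 1 d \<noteq> 0" using d by (simp add: unit_iff)
  ultimately have "l ^ CARD('f) = l" by simp
  then obtain k where k: "l = to_ac k" unfolding power_CARD_eq_self_iff by blast
  have "d' = \<iota> k * d" by (rule e_inj) (simp add: l k)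
  then show ?thesis using k \<open>l \<noteq> 0\<close> by auto
qed

text \<open>For trace-zero \<open>d\<close>, with second symmetric function \<open>f\<close> and
  norm \<open>n\<close>, the cubic equation gives \<open>isog d - 1 = - (f / n) d\<close> on
  conjugates. So \<open>d\<close> is proportional to \<open>x - 1\<close>, and \<open>f = 0\<close>
  happens only over the node.\<close>

lemma isog_fibre:
  assumes x: "x \<in> nodal" "x \<noteq> 1"
  shows "{d. d dvd 1 \<and> Tr \<iota> d = 0 \<and> isog d = x} = (\<lambda>k. \<iota> k * (x - 1)) ` (UNIV - {0})"
proof (intro equalityI subsetI)
  fix d assume "d \<in> {d. d dvd 1 \<and> Tr \<iota> d = 0 \<and> isog d = x}"
  then have d: "d dvd 1" "Tr \<iota> d = 0" "isog d = x" by auto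
  have s: "e 1 d + e 2 d + e 3 d = 0" using d(2) by (simp only: Tr_0_iff)
  define n where "n = e 1 d * e 2 d * e 3 d"
  define f where "f = e 1 d * e 2 d + e 2 d * e 3 d + e 3 d * e 1 d"
  have nz: "n \<noteq> 0" using d(1) by (simp add: unit_iff n_def)
  have 1: "e 1 d ^ 3 = n - f * e 1 d"
    using sum_cubes_eq(2)[OF s] by (simp add: n_def f_def)
  have 2: "e 2 d ^ 3 = n - f * e 2 d"
    using sum_cubes_eq(2)[of "e 2 d" "e 3 d" "e 1 d"] s by (simp add: n_def f_def mult_ac add_ac)
  have 3: "e 3 d ^ 3 = n - f * e 3 d"
    using sum_cubes_eq(2)[of "e 3 d" "e 1 d" "e 2 d"] s by (simp add: n_def f_def mult_ac add_ac)
  have cube: "e i d ^ 3 = n - f * e i d" for i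
    using exhaust_3[of i] 1 2 3 by (elim disjE) (simp_all only:)
  have y: "e i (x - 1) = - (f / n) * e i d" for i
  proof -
    have "e i x = (n - f * e i d) / n" unfolding d(3)[symmetric] e_isog n_def[symmetric] cube ..
    then show ?thesis using nz by (simp add: field_simps)
  qed
  have "f \<noteq> 0"
  proof
    assume "f = 0"
    then have "e i (x - 1) = e i 0" for i using y[of i] by simp
    then have "x - 1 = 0" by (rule e_inj)
    then show False using x(2) by simp
  qed
  have "\<exists>k. k \<noteq> 0 \<and> d = \<iota> k * (x - 1)"
    by (rule scalar_ratio[OF nodal_isog(1)[OF x], of _ "- (n / f)"]) (use nz \<open>f \<noteq> 0\<close> in \<open>simp_all only: y, simp_all\<close>)
  then show "d \<in> (\<lambda>k. \<iota> k * (x - 1)) ` (UNIV - {0})" by blast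
next
  fix d assume "d \<in> (\<lambda>k. \<iota> k * (x - 1)) ` (UNIV - {0})"
  then obtain k where k: "k \<noteq> 0" "d = \<iota> k * (x - 1)" by blast
  then show "d \<in> {d. d dvd 1 \<and> Tr \<iota> d = 0 \<and> isog d = x}"
    using nodal_isog[OF x] unit_\<iota>_iff[of k] by (simp add: unit_mult_iff Tr_scale isog_mult isog_\<iota>)
qed

lemma card_isog_fibre:
  assumes x: "x \<in> nodal" "x \<noteq> 1"
  shows "card {d. d dvd 1 \<and> Tr \<iota> d = 0 \<and> isog d = x} = CARD('f) - 1"
proof -
  have nz: "e 1 (x - 1) \<noteq> 0" using nodal_isog(1)[OF x] unfolding unit_iff by blast
  have "inj (\<lambda>k. \<iota> k * (x - 1))"
  proof (rule injI)
    fix k l assume "\<iota> k * (x - 1) = \<iota> l * (x - 1)"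
    then have "e 1 (\<iota> k * (x - 1)) = e 1 (\<iota> l * (x - 1))" by simp
    then have "to_ac k * e 1 (x - 1) = to_ac l * e 1 (x - 1)" by (simp only: e_simps(4) e_\<iota>)
    then show "k = l" using nz by (simp only: mult_cancel_right to_ac_eq_iff) simp
  qed
  then show ?thesis unfolding isog_fibre[OF x]
    by (subst card_image) (auto intro: inj_on_subset simp: card_Diff_singleton)
qed

text \<open>Two trace-zero solutions of \<open>d^3 = N(d)\<close> with the same ratio of the first two conjugates
  are proportional, and that ratio is a cube root of unity.\<close>

lemma card_isog_fibre_1:
  "card {d. d dvd 1 \<and> Tr \<iota> d = 0 \<and> isog d = 1} \<le> 3 * (CARD('f) - 1)"
proof -
  let ?S = "{d. d dvd 1 \<and> Tr \<iota> d = 0 \<and> isog d = 1}"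
  let ?Z = "{z :: 'f alg_closure. z ^ 3 = 1}"
  let ?p = "Polynomial.monom 1 3 - 1 :: 'f alg_closure poly"
  define Sz where "Sz z = {d \<in> ?S. e 2 d / e 1 d = z}" for z
  have "poly.coeff ?p 3 = 1" by simp
  then have pnz: "?p \<noteq> 0" by (metis coeff_0 zero_neq_one)
  have Z: "?Z = {z. poly ?p z = 0}" by (simp add: poly_monom)
  have "Polynomial.degree ?p \<le> 3" by (intro degree_diff_le degree_monom_le) simp
  then have cZ: "card ?Z \<le> 3" unfolding Z using card_poly_roots_bound[OF pnz] by linarith
  have fZ: "finite ?Z" unfolding Z using pnz by (rule poly_roots_finite)
  have finB: "finite A" for A :: "'b set" by (rule finite_subset[OF subset_UNIV finite_B])
  have le: "card (Sz z) \<le> CARD('f) - 1" for z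
  proof (cases "Sz z = {}")
    case False
    then obtain d0 where d0: "d0 dvd 1" "Tr \<iota> d0 = 0" "e 2 d0 / e 1 d0 = z" by (auto simp: Sz_def)
    have "Sz z \<subseteq> (\<lambda>k. \<iota> k * d0) ` (UNIV - {0})"
    proof
      fix d assume "d \<in> Sz z"
      then have d: "d dvd 1" "Tr \<iota> d = 0" "e 2 d / e 1 d = z" by (auto simp: Sz_def)
      have nz: "e 1 d \<noteq> 0" "e 1 d0 \<noteq> 0" using d d0 by (simp_all add: unit_iff)
      have "e 2 d = (e 2 d / e 1 d) * e 1 d" "e 2 d0 = (e 2 d0 / e 1 d0) * e 1 d0" using nz by simp_all
      then have r: "e 2 d = z * e 1 d" "e 2 d0 = z * e 1 d0" by (simp_all only: d(3) d0(3))
      have "e 1 d + e 2 d + e 3 d = 0" "e 1 d0 + e 2 d0 + e 3 d0 = 0"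
        using d(2) d0(2) by (simp_all only: Tr_0_iff)
      then have r3: "e 3 d = - (1 + z) * e 1 d" "e 3 d0 = - (1 + z) * e 1 d0"
        unfolding r by (simp_all add: algebra_simps add_eq_0_iff)
      define l where "l = e 1 d / e 1 d0"
      have "e 1 d = l * e 1 d0" "e 2 d = l * e 2 d0" "e 3 d = l * e 3 d0"
        unfolding r r3 using nz by (simp_all add: l_def)
      then have l: "e i d = l * e i d0" for i using exhaust_3[of i] by (elim disjE) (simp_all only:)
      have "l \<noteq> 0" using nz by (simp add: l_def)
      then have "\<exists>k. k \<noteq> 0 \<and> d = \<iota> k * d0" by (rule scalar_ratio[OF d0(1) l])
      then show "d \<in> (\<lambda>k. \<iota> k * d0) ` (UNIV - {0})" by blast
    qed
    then have "card (Sz z) \<le> card ((\<lambda>k. \<iota> k * d0) ` (UNIV - {0}))" by (rule card_mono[OF finB])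
    also have "\<dots> \<le> card (UNIV - {0 :: 'f})" by (rule card_image_le) simp
    also have "\<dots> = CARD('f) - 1" by (simp add: card_Diff_singleton)
    finally show ?thesis .
  qed simp
  have "?S \<subseteq> (\<Union>z\<in>?Z. Sz z)"
  proof
    fix d assume d: "d \<in> ?S"
    then have nz: "e i d \<noteq> 0" for i by (simp add: unit_iff)
    have "e i d ^ 3 / (e 1 d * e 2 d * e 3 d) = 1" for i
      using d by (simp flip: e_isog)
    then have "e i d ^ 3 = e 1 d * e 2 d * e 3 d" for i using nz by (simp add: field_simps)
    then have "e 2 d ^ 3 = e 1 d ^ 3" by metis
    then have "(e 2 d / e 1 d) ^ 3 = 1" using nz[of 1] by (simp add: power_divide)
    then show "d \<in> (\<Union>z\<in>?Z. Sz z)" using d by (simp add: Sz_def)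
  qed
  then have "card ?S \<le> card (\<Union>z\<in>?Z. Sz z)" by (rule card_mono[OF finB])
  also have "\<dots> \<le> (\<Sum>z\<in>?Z. card (Sz z))" by (rule card_UN_le[OF fZ])
  also have "\<dots> \<le> (\<Sum>z\<in>?Z. CARD('f) - 1)" by (rule sum_mono[OF le])
  also have "\<dots> = card ?Z * (CARD('f) - 1)" by simp
  also have "\<dots> \<le> 3 * (CARD('f) - 1)" using cZ by (rule mult_le_mono1)
  finally show ?thesis .
qed

section \<open>Character sums over the nodal cubic\<close>

lemma finite_TB: "finite (carrier (TB \<iota>))"
  by (rule finite_subset[OF subset_UNIV finite_B])

lemma nodal_TB: "x \<in> nodal \<Longrightarrow> x \<in> carrier (TB \<iota>)"
  by (simp add: nodal_def carrier_TB)

lemma nodal_sum_trivial: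
  assumes \<psi>: "\<psi> \<in> characters (TB \<iota>)" and triv: "\<And>d. d dvd 1 \<Longrightarrow> \<psi> (isog d) = 1"
  shows "(\<Sum>x\<in>nodal. \<psi> x) = of_nat (card nodal)"
proof -
  have "\<psi> x = 1" if "x \<in> nodal" for x
  proof (cases "x = 1")
    case True
    then show ?thesis using TB.character_simps(2)[OF \<psi>] by simp
  next
    case False
    then show ?thesis using triv[OF nodal_isog(1)[OF that False]] nodal_isog(3)[OF that False] by simp
  qed
  then show ?thesis by simp
qed

text \<open>Summing over parameters \<open>d\<close> counts every point other than the node
  \<open>q - 1\<close> times, and the node \<open>r\<close> times with
  \<open>0 \<le> r \<le> 3 (q - 1)\<close>. Replacing \<open>r\<close> by \<open>q - 1\<close> costs
  at most \<open>2 (q - 1)\<close>, so division by \<open>q - 1\<close> leaves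
  \<open>sqrt q + 2\<close>.\<close>

lemma nodal_sum_bound:
  assumes \<psi>: "\<psi> \<in> characters (TB \<iota>)" and u: "u dvd 1" "\<psi> (isog u) \<noteq> 1"
  shows "norm (\<Sum>x\<in>nodal. \<psi> x) \<le> 3 * sqrt (real CARD('f)) + 3"
proof -
  let ?D = "{d. d dvd 1 \<and> Tr \<iota> d = 0}" and ?F = "\<lambda>x. {d. d dvd 1 \<and> Tr \<iota> d = 0 \<and> isog d = x}"
  define S where "S = (\<Sum>x\<in>nodal. \<psi> x)"
  define Q where "Q = real CARD('f) - 1"
  have Q: "Q > 0" using CARD_field_gt_1[where 'f='f] by (simp add: Q_def)
  define A where "A = (\<Sum>d\<in>?D. \<psi> (isog d))"
  define r where "r = real (card (?F 1))"
  have r: "0 \<le> r" "r \<le> 3 * Q"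
  proof -
    have "real (card (?F 1)) \<le> real (3 * (CARD('f) - 1))" using card_isog_fibre_1 by (simp only: of_nat_le_iff)
    then show "r \<le> 3 * Q" using CARD_field_gt_1[where 'f='f] by (simp add: r_def Q_def of_nat_diff)
  qed (simp add: r_def)
  have A_bound: "norm A \<le> Q * sqrt (real CARD('f))"
    unfolding A_def Q_def
  proof (rule trace_zero_sum_bound[where \<Psi> = "\<lambda>d. \<psi> (isog d)", OF _ _ _ u])
    show "\<psi> (isog (x * y)) = \<psi> (isog x) * \<psi> (isog y)" if "x dvd 1" "y dvd 1" for x y
      using TB.character_simps(1)[OF \<psi> isog_in_TB[OF that(1)] isog_in_TB[OF that(2)]] by (simp add: isog_mult)
    show "norm (\<psi> (isog x)) = 1" if "x dvd 1" for x
      by (rule TB.norm_character[OF \<psi> isog_in_TB[OF that] finite_TB])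
    show "\<psi> (isog (\<iota> c)) = 1" if "c \<noteq> 0" for c
      using TB.character_simps(2)[OF \<psi>] that by (simp add: isog_\<iota>)
  qed
  have "A = (\<Sum>x\<in>nodal. \<Sum>d\<in>{d \<in> ?D. isog d = x}. \<psi> (isog d))"
    unfolding A_def
    by (rule sum.group[symmetric]) (auto simp: finite_nodal isog_nodal intro: finite_subset[OF subset_UNIV finite_B])
  also have "\<dots> = (\<Sum>x\<in>nodal. of_nat (card (?F x)) * \<psi> x)"
  proof (rule sum.cong[OF refl])
    fix x
    have "(\<Sum>d\<in>{d \<in> ?D. isog d = x}. \<psi> (isog d)) = (\<Sum>d\<in>?F x. \<psi> x)"
      by (rule sum.cong) auto
    then show "(\<Sum>d\<in>{d \<in> ?D. isog d = x}. \<psi> (isog d)) = of_nat (card (?F x)) * \<psi> x" by simp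
  qed
  also have "\<dots> = of_nat (card (?F 1)) * \<psi> 1 + (\<Sum>x\<in>nodal - {1}. of_nat (card (?F x)) * \<psi> x)"
    by (rule sum.remove[OF finite_nodal one_nodal])
  also have "(\<Sum>x\<in>nodal - {1}. of_nat (card (?F x)) * \<psi> x) = (\<Sum>x\<in>nodal - {1}. of_real Q * \<psi> x)"
    by (rule sum.cong[OF refl])
      (use CARD_field_gt_1[where 'f='f] in \<open>auto simp: card_isog_fibre Q_def of_nat_diff\<close>)
  also have "\<dots> = of_real Q * (S - 1)"
    unfolding sum_distrib_left[symmetric] S_def sum.remove[OF finite_nodal one_nodal]
    using TB.character_simps(2)[OF \<psi>] by simp
  finally have "A = of_real r + of_real Q * (S - 1)"
    using TB.character_simps(2)[OF \<psi>] by (simp add: r_def)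
  then have "of_real Q * S = A + of_real (Q - r)" by (simp add: algebra_simps)
  then have "norm (of_real Q * S) \<le> norm A + norm (of_real (Q - r) :: complex)"
    using norm_triangle_ineq by metis
  then have "Q * norm S \<le> norm A + \<bar>Q - r\<bar>" using Q by (simp only: norm_mult norm_of_real abs_of_pos)
  also have "\<dots> \<le> Q * sqrt (real CARD('f)) + 2 * Q" using A_bound r Q by linarith
  also have "\<dots> = Q * (sqrt (real CARD('f)) + 2)" by (simp add: algebra_simps)
  finally have "norm S \<le> sqrt (real CARD('f)) + 2" using Q by (simp only: mult_le_cancel_left_pos)
  also have "\<dots> \<le> 3 * sqrt (real CARD('f)) + 3" by simp
  finally show ?thesis by (simp add: S_def)
qed

section \<open>From the coset to the nodal cubic\<close>

lemma unit_inverse: "x dvd 1 \<Longrightarrow> x * unit_inverse x = (1 :: 'b)"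
proof -
  assume "x dvd 1"
  then obtain y where y: "x * y = 1" "y * x = 1" by (rule unit_obtain_inverse)
  have "unit_inverse x = y"
    unfolding unit_inverse_def
  proof (rule the_equality)
    fix z assume "x * z = 1"
    then have "y * (x * z) = y" by simp
    then show "z = y" by (simp add: y mult.assoc[symmetric])
  qed (rule y)
  then show ?thesis using y by simp
qed

text \<open>Writing \<open>h = hs * x\<close> turns the trace and norm conditions into
  \<open>x\<close> being nodal, and membership in the coset into \<open>w * x \<in> H\<close> with
  \<open>w\<close> the inverse of \<open>g\<close> times \<open>hs\<close>. Orthogonality expands
  the latter over the annihilator: an exceptional character sums to the full number of nodal points,
  and the others are bounded by \<open>nodal_sum_bound\<close>.\<close>

theorem coset_count:
  fixes H :: "'b set" and g \<gamma> :: 'b and s :: 'f and m :: nat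
  assumes char: "CHAR('f) \<noteq> 3"
    and H: "subgroup H (TB \<iota>)" and m: "card (rcosets\<^bsub>TB \<iota>\<^esub> H) = m"
    and g: "g \<in> carrier (TB \<iota>)" and \<gamma>: "\<gamma> dvd 1"
    and s: "s \<noteq> 0" "s ^ 3 = 27 * Nm \<iota> \<gamma>"
  shows "h_star \<iota> s \<gamma> \<in> carrier (TB \<iota>) \<and>
    (\<exists>R :: complex.
       of_nat (N_nod_coset \<iota> H g s \<gamma>) =
         of_nat (N_nod \<iota> s (Nm \<iota> \<gamma>)) / of_nat m *
           (\<Sum>\<psi>\<in>annihilator (TB \<iota>) H \<inter> exceptional \<iota> e.
              \<psi> (inv\<^bsub>TB \<iota>\<^esub> g \<otimes>\<^bsub>TB \<iota>\<^esub> h_star \<iota> s \<gamma>)) + R \<and>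
       norm R \<le>
         (real m - real (card (annihilator (TB \<iota>) H \<inter> exceptional \<iota> e))) / real m *
           (3 * sqrt (real CARD('f)) + 3))"
proof -
  let ?A = "annihilator (TB \<iota>) H" and ?E = "exceptional \<iota> e" and ?C = "carrier (TB \<iota>)"
  define hs where "hs = h_star \<iota> s \<gamma>"
  have three: "(3 :: 'f) \<noteq> 0"
  proof
    assume "(3 :: 'f) = 0"
    then have "CHAR('f) dvd 3" using of_nat_eq_0_iff_char_dvd[where 'a='f and n=3] by simp
    moreover have "CHAR('f) \<noteq> 1" using of_nat_CHAR[where 'a='f] by (metis of_nat_1 zero_neq_one)
    moreover have "prime (3::nat)" by simp
    ultimately show False using char prime_nat_iff[of 3] by blast
  qed
  have "(27 :: 'f) = 3 ^ 3" by simp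
  then have n27: "(27 :: 'f) \<noteq> 0" using three by (metis power_eq_0_iff)
  \<comment> \<open>The hypothesis on \<open>s\<close> makes \<open>s / 3\<close> a cube root of
    \<open>N(\<gamma>)\<close>; this is why \<open>hs\<close> has norm one and why scaling by
    \<open>s / 3\<close> maps the nodal curve onto the set counted by \<open>N_nod\<close>.\<close>
  have s3: "(s / 3) ^ 3 = Nm \<iota> \<gamma>" using s(2) n27 by (simp add: power_divide)
  have s30: "s / 3 \<noteq> 0" using s(1) three by simp
  have \<gamma>hs: "\<gamma> * hs = \<iota> (s / 3)"
    unfolding hs_def h_star_def mult.left_commute[of \<gamma>] unit_inverse[OF \<gamma>] by simp
  have hsC: "hs \<in> ?C"
  proof -
    have "Nm \<iota> \<gamma> * Nm \<iota> hs = Nm \<iota> (\<iota> (s / 3) * 1)" by (simp flip: Nm_mult add: \<gamma>hs)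
    also have "\<dots> = Nm \<iota> \<gamma> * 1" unfolding Nm_scale s3 Nm_1 ..
    finally show ?thesis using \<gamma> unit_iff_Nm[of \<gamma>] by (simp add: carrier_TB)
  qed
  have N: "N_nod \<iota> s (Nm \<iota> \<gamma>) = card nodal"
  proof -
    have "bij_betw (\<lambda>x. \<iota> (s / 3) * x) nodal {x. x dvd 1 \<and> Tr \<iota> x = s \<and> Nm \<iota> x = Nm \<iota> \<gamma>}"
    proof (rule bij_betw_byWitness[of _ "\<lambda>x. \<iota> (3 / s) * x"])
      have i: "\<iota> (3 / s) * \<iota> (s / 3) = 1" "\<iota> (s / 3) * \<iota> (3 / s) = 1"
        using s(1) three by (simp_all add: \<iota>_simps(1) flip: \<iota>_simps(4))
      show "\<forall>x\<in>nodal. \<iota> (3 / s) * (\<iota> (s / 3) * x) = x"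
        "\<forall>x\<in>{x. x dvd 1 \<and> Tr \<iota> x = s \<and> Nm \<iota> x = Nm \<iota> \<gamma>}. \<iota> (s / 3) * (\<iota> (3 / s) * x) = x"
        by (simp_all add: mult.assoc[symmetric] i)
      show "(\<lambda>x. \<iota> (s / 3) * x) ` nodal \<subseteq> {x. x dvd 1 \<and> Tr \<iota> x = s \<and> Nm \<iota> x = Nm \<iota> \<gamma>}"
      proof (rule image_subsetI)
        fix x assume x: "x \<in> nodal"
        have n: "Nm \<iota> (\<iota> (s / 3) * x) = Nm \<iota> \<gamma>" unfolding Nm_scale s3 using x by (simp add: nodal_def)
        moreover have "Tr \<iota> (\<iota> (s / 3) * x) = s" unfolding Tr_scale using x three by (simp add: nodal_def)
        moreover have "\<iota> (s / 3) * x dvd 1" unfolding unit_iff_Nm n using \<gamma> by (simp add: unit_iff_Nm)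
        ultimately show "\<iota> (s / 3) * x \<in> {x. x dvd 1 \<and> Tr \<iota> x = s \<and> Nm \<iota> x = Nm \<iota> \<gamma>}"
          by blast
      qed
      show "(\<lambda>x. \<iota> (3 / s) * x) ` {x. x dvd 1 \<and> Tr \<iota> x = s \<and> Nm \<iota> x = Nm \<iota> \<gamma>} \<subseteq> nodal"
      proof (rule image_subsetI)
        fix x assume "x \<in> {x. x dvd 1 \<and> Tr \<iota> x = s \<and> Nm \<iota> x = Nm \<iota> \<gamma>}"
        then have "Tr \<iota> x = s" "Nm \<iota> x = Nm \<iota> \<gamma>" by blast+
        then show "\<iota> (3 / s) * x \<in> nodal"
          unfolding nodal_def mem_Collect_eq Nm_scale Tr_scale
          using s three n27 \<gamma> unit_iff_Nm[of \<gamma>] by (simp add: power_divide)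
      qed
    qed
    then show ?thesis unfolding N_nod_def by (rule bij_betw_same_card[symmetric])
  qed
  have HC: "H \<subseteq> ?C" using H by (rule subgroup.subset)
  define w where "w = inv\<^bsub>TB \<iota>\<^esub> g * hs"
  have ig: "inv\<^bsub>TB \<iota>\<^esub> g \<in> ?C" using g by simp
  have wC: "w \<in> ?C" using TB.m_closed[OF ig hsC] by (simp add: w_def)
  have gw: "g * w = hs"
  proof -
    have "g * inv\<^bsub>TB \<iota>\<^esub> g = 1" using TB.r_inv[OF g] by simp
    then show ?thesis by (simp add: w_def mult.assoc[symmetric])
  qed
  have Nc: "N_nod_coset \<iota> H g s \<gamma> = card {x \<in> nodal. w * x \<in> H}"
  proof -
    have "bij_betw (\<lambda>x. hs * x) {x \<in> nodal. w * x \<in> H} {h \<in> g <#\<^bsub>TB \<iota>\<^esub> H. Tr \<iota> (\<gamma> * h) = s}"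
      unfolding bij_betw_def
    proof
      have hsu: "hs dvd 1" using hsC by (simp add: carrier_TB unit_iff_Nm)
      then obtain k where k: "hs * k = 1" "k * hs = 1" by (rule unit_obtain_inverse)
      show "inj_on (\<lambda>x. hs * x) {x \<in> nodal. w * x \<in> H}"
      proof (rule inj_onI)
        fix x y assume "hs * x = hs * y"
        then have "k * hs * x = k * hs * y" by (simp add: mult.assoc)
        then show "x = y" by (simp add: k)
      qed
      have tr: "Tr \<iota> (\<gamma> * (hs * x)) = s \<longleftrightarrow> Tr \<iota> x = 3" for x
      proof -
        have "Tr \<iota> (\<gamma> * (hs * x)) = (s / 3) * Tr \<iota> x"
          by (simp only: mult.assoc[symmetric] \<gamma>hs Tr_scale)
        moreover have "s = (s / 3) * 3" using three by simp
        ultimately show ?thesis using s30 by (metis mult_cancel_left)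
      qed
      show "(\<lambda>x. hs * x) ` {x \<in> nodal. w * x \<in> H} = {h \<in> g <#\<^bsub>TB \<iota>\<^esub> H. Tr \<iota> (\<gamma> * h) = s}"
      proof (intro equalityI subsetI)
        fix h assume "h \<in> (\<lambda>x. hs * x) ` {x \<in> nodal. w * x \<in> H}"
        then obtain x where x: "h = hs * x" "x \<in> nodal" "w * x \<in> H" by blast
        have "h = g \<otimes>\<^bsub>TB \<iota>\<^esub> (w * x)" by (simp add: x(1) gw[symmetric] mult.assoc)
        then have "h \<in> g <#\<^bsub>TB \<iota>\<^esub> H" using x(3) unfolding l_coset_def by blast
        moreover have "Tr \<iota> (\<gamma> * h) = s" unfolding x(1) tr using x(2) by (simp add: nodal_def)
        ultimately show "h \<in> {h \<in> g <#\<^bsub>TB \<iota>\<^esub> H. Tr \<iota> (\<gamma> * h) = s}" by blast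
      next
        fix h assume "h \<in> {h \<in> g <#\<^bsub>TB \<iota>\<^esub> H. Tr \<iota> (\<gamma> * h) = s}"
        then obtain z where z: "h = g * z" "z \<in> H" and th: "Tr \<iota> (\<gamma> * h) = s"
          unfolding l_coset_def by auto
        define x where "x = k * h"
        have hx: "h = hs * x" by (simp add: x_def mult.assoc[symmetric] k)
        have "Nm \<iota> h = 1" using z HC g by (auto simp: Nm_mult carrier_TB)
        then have "Nm \<iota> x = 1" using hsC unfolding hx by (simp add: Nm_mult carrier_TB)
        moreover have "Tr \<iota> x = 3" using th unfolding hx tr .
        ultimately have "x \<in> nodal" by (simp add: nodal_def)
        moreover have "w * x = z"
        proof -
          have "w * x = inv\<^bsub>TB \<iota>\<^esub> g * (hs * x)" by (simp add: w_def mult.assoc)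
          also have "\<dots> = (inv\<^bsub>TB \<iota>\<^esub> g * g) * z" unfolding hx[symmetric] z(1) by (simp add: mult.assoc)
          also have "inv\<^bsub>TB \<iota>\<^esub> g * g = 1" using TB.l_inv[OF g] by simp
          finally show ?thesis by simp
        qed
        ultimately show "h \<in> (\<lambda>x. hs * x) ` {x \<in> nodal. w * x \<in> H}" using hx z(2) by blast
      qed
    qed
    then show ?thesis unfolding N_nod_coset_def by (rule bij_betw_same_card[symmetric])
  qed
  have finA: "finite ?A" using TB.finite_characters[OF finite_TB] by (simp add: annihilator_def)
  have cA: "card ?A = m" using TB.annihilator_orthogonality(1)[OF H finite_TB TB.one_closed] m by simp
  have m0: "m > 0"
  proof -
    have "card (rcosets\<^bsub>TB \<iota>\<^esub> H) * card H = Coset.order (TB \<iota>)" by (rule TB.lagrange[OF H])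
    moreover have "Coset.order (TB \<iota>) > 0" using finite_TB by (simp add: TB.order_gt_0_iff_finite)
    ultimately show ?thesis using m by (metis mult_is_0 not_gr_zero)
  qed
  define S where "S \<psi> = (\<Sum>x\<in>nodal. \<psi> x)" for \<psi> :: "'b \<Rightarrow> complex"
  have chars: "\<psi> \<in> characters (TB \<iota>)" if "\<psi> \<in> ?A" for \<psi> using that by (simp add: annihilator_def)
  have "of_nat m * of_nat (N_nod_coset \<iota> H g s \<gamma>) = (\<Sum>x\<in>nodal. if w * x \<in> H then of_nat m else (0::complex))"
    unfolding Nc using finite_nodal by (simp add: sum.If_cases Int_def)
  also have "\<dots> = (\<Sum>x\<in>nodal. \<Sum>\<psi>\<in>?A. \<psi> (w * x))"
  proof (rule sum.cong[OF refl])
    fix x assume "x \<in> nodal"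
    then have "w * x \<in> ?C" using TB.m_closed[OF wC nodal_TB] by simp
    from TB.annihilator_orthogonality(2)[OF H finite_TB this]
    show "(if w * x \<in> H then of_nat m else 0) = (\<Sum>\<psi>\<in>?A. \<psi> (w * x))" using m by simp
  qed
  also have "\<dots> = (\<Sum>\<psi>\<in>?A. \<Sum>x\<in>nodal. \<psi> (w * x))" by (rule sum.swap)
  also have "\<dots> = (\<Sum>\<psi>\<in>?A. \<psi> w * S \<psi>)"
  proof (rule sum.cong[OF refl])
    fix \<psi> assume "\<psi> \<in> ?A"
    have "\<psi> (w * x) = \<psi> w * \<psi> x" if "x \<in> nodal" for x
      using TB.character_simps(1)[OF chars[OF \<open>\<psi> \<in> ?A\<close>] wC nodal_TB[OF that]] by simp
    then show "(\<Sum>x\<in>nodal. \<psi> (w * x)) = \<psi> w * S \<psi>" unfolding S_def sum_distrib_left by (rule sum.cong[OF refl])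
  qed
  also have "\<dots> = (\<Sum>\<psi>\<in>?A \<inter> ?E. \<psi> w * S \<psi>) + (\<Sum>\<psi>\<in>?A - ?E. \<psi> w * S \<psi>)"
    using sum.Int_Diff[OF finA] by blast
  also have "(\<Sum>\<psi>\<in>?A \<inter> ?E. \<psi> w * S \<psi>) = of_nat (card nodal) * (\<Sum>\<psi>\<in>?A \<inter> ?E. \<psi> w)"
    unfolding sum_distrib_left
  proof (rule sum.cong[OF refl])
    fix \<psi> assume \<psi>: "\<psi> \<in> ?A \<inter> ?E"
    then have c: "\<psi> \<in> characters (TB \<iota>)" using chars by blast
    have "S \<psi> = of_nat (card nodal)" unfolding S_def
      by (rule nodal_sum_trivial[OF c]) (use exceptional_iff[OF char c] \<psi> in blast)
    then show "\<psi> w * S \<psi> = of_nat (card nodal) * \<psi> w" by (simp add: mult.commute)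
  qed
  finally have main: "of_nat m * of_nat (N_nod_coset \<iota> H g s \<gamma>) =
      of_nat (card nodal) * (\<Sum>\<psi>\<in>?A \<inter> ?E. \<psi> w) + (\<Sum>\<psi>\<in>?A - ?E. \<psi> w * S \<psi>)" .
  define R where "R = (\<Sum>\<psi>\<in>?A - ?E. \<psi> w * S \<psi>) / of_nat m"
  have eq: "of_nat (N_nod_coset \<iota> H g s \<gamma>) =
      of_nat (N_nod \<iota> s (Nm \<iota> \<gamma>)) / of_nat m * (\<Sum>\<psi>\<in>?A \<inter> ?E. \<psi> w) + R"
    using main m0 unfolding N R_def by (simp add: field_simps)
  have "norm (\<Sum>\<psi>\<in>?A - ?E. \<psi> w * S \<psi>) \<le> (\<Sum>\<psi>\<in>?A - ?E. 3 * sqrt (real CARD('f)) + 3)"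
  proof (rule sum_norm_le)
    fix \<psi> assume \<psi>: "\<psi> \<in> ?A - ?E"
    then have c: "\<psi> \<in> characters (TB \<iota>)" using chars by blast
    obtain u where u: "u dvd 1" "\<psi> (isog u) \<noteq> 1" using exceptional_iff[OF char c] \<psi> by blast
    show "norm (\<psi> w * S \<psi>) \<le> 3 * sqrt (real CARD('f)) + 3"
      using nodal_sum_bound[OF c u] TB.norm_character[OF c wC finite_TB]
      by (simp add: norm_mult S_def)
  qed
  also have "\<dots> = real (card (?A - ?E)) * (3 * sqrt (real CARD('f)) + 3)" by simp
  also have "real (card (?A - ?E)) = real m - real (card (?A \<inter> ?E))"
  proof -
    have "card ?A = card (?A \<inter> ?E) + card (?A - ?E)"
      using card_Un_disjoint[of "?A \<inter> ?E" "?A - ?E"] finA by (simp add: Int_Diff_Un Int_Diff_disjoint)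
    then show ?thesis using cA by simp
  qed
  finally have "norm R \<le> (real m - real (card (?A \<inter> ?E))) / real m * (3 * sqrt (real CARD('f)) + 3)"
    using m0 by (simp add: R_def norm_divide divide_right_mono)
  then show ?thesis using eq hsC unfolding w_def hs_def mult_TB by blast
qed

end

theorem theorem5p21:
  fixes \<iota> :: "'f::{field,finite} \<Rightarrow> 'b::comm_ring_1"
    and e :: "3 \<Rightarrow> 'b \<Rightarrow> 'f alg_closure"
    and H :: "'b set" and g \<gamma> :: 'b and s :: 'f and m :: nat
  assumes "CHAR('f) \<noteq> 2" and "CHAR('f) \<noteq> 3"
    and "etale_cubic \<iota>"
    and "bij_betw e UNIV (geometric_embeddings \<iota>)"
    and "subgroup H (TB \<iota>)" and "card (rcosets\<^bsub>TB \<iota>\<^esub> H) = m"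
    and "g \<in> carrier (TB \<iota>)" and "\<gamma> dvd 1"
    and "s \<noteq> 0" and "s ^ 3 = 27 * Nm \<iota> \<gamma>"
  shows "h_star \<iota> s \<gamma> \<in> carrier (TB \<iota>) \<and>
    (\<exists>R :: complex.
       of_nat (N_nod_coset \<iota> H g s \<gamma>) =
         of_nat (N_nod \<iota> s (Nm \<iota> \<gamma>)) / of_nat m *
           (\<Sum>\<psi>\<in>annihilator (TB \<iota>) H \<inter> exceptional \<iota> e.
              \<psi> (inv\<^bsub>TB \<iota>\<^esub> g \<otimes>\<^bsub>TB \<iota>\<^esub> h_star \<iota> s \<gamma>)) + R \<and>
       norm R \<le>
         (real m - real (card (annihilator (TB \<iota>) H \<inter> exceptional \<iota> e))) / real m *
           (3 * sqrt (real CARD('f)) + 3))"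
proof -
  interpret cubic_algebra \<iota> e
    using assms(3,4) by unfold_locales (auto simp: etale_cubic_def)
  show ?thesis by (rule coset_count) (use assms in auto)
qed

end
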